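(* Let $N$ be a positive integer with $k=T/N<1$, $t_n=nk$, let $\epsilon\in(0,1)$, and let $\gamma$ be the sum-of-exponentials kernel below. Define the fast scheme \[ x_n=x_0+\sum_{j=1}^n b(x_{j-1})\int_{t_{j-1}}^{t_j}\gamma(t_n-s)\,ds+G(t_n),\qquad 0\le n\le N, \] using the same realization of $x_0$ and $G$ as the exact solution. (1) Assume $\mathbb E(|x_0|^2+|b(x_0)|^2)<\infty$. Then there is $C(T)$ independent of $k$ and $\epsilon$ with \[ \sup_{0\le n\le N}\|x_n-x(t_n)\|\le C(T)\big(k^{H+\alpha-1}+\epsilon\big); \] in particular, if $\epsilon=k^{H+\alpha-1}$ then $\sup_n\|x_n-x(t_n)\|\le C(T)k^{H+\alpha-1}$. (2) Assume $\alpha=2-2H$, $b(x)=Bx$ for a constant $d\times d$ matrix $B$, $\mathbb E|x_0|^2<\infty$, and $\epsilon=k^{\min(3/2-H,\,3-3H)}$. Then \[ \sup_{0\le n\le N}\|x_n-x(t_n)\|\le \begin{cases} C(T,H)\,k^{3-3H}, & H\in(3/4,1),\\ C(T,H)\,\sqrt{|\ln k|}\,k^{3/4}, & H=3/4,\\ C(T,H)\,k^{3/2-H}, & H\in(1/2,3/4), \end{cases} \] with $C(T,H)$ independent of $k$.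
   Context: Fix $T>0$, $d\ge1$, $\alpha\in(0,1)$, $H\in(1/2,1)$, $\sigma>0$. On a probability space let $x_0$ be an $\mathbb R^d$-valued random variable and $B_H$ a $d$-dimensional process with independent fractional Brownian motion components of Hurst index $H$ (centered Gaussian, $B_H^i(0)=0$, covariance $\tfrac12(t^{2H}+s^{2H}-|t-s|^{2H})$). Let $b:\mathbb R^d\to\mathbb R^d$ satisfy $|b(x)-b(y)|\le L|x-y|$. Let $G(t)=\frac{\sigma}{\Gamma(\alpha)}\int_0^t (t-s)^{\alpha-1}\,dB_H(s)$ and let $x(t)$, $t\in[0,T]$, be the unique continuous strong solution of $x(t)=x_0+\frac{1}{\Gamma(\alpha)}\int_0^t (t-s)^{\alpha-1} b(x(s))\,ds+G(t)$. Let $\omega_i,s_i>0$ ($1\le i\le M$) satisfy $\big|t^{\alpha-1}-\sum_{i=1}^M\omega_ie^{-s_it}\big|\le\epsilon$ for all $t\in[k,T]$, and set \[ \gamma(t)=\begin{cases}\frac{1}{\Gamma(\alpha)}t^{\alpha-1}, & 0<t\le k,\\[2pt] \frac{1}{\Gamma(\alpha)}\sum_{i=1}^M\omega_ie^{-s_it}, & t>k.\end{cases} \] $\|v\|:=\sqrt{\mathbb E|v|^2}$. *)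

theory Defs
  imports "HOL-Probability.Probability"
begin

definition fbm_cov :: "real \<Rightarrow> real \<Rightarrow> real \<Rightarrow> real" where
  "fbm_cov H t s = (t powr (2*H) + s powr (2*H) - \<bar>t - s\<bar> powr (2*H)) / 2"

definition centered_gaussian_rv :: "'w measure \<Rightarrow> ('w \<Rightarrow> real) \<Rightarrow> real \<Rightarrow> bool" where
  "centered_gaussian_rv P X v \<longleftrightarrow> X \<in> borel_measurable P \<and>
     (if v = 0 then (AE w in P. X w = 0)
      else distributed P lborel X (normal_density 0 (sqrt v)))"

text \<open>B is a d-dimensional process (t \<ge> 0) whose components are independent fractional
  Brownian motions of Hurst index H: the family (B_i(t)) is jointly centered Gaussian with
  covariance E[B_i(t) B_j(s)] = [i = j] * fbm_cov H t s.\<close>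
definition is_fBm :: "'w measure \<Rightarrow> real \<Rightarrow> (real \<Rightarrow> 'w \<Rightarrow> real^'d) \<Rightarrow> bool" where
  "is_fBm P H B \<longleftrightarrow>
     (\<forall>(I :: (real \<times> 'd) set) (c :: real \<times> 'd \<Rightarrow> real).
        finite I \<and> I \<subseteq> {0..} \<times> UNIV \<longrightarrow>
        centered_gaussian_rv P (\<lambda>w. \<Sum>p\<in>I. c p * (B (fst p) w $ snd p))
          (\<Sum>p\<in>I. \<Sum>q\<in>I. c p * c q *
              (if snd p = snd q then fbm_cov H (fst p) (fst q) else 0)))"

definition L2_lim :: "'w measure \<Rightarrow> (nat \<Rightarrow> 'w \<Rightarrow> real^'d) \<Rightarrow> ('w \<Rightarrow> real^'d) \<Rightarrow> bool" where
  "L2_lim P Y X \<longleftrightarrow> (\<forall>n. integrable P (\<lambda>w. (norm (Y n w - X w))\<^sup>2)) \<and>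
     (\<lambda>n. integral\<^sup>L P (\<lambda>w. (norm (Y n w - X w))\<^sup>2)) \<longlonglongrightarrow> 0"

text \<open>G(t) = sigma/Gamma(alpha) * int_0^t (t-s)^(alpha-1) dB_H(s) for t in [0,T], the Wiener
  integral realised as the mean-square limit of left-point Riemann sums on uniform partitions.\<close>
definition is_RL_fBm_integral ::
  "'w measure \<Rightarrow> real \<Rightarrow> real \<Rightarrow> (real \<Rightarrow> 'w \<Rightarrow> real^'d) \<Rightarrow> real \<Rightarrow> (real \<Rightarrow> 'w \<Rightarrow> real^'d) \<Rightarrow> bool" where
  "is_RL_fBm_integral P \<alpha> \<sigma> B T G \<longleftrightarrow>
     (\<forall>t\<in>{0..T}. G t \<in> borel_measurable P \<and>
        L2_lim P (\<lambda>n w. (\<sigma> / Gamma \<alpha>) *\<^sub>R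
             (\<Sum>i<n. ((t - t * real i / real n) powr (\<alpha> - 1)) *\<^sub>R
                 (B (t * real (Suc i) / real n) w - B (t * real i / real n) w))) (G t))"

definition is_RL_solution ::
  "'w measure \<Rightarrow> real \<Rightarrow> (real^'d \<Rightarrow> real^'d) \<Rightarrow> ('w \<Rightarrow> real^'d) \<Rightarrow> (real \<Rightarrow> 'w \<Rightarrow> real^'d)
    \<Rightarrow> real \<Rightarrow> (real \<Rightarrow> 'w \<Rightarrow> real^'d) \<Rightarrow> bool" where
  "is_RL_solution P \<alpha> b x0 G T x \<longleftrightarrow>
     (\<forall>w\<in>space P. continuous_on {0..T} (\<lambda>t. x t w)) \<and>
     (\<forall>t\<in>{0..T}. x t \<in> borel_measurable P) \<and>
     (\<forall>t\<in>{0..T}. AE w in P.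
        x t w = x0 w + (1 / Gamma \<alpha>) *\<^sub>R
                 (LINT s:{0..t}|lborel. ((t - s) powr (\<alpha> - 1)) *\<^sub>R b (x s w)) + G t w)"

definition soe_approx :: "real \<Rightarrow> real \<Rightarrow> real \<Rightarrow> real \<Rightarrow> nat \<Rightarrow> (nat \<Rightarrow> real) \<Rightarrow> (nat \<Rightarrow> real) \<Rightarrow> bool" where
  "soe_approx \<alpha> k T \<epsilon> M \<omega> s \<longleftrightarrow> 0 < M \<and> (\<forall>i<M. 0 < \<omega> i \<and> 0 < s i) \<and>
     (\<forall>t\<in>{k..T}. \<bar>t powr (\<alpha> - 1) - (\<Sum>i<M. \<omega> i * exp (- s i * t))\<bar> \<le> \<epsilon>)"

definition soe_kernel :: "real \<Rightarrow> real \<Rightarrow> nat \<Rightarrow> (nat \<Rightarrow> real) \<Rightarrow> (nat \<Rightarrow> real) \<Rightarrow> real \<Rightarrow> real" where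
  "soe_kernel \<alpha> k M \<omega> s t =
     (if t \<le> k then t powr (\<alpha> - 1) / Gamma \<alpha>
      else (\<Sum>i<M. \<omega> i * exp (- s i * t)) / Gamma \<alpha>)"

definition fast_scheme ::
  "'w measure \<Rightarrow> real \<Rightarrow> real \<Rightarrow> nat \<Rightarrow> nat \<Rightarrow> (nat \<Rightarrow> real) \<Rightarrow> (nat \<Rightarrow> real)
    \<Rightarrow> ('w \<Rightarrow> real^'d) \<Rightarrow> (real^'d \<Rightarrow> real^'d) \<Rightarrow> (real \<Rightarrow> 'w \<Rightarrow> real^'d)
    \<Rightarrow> (nat \<Rightarrow> 'w \<Rightarrow> real^'d) \<Rightarrow> bool" where
  "fast_scheme P \<alpha> T N M \<omega> s x0 b G X \<longleftrightarrow>
     (let k = T / real N in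
      \<forall>n\<le>N. \<forall>w\<in>space P.
        X n w = x0 w
          + (\<Sum>j\<in>{1..n}. (LINT u:{real (j - 1) * k .. real j * k}|lborel.
                               soe_kernel \<alpha> k M \<omega> s (real n * k - u)) *\<^sub>R b (X (j - 1) w))
          + G (real n * k) w)"

end

theory Submission
  imports Defs
begin

text \<open>
  Since \<open>H > 1/2\<close>, the covariance of fractional Brownian increments is the integral of
  \<open>H(2H-1)|u-v|^(2H-2)\<close> over rectangles, so \<open>E|G(t)-G(s)|^2\<close> is a double integral of
  Riemann--Liouville kernels against this density. Splitting it along the diagonal, the inner
  integrals are Beta integrals and, with \<open>h = t-s\<close> and \<open>\<rho> = \<alpha>+2H-2\<close>,
  \<open>E|G(t)-G(s)|^2 = c (h^(\<alpha>+\<rho>)/(\<alpha>+\<rho>) + \<integral>_0^s ((h+w)^(\<alpha>-1) - w^(\<alpha>-1)) ((h+w)^\<rho> - w^\<rho>) dw)\<close>.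
  This is at most \<open>C h^(2(\<alpha>+H-1))\<close>, hence \<open>G\<close> and then \<open>x\<close> are Hoelder continuous in mean square
  with exponent \<open>\<alpha>+H-1\<close>. The error of the scheme is a kernel error of size \<open>\<epsilon>\<close> plus the
  residual \<open>\<integral> K(t_n-s) (b(x(t_(j-1))) - b(x(s))) ds\<close>, and a Gronwall argument with exponential
  weights gives the first part.

  If \<open>\<alpha> = 2-2H\<close> then \<open>\<rho> = 0\<close>, the second integral vanishes, and \<open>G\<close> has exactly the increments
  of a fractional Brownian motion of Hurst index \<open>1-H\<close>. Its increments over cells of the grid
  at distance \<open>m\<close> have correlation of order \<open>k^\<alpha> m^(\<alpha>-2)\<close>, which is summable in \<open>m\<close>; for linear
  \<open>b\<close> the noise part of the residual is therefore of order
  \<open>(k^(3\<alpha>) \<Sum>_(l \<le> N) l^(2\<alpha>-2))^(1/2)\<close>, whose three regimes are those of the second part. The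
  drift part of the residual is smaller because the fractional integral gains regularity.
\<close>

section \<open>Mean square bounds\<close>

definition L2_le :: "'w measure \<Rightarrow> ('w \<Rightarrow> 'a::euclidean_space) \<Rightarrow> real \<Rightarrow> bool" where
  "L2_le P Z A \<longleftrightarrow> Z \<in> borel_measurable P \<and> 0 \<le> A \<and>
     (\<integral>\<^sup>+w. ennreal ((norm (Z w))\<^sup>2) \<partial>P) \<le> ennreal (A\<^sup>2)"

lemma L2_leD:
  assumes "L2_le P Z A"
  shows "Z \<in> borel_measurable P" "0 \<le> A" "integrable P (\<lambda>w. (norm (Z w))\<^sup>2)"
    "(\<integral>w. (norm (Z w))\<^sup>2 \<partial>P) \<le> A\<^sup>2"
proof -
  show [measurable]: "Z \<in> borel_measurable P" and "0 \<le> A"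
    using assms by (auto simp: L2_le_def)
  have le: "(\<integral>\<^sup>+w. ennreal ((norm (Z w))\<^sup>2) \<partial>P) \<le> ennreal (A\<^sup>2)"
    using assms by (simp add: L2_le_def)
  show int: "integrable P (\<lambda>w. (norm (Z w))\<^sup>2)"
    by (rule integrableI_nonneg) (use le in \<open>auto intro: le_less_trans simp: less_top\<close>)
  show "(\<integral>w. (norm (Z w))\<^sup>2 \<partial>P) \<le> A\<^sup>2"
    using le nn_integral_eq_integral[OF int] by (simp add: ennreal_le_iff)
qed

lemma L2_leI:
  assumes [measurable]: "Z \<in> borel_measurable P" and "0 \<le> A"
    and "integrable P (\<lambda>w. (norm (Z w))\<^sup>2)" "(\<integral>w. (norm (Z w))\<^sup>2 \<partial>P) \<le> A\<^sup>2"
  shows "L2_le P Z A"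
  using assms nn_integral_eq_integral[OF assms(3)] by (simp add: L2_le_def ennreal_le_iff)

lemma L2_le_mono:
  assumes "L2_le P Z A" "A \<le> A'"
  shows "L2_le P Z A'"
proof -
  have "A\<^sup>2 \<le> A'\<^sup>2" using assms by (intro power_mono) (auto simp: L2_le_def)
  then show ?thesis
    using assms by (auto simp: L2_le_def intro: order_trans ennreal_leI)
qed

lemma L2_le_bound:
  assumes "L2_le P Z A" and [measurable]: "Y \<in> borel_measurable P"
    and "AE w in P. norm (Y w) \<le> norm (Z w)"
  shows "L2_le P Y A"
proof -
  have "(\<integral>\<^sup>+w. ennreal ((norm (Y w))\<^sup>2) \<partial>P) \<le> (\<integral>\<^sup>+w. ennreal ((norm (Z w))\<^sup>2) \<partial>P)"
    by (rule nn_integral_mono_AE) (use assms(3) in \<open>auto intro!: ennreal_leI power_mono\<close>)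
  with assms show ?thesis by (auto simp: L2_le_def)
qed

lemma L2_le_cong_AE:
  assumes "L2_le P Z A" "Y \<in> borel_measurable P" "AE w in P. Y w = Z w"
  shows "L2_le P Y A"
  by (rule L2_le_bound[OF assms(1,2)]) (use assms(3) in auto)

lemma nn_integral_mult_le_L2:
  assumes [measurable]: "f \<in> borel_measurable M" "g \<in> borel_measurable M"
    and "(\<integral>\<^sup>+w. (f w)\<^sup>2 \<partial>M) \<le> ennreal (a\<^sup>2)" "(\<integral>\<^sup>+w. (g w)\<^sup>2 \<partial>M) \<le> ennreal (b\<^sup>2)" "0 \<le> a" "0 \<le> b"
  shows "(\<integral>\<^sup>+w. f w * g w \<partial>M) \<le> ennreal (a * b)"
proof -
  have "(\<integral>\<^sup>+w. f w * g w \<partial>M)\<^sup>2 \<le> (\<integral>\<^sup>+w. (f w)\<^sup>2 \<partial>M) * (\<integral>\<^sup>+w. (g w)\<^sup>2 \<partial>M)"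
    by (rule Cauchy_Schwarz_nn_integral) auto
  also have "\<dots> \<le> ennreal (a\<^sup>2) * ennreal (b\<^sup>2)"
    using assms by (intro mult_mono) auto
  also have "\<dots> = (ennreal (a * b))\<^sup>2"
    using assms by (simp add: ennreal_mult ennreal_power power_mult_distrib)
  finally have *: "(\<integral>\<^sup>+w. f w * g w \<partial>M)\<^sup>2 \<le> (ennreal (a * b))\<^sup>2" .
  show ?thesis
  proof (cases "\<integral>\<^sup>+w. f w * g w \<partial>M")
    case (real r)
    then have "r\<^sup>2 \<le> (a * b)\<^sup>2" using * assms by (simp add: ennreal_power ennreal_le_iff)
    then show ?thesis using real assms by (auto intro!: ennreal_leI power2_le_imp_le)
  next
    case top
    then show ?thesis using * assms by (simp add: ennreal_power power2_eq_square ennreal_mult_eq_top_iff top_unique)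
  qed
qed

lemma L2_le_add:
  assumes "L2_le P Y A" "L2_le P Z C"
  shows "L2_le P (\<lambda>w. Y w + Z w) (A + C)"
proof -
  have [measurable]: "Y \<in> borel_measurable P" "Z \<in> borel_measurable P" and [simp]: "0 \<le> A" "0 \<le> C"
    using assms by (auto simp: L2_le_def)
  have "(\<integral>\<^sup>+w. ennreal ((norm (Y w + Z w))\<^sup>2) \<partial>P) \<le>
     (\<integral>\<^sup>+w. ennreal ((norm (Y w))\<^sup>2) + 2 * (ennreal (norm (Y w)) * ennreal (norm (Z w)))
        + ennreal ((norm (Z w))\<^sup>2) \<partial>P)"
  proof (rule nn_integral_mono)
    fix w
    have "(norm (Y w + Z w))\<^sup>2 \<le> (norm (Y w) + norm (Z w))\<^sup>2"
      by (intro power_mono norm_triangle_ineq) auto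
    also have "\<dots> = (norm (Y w))\<^sup>2 + 2 * (norm (Y w) * norm (Z w)) + (norm (Z w))\<^sup>2"
      by (simp add: power2_sum)
    finally have "ennreal ((norm (Y w + Z w))\<^sup>2) \<le>
        ennreal ((norm (Y w))\<^sup>2 + 2 * (norm (Y w) * norm (Z w)) + (norm (Z w))\<^sup>2)"
      by (rule ennreal_leI)
    then show "ennreal ((norm (Y w + Z w))\<^sup>2) \<le> ennreal ((norm (Y w))\<^sup>2)
        + 2 * (ennreal (norm (Y w)) * ennreal (norm (Z w))) + ennreal ((norm (Z w))\<^sup>2)"
      by (simp add: ennreal_plus ennreal_mult)
  qed
  also have "\<dots> = (\<integral>\<^sup>+w. ennreal ((norm (Y w))\<^sup>2) \<partial>P)
      + 2 * (\<integral>\<^sup>+w. ennreal (norm (Y w)) * ennreal (norm (Z w)) \<partial>P)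
      + (\<integral>\<^sup>+w. ennreal ((norm (Z w))\<^sup>2) \<partial>P)"
    by (simp add: nn_integral_add nn_integral_cmult)
  also have "\<dots> \<le> ennreal (A\<^sup>2) + 2 * ennreal (A * C) + ennreal (C\<^sup>2)"
    using assms by (intro add_mono mult_left_mono nn_integral_mult_le_L2)
      (auto simp: L2_le_def ennreal_power)
  also have "\<dots> = ennreal ((A + C)\<^sup>2)"
    by (simp add: power2_sum ennreal_plus ennreal_mult mult.assoc)
  finally show ?thesis by (simp add: L2_le_def)
qed

lemma L2_le_scaleR:
  assumes "L2_le P Z A"
  shows "L2_le P (\<lambda>w. c *\<^sub>R Z w) (\<bar>c\<bar> * A)"
proof -
  have [measurable]: "Z \<in> borel_measurable P" using assms by (simp add: L2_le_def)
  have "(\<integral>\<^sup>+w. ennreal ((norm (c *\<^sub>R Z w))\<^sup>2) \<partial>P) = ennreal (c\<^sup>2) * (\<integral>\<^sup>+w. ennreal ((norm (Z w))\<^sup>2) \<partial>P)"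
    by (simp add: power_mult_distrib ennreal_mult nn_integral_cmult)
  also have "\<dots> \<le> ennreal (c\<^sup>2) * ennreal (A\<^sup>2)"
    using assms by (intro mult_left_mono) (auto simp: L2_le_def)
  finally show ?thesis
    using assms by (simp add: L2_le_def ennreal_mult power_mult_distrib)
qed

lemma L2_le_norm_bound:
  assumes "L2_le P Z A" and [measurable]: "Y \<in> borel_measurable P" and "0 \<le> c"
    and "AE w in P. norm (Y w) \<le> c * norm (Z w)"
  shows "L2_le P Y (c * A)"
proof -
  have "L2_le P (\<lambda>w. c *\<^sub>R Z w) (c * A)"
    using L2_le_scaleR[OF assms(1), of c] assms(3) by simp
  then show ?thesis by (rule L2_le_bound) (use assms in auto)
qed

lemma L2_le_diff:
  assumes "L2_le P Y A" "L2_le P Z C"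
  shows "L2_le P (\<lambda>w. Y w - Z w) (A + C)"
  using L2_le_add[OF assms(1) L2_le_scaleR[OF assms(2), of "-1"]] by simp

lemma L2_le_zero: "L2_le P (\<lambda>w. 0) 0"
  by (simp add: L2_le_def)

lemma L2_le_sum:
  assumes "\<And>i. i \<in> I \<Longrightarrow> L2_le P (Z i) (A i)" "finite I"
  shows "L2_le P (\<lambda>w. \<Sum>i\<in>I. Z i w) (\<Sum>i\<in>I. A i)"
  using assms(2,1) by (induction rule: finite_induct) (auto intro: L2_le_zero L2_le_add)

lemma (in prob_space) L2_le_const: "L2_le M (\<lambda>w. c) (norm c)"
  by (simp add: L2_le_def emeasure_space_1)

lemma L2_le_tendsto:
  assumes "\<And>n. L2_le P Z (A n)" "A \<longlonglongrightarrow> a"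
  shows "L2_le P Z a"
proof -
  have "0 \<le> a" using assms by (intro LIMSEQ_le_const[OF assms(2)]) (auto simp: L2_le_def)
  moreover have "(\<lambda>n. ennreal ((A n)\<^sup>2)) \<longlonglongrightarrow> ennreal (a\<^sup>2)"
    by (intro tendsto_ennrealI tendsto_power assms)
  then have "(\<integral>\<^sup>+w. ennreal ((norm (Z w))\<^sup>2) \<partial>P) \<le> ennreal (a\<^sup>2)"
    by (rule LIMSEQ_le_const) (use assms in \<open>auto simp: L2_le_def\<close>)
  ultimately show ?thesis using assms by (auto simp: L2_le_def)
qed

lemma L2_le_Fatou:
  assumes "\<And>n. L2_le P (Y n) A" and [measurable]: "Z \<in> borel_measurable P"
    and "AE w in P. (\<lambda>n. Y n w) \<longlonglongrightarrow> Z w"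
  shows "L2_le P Z A"
proof -
  have [measurable]: "Y n \<in> borel_measurable P" for n using assms(1) by (auto simp: L2_le_def)
  have "(\<integral>\<^sup>+w. ennreal ((norm (Z w))\<^sup>2) \<partial>P) = (\<integral>\<^sup>+w. liminf (\<lambda>n. ennreal ((norm (Y n w))\<^sup>2)) \<partial>P)"
  proof (rule nn_integral_cong_AE)
    show "AE w in P. ennreal ((norm (Z w))\<^sup>2) = liminf (\<lambda>n. ennreal ((norm (Y n w))\<^sup>2))"
      using assms(3)
    proof eventually_elim
      case (elim w)
      then have "(\<lambda>n. ennreal ((norm (Y n w))\<^sup>2)) \<longlonglongrightarrow> ennreal ((norm (Z w))\<^sup>2)"
        by (intro tendsto_ennrealI tendsto_power tendsto_norm)
      from lim_imp_Liminf[OF _ this] show ?case by simp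
    qed
  qed
  also have "\<dots> \<le> liminf (\<lambda>n. \<integral>\<^sup>+w. ennreal ((norm (Y n w))\<^sup>2) \<partial>P)"
    by (rule nn_integral_liminf) auto
  also have "\<dots> \<le> liminf (\<lambda>n::nat. ennreal (A\<^sup>2))"
    by (rule Liminf_mono) (use assms(1) in \<open>auto simp: L2_le_def\<close>)
  finally show ?thesis using assms(1)[of 0] by (auto simp: L2_le_def Liminf_const)
qed

lemma measurable_joint_compose:
  assumes "(\<lambda>p. Z (fst p) (snd p)) \<in> measurable (M \<Otimes>\<^sub>M N) K"
    and "f \<in> measurable L M" "g \<in> measurable L N"
  shows "(\<lambda>x. Z (f x) (g x)) \<in> measurable L K"
  using measurable_compose[OF measurable_Pair[OF assms(2,3)] assms(1)] by simp

lemma L2_le_integral: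
  fixes Z :: "real \<Rightarrow> 'w \<Rightarrow> 'a::euclidean_space" and K \<phi> :: "real \<Rightarrow> real"
  assumes "sigma_finite_measure P"
    and [measurable]: "(\<lambda>p. Z (fst p) (snd p)) \<in> borel_measurable (lborel \<Otimes>\<^sub>M P)" "K \<in> borel_measurable borel"
      "\<phi> \<in> borel_measurable borel"
    and Z: "\<And>s. K s \<noteq> 0 \<Longrightarrow> L2_le P (Z s) (\<phi> s)"
    and A: "(\<integral>\<^sup>+s. ennreal (\<bar>K s\<bar> * \<phi> s) \<partial>lborel) \<le> ennreal A" "0 \<le> A"
  shows "L2_le P (\<lambda>w. \<integral>s. K s *\<^sub>R Z s w \<partial>lborel) A"
proof -
  interpret P: sigma_finite_measure P by fact
  interpret pair_sigma_finite lborel P ..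
  define z where "z = (\<lambda>s w. ennreal (norm (Z s w)))"
  define k where "k = (\<lambda>s. ennreal \<bar>K s\<bar>)"
  note jZ = measurable_joint_compose[of Z, OF assms(2)]
  have [measurable]: "k \<in> borel_measurable borel" unfolding k_def by measurable
  have jz: "(\<lambda>x. z (f x) (g x)) \<in> borel_measurable L"
    if "f \<in> measurable L lborel" "g \<in> measurable L P" for L and f :: "'c \<Rightarrow> real" and g :: "'c \<Rightarrow> 'w"
    unfolding z_def using jZ[OF that] by simp
  have [measurable]: "z s \<in> borel_measurable P" for s
    using jz[of "\<lambda>_. s" P "\<lambda>w. w"] by simp
  have mint [measurable]: "(\<lambda>w. \<integral>s. K s *\<^sub>R Z s w \<partial>lborel) \<in> borel_measurable P"
    by (rule lborel.borel_measurable_lebesgue_integral)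
      (auto simp: case_prod_unfold intro!: borel_measurable_scaleR jZ)
  have "(\<integral>\<^sup>+w. ennreal ((norm (\<integral>s. K s *\<^sub>R Z s w \<partial>lborel))\<^sup>2) \<partial>P)
      \<le> (\<integral>\<^sup>+w. (\<integral>\<^sup>+s. k s * z s w \<partial>lborel)\<^sup>2 \<partial>P)"
  proof (rule nn_integral_mono)
    fix w assume "w \<in> space P"
    have "ennreal (norm (\<integral>s. K s *\<^sub>R Z s w \<partial>lborel)) \<le> (\<integral>\<^sup>+s. k s * z s w \<partial>lborel)"
    proof (cases "integrable lborel (\<lambda>s. K s *\<^sub>R Z s w)")
      case True
      from integral_norm_bound_ennreal[OF this] show ?thesis
        by (simp add: k_def z_def ennreal_mult)
    next
      case False
      then show ?thesis by (simp add: not_integrable_integral_eq)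
    qed
    then show "ennreal ((norm (\<integral>s. K s *\<^sub>R Z s w \<partial>lborel))\<^sup>2) \<le> (\<integral>\<^sup>+s. k s * z s w \<partial>lborel)\<^sup>2"
      by (simp add: power_mono flip: ennreal_power)
  qed
  also have "\<dots> = (\<integral>\<^sup>+w. (\<integral>\<^sup>+s. (\<integral>\<^sup>+r. k s * k r * (z s w * z r w) \<partial>lborel) \<partial>lborel) \<partial>P)"
  proof (rule nn_integral_cong)
    fix w assume w: "w \<in> space P"
    have [measurable]: "(\<lambda>s. z s w) \<in> borel_measurable lborel"
      using jz[of "\<lambda>s. s" lborel "\<lambda>_. w"] w by simp
    have "(\<integral>\<^sup>+s. k s * z s w \<partial>lborel)\<^sup>2 = (\<integral>\<^sup>+s. k s * z s w * (\<integral>\<^sup>+r. k r * z r w \<partial>lborel) \<partial>lborel)"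
      by (simp add: power2_eq_square nn_integral_multc)
    also have "\<dots> = (\<integral>\<^sup>+s. (\<integral>\<^sup>+r. k s * k r * (z s w * z r w) \<partial>lborel) \<partial>lborel)"
      by (intro nn_integral_cong) (simp add: nn_integral_cmult[symmetric] ac_simps)
    finally show "(\<integral>\<^sup>+s. k s * z s w \<partial>lborel)\<^sup>2 = (\<integral>\<^sup>+s. (\<integral>\<^sup>+r. k s * k r * (z s w * z r w) \<partial>lborel) \<partial>lborel)" .
  qed
  also have "\<dots> = (\<integral>\<^sup>+s. (\<integral>\<^sup>+w. (\<integral>\<^sup>+r. k s * k r * (z s w * z r w) \<partial>lborel) \<partial>P) \<partial>lborel)"
    by (rule Fubini') (auto simp: case_prod_unfold intro!: lborel.borel_measurable_nn_integral
      borel_measurable_times_ennreal jz)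
  also have "\<dots> = (\<integral>\<^sup>+s. (\<integral>\<^sup>+r. (\<integral>\<^sup>+w. k s * k r * (z s w * z r w) \<partial>P) \<partial>lborel) \<partial>lborel)"
    by (intro nn_integral_cong Fubini')
      (auto simp: case_prod_unfold intro!: borel_measurable_times_ennreal jz)
  also have "\<dots> \<le> (\<integral>\<^sup>+s. (\<integral>\<^sup>+r. ennreal (\<bar>K s\<bar> * \<phi> s) * ennreal (\<bar>K r\<bar> * \<phi> r) \<partial>lborel) \<partial>lborel)"
  proof (intro nn_integral_mono)
    fix s r :: real
    show "(\<integral>\<^sup>+w. k s * k r * (z s w * z r w) \<partial>P) \<le> ennreal (\<bar>K s\<bar> * \<phi> s) * ennreal (\<bar>K r\<bar> * \<phi> r)"
    proof (cases "K s = 0 \<or> K r = 0")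
      case True
      then show ?thesis by (auto simp: k_def)
    next
      case False
      then have Zs: "L2_le P (Z s) (\<phi> s)" "L2_le P (Z r) (\<phi> r)" using Z by auto
      then have [simp]: "0 \<le> \<phi> s" "0 \<le> \<phi> r" by (auto simp: L2_le_def)
      have "(\<integral>\<^sup>+w. k s * k r * (z s w * z r w) \<partial>P) = k s * k r * (\<integral>\<^sup>+w. z s w * z r w \<partial>P)"
        by (simp add: nn_integral_cmult)
      also have "\<dots> \<le> k s * k r * ennreal (\<phi> s * \<phi> r)"
        using Zs by (intro mult_left_mono nn_integral_mult_le_L2)
          (auto simp: z_def L2_le_def ennreal_power)
      also have "\<dots> = ennreal (\<bar>K s\<bar> * \<phi> s) * ennreal (\<bar>K r\<bar> * \<phi> r)"
        by (simp add: k_def ennreal_mult[symmetric] ac_simps)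
      finally show ?thesis .
    qed
  qed
  also have "\<dots> = (\<integral>\<^sup>+s. ennreal (\<bar>K s\<bar> * \<phi> s) \<partial>lborel)\<^sup>2"
    by (simp add: nn_integral_cmult nn_integral_multc power2_eq_square)
  also have "\<dots> \<le> (ennreal A)\<^sup>2" by (intro power_mono A) auto
  finally show ?thesis using A(2) mint by (simp add: L2_le_def ennreal_power)
qed

section \<open>Integrals of powers\<close>

lemma nonneg_has_integral_lborel:
  fixes f :: "real \<Rightarrow> real"
  assumes [measurable]: "f \<in> borel_measurable borel" "S \<in> sets borel"
    and "\<And>x. x \<in> S \<Longrightarrow> 0 \<le> f x" "(f has_integral I) S"
  shows "(\<integral>\<^sup>+x. ennreal (f x * indicator S x) \<partial>lborel) = ennreal I"
    and "set_integrable lborel S f" "(LINT x:S|lborel. f x) = I" "0 \<le> I"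
proof -
  show nn: "(\<integral>\<^sup>+x. ennreal (f x * indicator S x) \<partial>lborel) = ennreal I"
    using nn_integral_has_integral_lebesgue[OF assms(3,4)] by (simp add: mult.commute)
  show I: "0 \<le> I" using assms(3,4) has_integral_nonneg by blast
  have "has_bochner_integral lborel (\<lambda>x. indicator S x *\<^sub>R f x) I"
    using nn assms(3) I
    by (intro has_bochner_integral_nn_integral) (auto simp: mult.commute indicator_def)
  then show "set_integrable lborel S f" "(LINT x:S|lborel. f x) = I"
    by (auto simp: set_integrable_def set_lebesgue_integral_def has_bochner_integral_iff)
qed

lemma has_integral_powr_affine:
  fixes a c d t :: real
  assumes "0 < a" "c \<le> d"
  shows "d \<le> t \<Longrightarrow> ((\<lambda>s. (t - s) powr (a - 1)) has_integral (((t - c) powr a - (t - d) powr a) / a)) {c..d}"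
    and "0 \<le> t + c \<Longrightarrow> ((\<lambda>s. (t + s) powr (a - 1)) has_integral (((t + d) powr a - (t + c) powr a) / a)) {c..d}"
proof -
  assume t: "d \<le> t"
  have "((\<lambda>s. (t - s) powr (a - 1)) has_integral (- ((t - d) powr a / a) - (- ((t - c) powr a / a)))) {c..d}"
  proof (rule fundamental_theorem_of_calculus_interior)
    show "continuous_on {c..d} (\<lambda>s. - ((t - s) powr a / a))"
      using assms t by (intro continuous_intros continuous_on_powr') auto
    show "((\<lambda>s. - ((t - s) powr a / a)) has_vector_derivative (t - x) powr (a - 1)) (at x)"
      if "x \<in> {c<..<d}" for x
      unfolding has_real_derivative_iff_has_vector_derivative[symmetric]
      using that assms t by (auto intro!: derivative_eq_intros simp: field_simps powr_diff)
  qed fact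
  then show "((\<lambda>s. (t - s) powr (a - 1)) has_integral (((t - c) powr a - (t - d) powr a) / a)) {c..d}"
    by (simp add: diff_divide_distrib)
next
  assume t: "0 \<le> t + c"
  have "((\<lambda>s. (t + s) powr (a - 1)) has_integral ((t + d) powr a / a - ((t + c) powr a / a))) {c..d}"
  proof (rule fundamental_theorem_of_calculus_interior)
    show "continuous_on {c..d} (\<lambda>s. (t + s) powr a / a)"
      using assms t by (intro continuous_intros continuous_on_powr') auto
    show "((\<lambda>s. (t + s) powr a / a) has_vector_derivative (t + x) powr (a - 1)) (at x)"
      if "x \<in> {c<..<d}" for x
      unfolding has_real_derivative_iff_has_vector_derivative[symmetric]
      using that assms t by (auto intro!: derivative_eq_intros simp: powr_diff)
  qed fact
  then show "((\<lambda>s. (t + s) powr (a - 1)) has_integral (((t + d) powr a - (t + c) powr a) / a)) {c..d}"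
    by (simp add: diff_divide_distrib)
qed

lemmas powr_reflect_lborel =
  nonneg_has_integral_lborel[OF _ _ _ has_integral_powr_affine(1), simplified]

lemmas powr_shift_lborel =
  nonneg_has_integral_lborel[OF _ _ _ has_integral_powr_affine(2), simplified]

lemma nn_integral_powr_eq_top:
  fixes a t :: real
  assumes "a \<le> 0" "0 < t"
  shows "(\<integral>\<^sup>+w. ennreal (w powr (a - 1) * indicator {0..t} w) \<partial>lborel) = \<infinity>"
proof (cases "\<integral>\<^sup>+w. ennreal (w powr (a - 1) * indicator {0..t} w) \<partial>lborel")
  case (real r)
  \<comment> \<open>\<open>w^(a-1) \<ge> t^(a-b) w^(b-1)\<close> on \<open>(0, t]\<close>, so the integral is at least \<open>t^a / b\<close> for every \<open>b > 0\<close>.\<close>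
  define b where "b = t powr a / (r + 1)"
  have b: "0 < b" using real assms by (auto simp: b_def)
  have "ennreal (t powr (a - b)) * ennreal (t powr b / b)
      = ennreal (t powr (a - b)) * (\<integral>\<^sup>+w. ennreal (w powr (b - 1) * indicator {0..t} w) \<partial>lborel)"
    using powr_shift_lborel(1)[of b 0 t 0] b assms by simp
  also have "\<dots> = (\<integral>\<^sup>+w. ennreal (t powr (a - b)) * ennreal (w powr (b - 1) * indicator {0..t} w) \<partial>lborel)"
    by (simp add: nn_integral_cmult)
  also have "\<dots> \<le> (\<integral>\<^sup>+w. ennreal (w powr (a - 1) * indicator {0..t} w) \<partial>lborel)"
  proof (rule nn_integral_mono)
    fix w :: real
    show "ennreal (t powr (a - b)) * ennreal (w powr (b - 1) * indicator {0..t} w)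
        \<le> ennreal (w powr (a - 1) * indicator {0..t} w)"
    proof (cases "0 < w \<and> w \<le> t")
      case True
      have "t powr (a - b) * w powr (b - 1) \<le> w powr (a - b) * w powr (b - 1)"
        using True assms b by (intro mult_right_mono powr_mono2') auto
      also have "\<dots> = w powr (a - 1)" by (simp flip: powr_add)
      finally show ?thesis using True by (simp add: ennreal_mult[symmetric] ennreal_leI)
    next
      case False
      then show ?thesis by (cases "w = 0") (auto simp: indicator_def)
    qed
  qed
  finally have "ennreal (t powr (a - b)) * ennreal (t powr b / b) \<le> ennreal r"
    using real by simp
  then have "ennreal (t powr (a - b) * (t powr b / b)) \<le> ennreal r"
    using b by (subst ennreal_mult) auto
  then have "t powr (a - b) * (t powr b / b) \<le> r" using real by (subst (asm) ennreal_le_iff) auto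
  also have "t powr (a - b) * (t powr b / b) = t powr a / b"
    using assms by (simp flip: powr_add)
  also have "\<dots> = r + 1" using assms by (simp add: b_def)
  finally show ?thesis by simp
qed simp

lemma nn_integral_Beta_affine:
  fixes a b u s :: real
  assumes "0 < a" "0 < b" "u < s"
  shows "(\<integral>\<^sup>+v. ennreal ((s - v) powr (a - 1) * (v - u) powr (b - 1) * indicator {u..s} v) \<partial>lborel)
     = ennreal (Beta a b * (s - u) powr (a + b - 1))"
proof -
  define c where "c = s - u"
  have c: "0 < c" using assms by (simp add: c_def)
  have "(\<integral>\<^sup>+v. ennreal ((s - v) powr (a - 1) * (v - u) powr (b - 1) * indicator {u..s} v) \<partial>lborel)
      = \<bar>c\<bar> * (\<integral>\<^sup>+y. ennreal ((s - (u + c * y)) powr (a - 1) * ((u + c * y) - u) powr (b - 1) * indicator {u..s} (u + c * y)) \<partial>lborel)"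
    using c by (intro nn_integral_real_affine) auto
  also have "(\<integral>\<^sup>+y. ennreal ((s - (u + c * y)) powr (a - 1) * ((u + c * y) - u) powr (b - 1) * indicator {u..s} (u + c * y)) \<partial>lborel)
      = (\<integral>\<^sup>+y. ennreal (c powr (a + b - 2)) * ennreal (y powr (b - 1) * (1 - y) powr (a - 1) * indicator {0..1} y) \<partial>lborel)"
  proof (rule nn_integral_cong)
    fix y :: real
    have 1: "u + c * y \<in> {u..s} \<longleftrightarrow> y \<in> {0..1}"
    proof -
      have "u + c * y \<le> s \<longleftrightarrow> c * y \<le> c * 1" by (auto simp: c_def)
      then show ?thesis using c by (auto simp: zero_le_mult_iff simp del: mult_1_right)
    qed
    have 2: "s - (u + c * y) = c * (1 - y)" by (simp add: c_def algebra_simps)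
    show "ennreal ((s - (u + c * y)) powr (a - 1) * ((u + c * y) - u) powr (b - 1) * indicator {u..s} (u + c * y))
      = ennreal (c powr (a + b - 2)) * ennreal (y powr (b - 1) * (1 - y) powr (a - 1) * indicator {0..1} y)"
    proof (cases "y \<in> {0..1}")
      case True
      have "c powr (a - 1) * c powr (b - 1) = c powr (a + b - 2)"
        by (simp flip: powr_add)
      then show ?thesis unfolding 2 using True 1 c
        by (simp add: powr_mult ennreal_mult[symmetric] ac_simps)
    next
      case False
      then show ?thesis unfolding indicator_def using 1 by auto
    qed
  qed
  also have "\<dots> = ennreal (c powr (a + b - 2)) * ennreal (Beta b a)"
    using nonneg_has_integral_lborel(1)[OF _ _ _ has_integral_Beta_real[OF assms(2,1)]]
    by (simp add: nn_integral_cmult)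
  also have "\<bar>c\<bar> * (ennreal (c powr (a + b - 2)) * ennreal (Beta b a)) = ennreal (Beta a b * c powr (a + b - 1))"
  proof -
    have "c * c powr (a + b - 2) = c powr (a + b - 1)" using c by (simp add: powr_mult_base)
    moreover have "0 \<le> Beta b a"
      using nonneg_has_integral_lborel(4)[OF _ _ _ has_integral_Beta_real[OF assms(2,1)]] by simp
    ultimately show ?thesis using c
      by (simp add: ennreal_mult[symmetric] Beta_commute mult.assoc[symmetric])
  qed
  finally show ?thesis by (simp add: c_def)
qed

lemma nn_integral_powr_min_le:
  fixes \<beta> h :: real
  assumes "0 < \<beta>" "\<beta> < 1" "0 < h"
  shows "(\<integral>\<^sup>+w. ennreal (w powr (\<beta> - 1) * min 1 (h / w) * indicator {0<..} w) \<partial>lborel)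
    \<le> ennreal (h powr \<beta> * (1 / \<beta> + 1 / (1 - \<beta>)))"
proof -
  have "(\<integral>\<^sup>+w. ennreal (w powr (\<beta> - 1) * min 1 (h / w) * indicator {0<..} w) \<partial>lborel)
      \<le> (\<integral>\<^sup>+w. ennreal (w powr (\<beta> - 1) * indicator {0..h} w)
          + ennreal h * ennreal (w powr (\<beta> - 2) * indicator {h..} w) \<partial>lborel)"
  proof (rule nn_integral_mono)
    fix w :: real
    consider "w \<le> 0" | "0 < w" "w \<le> h" | "h < w" by linarith
    then show "ennreal (w powr (\<beta> - 1) * min 1 (h / w) * indicator {0<..} w)
      \<le> ennreal (w powr (\<beta> - 1) * indicator {0..h} w)
          + ennreal h * ennreal (w powr (\<beta> - 2) * indicator {h..} w)"
    proof cases
      case 1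
      then show ?thesis by simp
    next
      case 2
      then show ?thesis by (auto intro!: add_increasing2 ennreal_leI)
    next
      case 3
      have "w powr (\<beta> - 1) * min 1 (h / w) \<le> w powr (\<beta> - 1) * (h / w)"
        by (intro mult_left_mono) auto
      also have "\<dots> = h * w powr (\<beta> - 2)"
        using 3 assms by (simp add: powr_diff power2_eq_square field_simps)
      finally show ?thesis using 3 assms by (simp add: ennreal_mult[symmetric] ennreal_leI)
    qed
  qed
  also have "\<dots> = (\<integral>\<^sup>+w. ennreal (w powr (\<beta> - 1) * indicator {0..h} w) \<partial>lborel)
      + ennreal h * (\<integral>\<^sup>+w. ennreal (w powr (\<beta> - 2) * indicator {h..} w) \<partial>lborel)"
    by (simp add: nn_integral_add nn_integral_cmult)
  also have "(\<integral>\<^sup>+w. ennreal (w powr (\<beta> - 1) * indicator {0..h} w) \<partial>lborel) = ennreal (h powr \<beta> / \<beta>)"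
    using powr_shift_lborel(1)[of \<beta> 0 h 0] assms by simp
  also have "(\<integral>\<^sup>+w. ennreal (w powr (\<beta> - 2) * indicator {h..} w) \<partial>lborel)
      = ennreal (- (h powr (\<beta> - 2 + 1)) / (\<beta> - 2 + 1))"
    using assms by (intro nonneg_has_integral_lborel(1) has_integral_powr_to_inf) auto
  also have "ennreal (h powr \<beta> / \<beta>) + ennreal h * \<dots> = ennreal (h powr \<beta> * (1 / \<beta> + 1 / (1 - \<beta>)))"
  proof -
    have "h * h powr (\<beta> - 1) = h powr \<beta>" using assms by (simp add: powr_mult_base)
    moreover have "- (h powr (\<beta> - 2 + 1)) / (\<beta> - 2 + 1) = h powr (\<beta> - 1) / (1 - \<beta>)"
      using assms by (simp add: field_simps)
    moreover have "0 \<le> h powr (\<beta> - 1) / (1 - \<beta>)" using assms by simp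
    ultimately show ?thesis using assms
      by (simp add: ennreal_mult[symmetric] ennreal_plus[symmetric] ring_distribs del: ennreal_plus)
  qed
  finally show ?thesis .
qed

lemma powr_diff_le_min:
  fixes w h \<rho> :: real
  assumes "0 < w" "0 \<le> h" "-1 \<le> \<rho>"
  shows "w powr \<rho> - (h + w) powr \<rho> \<le> w powr \<rho> * min 1 (h / w)"
proof -
  have "w powr \<rho> * (1 - h / w) \<le> (h + w) powr \<rho>"
  proof -
    have "1 - h / w \<le> (1 + h / w) powr (-1)"
      using assms by (simp add: powr_minus_divide field_simps)
    also have "\<dots> \<le> (1 + h / w) powr \<rho>" using assms by (intro powr_mono) auto
    finally have "w powr \<rho> * (1 - h / w) \<le> w powr \<rho> * (1 + h / w) powr \<rho>"
      by (intro mult_left_mono) auto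
    also have "\<dots> = (h + w) powr \<rho>"
      using assms by (simp add: powr_mult[symmetric] ring_distribs add.commute)
    finally show ?thesis .
  qed
  then show ?thesis by (auto simp: min_def algebra_simps)
qed

lemma powr_le_exp:
  fixes x \<theta> :: real
  assumes "0 \<le> \<theta>" "\<theta> \<le> 1" "0 < x"
  shows "x powr \<theta> \<le> exp x"
proof (cases "x \<le> 1")
  case True
  then have "x powr \<theta> \<le> 1" using assms by (intro powr_le1) auto
  also have "1 \<le> exp x" using assms by simp
  finally show ?thesis .
next
  case False
  then have "x powr \<theta> \<le> x powr 1" using assms by (intro powr_mono) auto
  also have "\<dots> \<le> exp x" using exp_ge_add_one_self[of x] assms by (simp del: exp_ge_add_one_self)
  finally show ?thesis .
qed

lemma exists_exponential_weight:
  fixes \<alpha> T \<delta> :: real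
  assumes "0 < \<alpha>" "\<alpha> < 1" "0 < T" "0 < \<delta>"
  shows "\<exists>\<mu>>0. \<forall>t\<in>{0..T}.
    (\<integral>\<^sup>+s. ennreal ((t - s) powr (\<alpha> - 1) * exp (\<mu> * s) * indicator {0..t} s) \<partial>lborel) \<le> ennreal (\<delta> * exp (\<mu> * t))"
proof -
  define C where "C = T powr (\<alpha>/2) / (\<alpha>/2)"
  define \<mu> where "\<mu> = (\<delta> / C) powr (- (2/\<alpha>))"
  have C: "0 < C" using assms by (simp add: C_def)
  have \<mu>: "0 < \<mu>" using assms C by (simp add: \<mu>_def)
  have mu_d: "\<mu> powr (- (\<alpha>/2)) * C = \<delta>" using assms C by (simp add: \<mu>_def powr_powr)
  show ?thesis
  proof (intro exI[of _ \<mu>] conjI ballI \<mu>)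
    fix t assume t: "t \<in> {0..T}"
    have "(\<integral>\<^sup>+s. ennreal ((t - s) powr (\<alpha> - 1) * exp (\<mu> * s) * indicator {0..t} s) \<partial>lborel)
      \<le> (\<integral>\<^sup>+s. ennreal (exp (\<mu> * t) * \<mu> powr (- (\<alpha>/2))) * ennreal ((t - s) powr (\<alpha>/2 - 1) * indicator {0..t} s) \<partial>lborel)"
    proof (rule nn_integral_mono)
      fix s
      show "ennreal ((t - s) powr (\<alpha> - 1) * exp (\<mu> * s) * indicator {0..t} s)
        \<le> ennreal (exp (\<mu> * t) * \<mu> powr (- (\<alpha>/2))) * ennreal ((t - s) powr (\<alpha>/2 - 1) * indicator {0..t} s)"
      proof (cases "0 \<le> s \<and> s < t")
        case True
        define x where "x = \<mu> * (t - s)"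
        have x: "0 < x" using True \<mu> by (simp add: x_def)
        have "x powr (\<alpha>/2) \<le> exp x" using assms x by (intro powr_le_exp) auto
        then have "exp (- x) \<le> x powr (- (\<alpha>/2))"
          using x by (simp add: exp_minus powr_minus)
        also have "\<dots> = \<mu> powr (- (\<alpha>/2)) * (t - s) powr (- (\<alpha>/2))"
          using \<mu> True by (simp add: x_def powr_mult)
        finally have "(t - s) powr (\<alpha> - 1) * (exp (\<mu> * t) * exp (- x)) \<le>
           (t - s) powr (\<alpha> - 1) * (exp (\<mu> * t) * (\<mu> powr (- (\<alpha>/2)) * (t - s) powr (- (\<alpha>/2))))"
          by (intro mult_left_mono) auto
        moreover have "exp (\<mu> * t) * exp (- x) = exp (\<mu> * s)"
          by (simp add: x_def exp_add[symmetric] algebra_simps)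
        moreover have "(t - s) powr (\<alpha> - 1) * (t - s) powr (- (\<alpha>/2)) = (t - s) powr (\<alpha>/2 - 1)"
          by (simp flip: powr_add)
        ultimately have "(t - s) powr (\<alpha> - 1) * exp (\<mu> * s) \<le> exp (\<mu> * t) * \<mu> powr (- (\<alpha>/2)) * (t - s) powr (\<alpha>/2 - 1)"
          by (metis mult.assoc mult.left_commute)
        then show ?thesis using True by (simp add: ennreal_mult[symmetric] ennreal_leI)
      next
        case False
        then show ?thesis by (cases "s = t") (auto simp: indicator_def)
      qed
    qed
    also have "\<dots> = ennreal (exp (\<mu> * t) * \<mu> powr (- (\<alpha>/2))) * ennreal (t powr (\<alpha>/2) / (\<alpha>/2))"
      using powr_reflect_lborel(1)[of "\<alpha>/2" 0 t t] assms t by (simp add: nn_integral_cmult)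
    also have "\<dots> = ennreal (exp (\<mu> * t) * \<mu> powr (- (\<alpha>/2)) * (t powr (\<alpha>/2) / (\<alpha>/2)))"
      using assms by (simp add: ennreal_mult[symmetric])
    also have "\<dots> \<le> ennreal (exp (\<mu> * t) * \<mu> powr (- (\<alpha>/2)) * C)"
      unfolding C_def using assms t by (intro ennreal_leI mult_left_mono divide_right_mono powr_mono2) auto
    also have "exp (\<mu> * t) * \<mu> powr (- (\<alpha>/2)) * C = \<delta> * exp (\<mu> * t)" using mu_d by (simp add: mult.assoc)
    finally show "(\<integral>\<^sup>+s. ennreal ((t - s) powr (\<alpha> - 1) * exp (\<mu> * s) * indicator {0..t} s) \<partial>lborel)
      \<le> ennreal (\<delta> * exp (\<mu> * t))" .
  qed
qed

section \<open>The covariance of fractional Brownian motion\<close>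

definition fbm_measure :: "real \<Rightarrow> (real \<times> real) measure" where
  "fbm_measure H = density (lborel \<Otimes>\<^sub>M lborel)
     (\<lambda>p. ennreal (H * (2*H - 1) * \<bar>fst p - snd p\<bar> powr (2*H - 2)))"

definition rl_ker :: "real \<Rightarrow> real \<Rightarrow> real \<Rightarrow> real" where
  "rl_ker \<alpha> t u = (t - u) powr (\<alpha> - 1) * indicator {0..<t} u"

lemma sets_fbm_measure [measurable_cong]: "sets (fbm_measure H) = sets (lborel \<Otimes>\<^sub>M lborel)"
  by (simp add: fbm_measure_def)

lemma rl_ker_measurable [measurable]: "rl_ker \<alpha> t \<in> borel_measurable borel"
  unfolding rl_ker_def by measurable

lemma rl_ker_nonneg [simp]: "0 \<le> rl_ker \<alpha> t u"
  by (simp add: rl_ker_def)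

lemma nn_integral_fbm_measure:
  fixes f g :: "real \<Rightarrow> ennreal"
  assumes "1/2 < H" and [measurable]: "f \<in> borel_measurable borel" "g \<in> borel_measurable borel"
  shows "(\<integral>\<^sup>+p. f (fst p) * g (snd p) \<partial>fbm_measure H) = ennreal (H * (2*H - 1)) *
    ((\<integral>\<^sup>+u. f u * (\<integral>\<^sup>+v. g v * ennreal ((v - u) powr (2*H - 2) * indicator {u<..} v) \<partial>lborel) \<partial>lborel)
     + (\<integral>\<^sup>+v. g v * (\<integral>\<^sup>+u. f u * ennreal ((u - v) powr (2*H - 2) * indicator {v<..} u) \<partial>lborel) \<partial>lborel))"
proof -
  interpret lborel_pair: pair_sigma_finite "lborel :: real measure" "lborel :: real measure" ..
  define c where "c = H * (2*H - 1)"
  have c: "0 \<le> c" using assms by (simp add: c_def)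
  define k where "k = (\<lambda>u v :: real. ennreal ((v - u) powr (2*H - 2) * indicator {u<..} v))"
  have [measurable]: "(\<lambda>x. k (f x) (g x)) \<in> borel_measurable L"
    if [measurable]: "f \<in> borel_measurable L" "g \<in> borel_measurable L" for f g and L :: "'c measure"
    unfolding k_def indicator_def greaterThan_iff by measurable
  \<comment> \<open>On the diagonal both sides vanish, because \<open>0 powr _ = 0\<close>.\<close>
  have k: "ennreal (c * \<bar>u - v\<bar> powr (2*H - 2)) = ennreal c * (k u v + k v u)" for u v
    using c by (auto simp: k_def ennreal_mult abs_if indicator_def)
  have "(\<integral>\<^sup>+p. f (fst p) * g (snd p) \<partial>fbm_measure H)
      = (\<integral>\<^sup>+p. ennreal (c * \<bar>fst p - snd p\<bar> powr (2*H - 2)) * (f (fst p) * g (snd p)) \<partial>(lborel \<Otimes>\<^sub>M lborel))"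
    unfolding fbm_measure_def c_def by (subst nn_integral_density) auto
  also have "\<dots> = (\<integral>\<^sup>+p. ennreal c * (f (fst p) * (g (snd p) * k (fst p) (snd p)))
       + ennreal c * (g (snd p) * (f (fst p) * k (snd p) (fst p))) \<partial>(lborel \<Otimes>\<^sub>M lborel))"
    unfolding k by (intro nn_integral_cong) (simp add: ring_distribs ac_simps)
  also have "\<dots> = ennreal c * (\<integral>\<^sup>+p. f (fst p) * (g (snd p) * k (fst p) (snd p)) \<partial>(lborel \<Otimes>\<^sub>M lborel))
       + ennreal c * (\<integral>\<^sup>+p. g (snd p) * (f (fst p) * k (snd p) (fst p)) \<partial>(lborel \<Otimes>\<^sub>M lborel))"
    by (simp add: nn_integral_add nn_integral_cmult)
  also have "(\<integral>\<^sup>+p. f (fst p) * (g (snd p) * k (fst p) (snd p)) \<partial>(lborel \<Otimes>\<^sub>M lborel))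
      = (\<integral>\<^sup>+u. \<integral>\<^sup>+v. f u * (g v * k u v) \<partial>lborel \<partial>lborel)"
    by (subst lborel.nn_integral_fst[symmetric]) auto
  also have "\<dots> = (\<integral>\<^sup>+u. f u * (\<integral>\<^sup>+v. g v * k u v \<partial>lborel) \<partial>lborel)"
    by (simp add: nn_integral_cmult)
  also have "(\<integral>\<^sup>+p. g (snd p) * (f (fst p) * k (snd p) (fst p)) \<partial>(lborel \<Otimes>\<^sub>M lborel))
      = (\<integral>\<^sup>+v. \<integral>\<^sup>+u. g v * (f u * k v u) \<partial>lborel \<partial>lborel)"
    by (subst lborel_pair.nn_integral_snd[symmetric]) (auto simp: case_prod_unfold)
  also have "\<dots> = (\<integral>\<^sup>+v. g v * (\<integral>\<^sup>+u. f u * k v u \<partial>lborel) \<partial>lborel)"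
    by (simp add: nn_integral_cmult)
  finally show ?thesis by (simp add: k_def c_def ring_distribs)
qed

lemma nn_integral_fbm_measure_swap:
  fixes f g :: "real \<Rightarrow> real"
  assumes "1/2 < H" and [measurable]: "f \<in> borel_measurable borel" "g \<in> borel_measurable borel"
    and "\<And>u. 0 \<le> f u" "\<And>u. 0 \<le> g u"
  shows "(\<integral>\<^sup>+p. ennreal (f (fst p) * g (snd p)) \<partial>fbm_measure H)
    = (\<integral>\<^sup>+p. ennreal (g (fst p) * f (snd p)) \<partial>fbm_measure H)"
  using assms nn_integral_fbm_measure[of H "\<lambda>u. ennreal (f u)" "\<lambda>u. ennreal (g u)"]
    nn_integral_fbm_measure[of H "\<lambda>u. ennreal (g u)" "\<lambda>u. ennreal (f u)"]
  by (simp add: ennreal_mult add.commute)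

lemma nn_integral_rl_ker_powr:
  assumes "0 < \<alpha>" "1/2 < H" "0 \<le> u"
  shows "(\<integral>\<^sup>+v. ennreal (rl_ker \<alpha> s v) * ennreal ((v - u) powr (2*H - 2) * indicator {u<..} v) \<partial>lborel)
    = ennreal (Beta \<alpha> (2*H - 1) * (s - u) powr (\<alpha> + 2*H - 2) * indicator {..<s} u)"
proof (cases "u < s")
  case True
  have "(\<integral>\<^sup>+v. ennreal (rl_ker \<alpha> s v) * ennreal ((v - u) powr (2*H - 2) * indicator {u<..} v) \<partial>lborel)
     = (\<integral>\<^sup>+v. ennreal ((s - v) powr (\<alpha> - 1) * (v - u) powr (2*H - 1 - 1) * indicator {u..s} v) \<partial>lborel)"
  proof (rule nn_integral_cong)
    fix v
    consider "v < u" | "v = u" | "u < v" "v < s" | "v = s" | "s < v" by linarith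
    then show "ennreal (rl_ker \<alpha> s v) * ennreal ((v - u) powr (2*H - 2) * indicator {u<..} v)
      = ennreal ((s - v) powr (\<alpha> - 1) * (v - u) powr (2*H - 1 - 1) * indicator {u..s} v)"
      by cases (use assms True in \<open>auto simp: rl_ker_def ennreal_mult\<close>)
  qed
  also have "\<dots> = ennreal (Beta \<alpha> (2*H - 1) * (s - u) powr (\<alpha> + (2*H - 1) - 1))"
    using assms True by (intro nn_integral_Beta_affine) auto
  finally show ?thesis using True by (simp add: algebra_simps)
next
  case False
  have "(\<lambda>v. ennreal (rl_ker \<alpha> s v) * ennreal ((v - u) powr (2*H - 2) * indicator {u<..} v)) = (\<lambda>_. 0)"
    using False by (auto simp: rl_ker_def indicator_def)
  with False show ?thesis by simp
qed

lemma nn_integral_rl_ker_fbm: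
  fixes \<alpha> H s t :: real
  assumes "0 < \<alpha>" "1/2 < H" "0 \<le> s" "s \<le> t"
  defines "\<rho> \<equiv> \<alpha> + 2*H - 2"
  shows "(\<integral>\<^sup>+p. ennreal (rl_ker \<alpha> t (fst p) * rl_ker \<alpha> s (snd p)) \<partial>fbm_measure H)
    = ennreal (H * (2*H - 1) * Beta \<alpha> (2*H - 1)) *
      (\<integral>\<^sup>+w. ennreal (((t - s + w) powr (\<alpha> - 1) * w powr \<rho> + w powr (\<alpha> - 1) * (t - s + w) powr \<rho>) * indicator {0..s} w) \<partial>lborel)"
proof -
  define \<beta> where "\<beta> = Beta \<alpha> (2*H - 1)"
  have \<beta>: "0 \<le> \<beta>" using assms by (simp add: \<beta>_def Beta_def Gamma_real_nonneg)
  have "(\<integral>\<^sup>+p. ennreal (rl_ker \<alpha> t (fst p) * rl_ker \<alpha> s (snd p)) \<partial>fbm_measure H)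
     = ennreal (H * (2*H - 1)) *
    ((\<integral>\<^sup>+u. ennreal (rl_ker \<alpha> t u) * (\<integral>\<^sup>+v. ennreal (rl_ker \<alpha> s v) * ennreal ((v - u) powr (2*H - 2) * indicator {u<..} v) \<partial>lborel) \<partial>lborel)
     + (\<integral>\<^sup>+v. ennreal (rl_ker \<alpha> s v) * (\<integral>\<^sup>+u. ennreal (rl_ker \<alpha> t u) * ennreal ((u - v) powr (2*H - 2) * indicator {v<..} u) \<partial>lborel) \<partial>lborel))"
    using assms by (subst nn_integral_fbm_measure[symmetric]) (auto simp: ennreal_mult)
  also have "(\<integral>\<^sup>+u. ennreal (rl_ker \<alpha> t u) * (\<integral>\<^sup>+v. ennreal (rl_ker \<alpha> s v) * ennreal ((v - u) powr (2*H - 2) * indicator {u<..} v) \<partial>lborel) \<partial>lborel)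
     = (\<integral>\<^sup>+u. ennreal \<beta> * ennreal ((t - u) powr (\<alpha> - 1) * (s - u) powr \<rho> * indicator {0..<s} u) \<partial>lborel)"
  proof (rule nn_integral_cong)
    fix u
    show "ennreal (rl_ker \<alpha> t u) * (\<integral>\<^sup>+v. ennreal (rl_ker \<alpha> s v) * ennreal ((v - u) powr (2*H - 2) * indicator {u<..} v) \<partial>lborel)
      = ennreal \<beta> * ennreal ((t - u) powr (\<alpha> - 1) * (s - u) powr \<rho> * indicator {0..<s} u)"
    proof (cases "0 \<le> u")
      case True
      then show ?thesis using assms \<beta>
        by (simp add: nn_integral_rl_ker_powr \<beta>_def[symmetric] \<rho>_def)
          (auto simp: rl_ker_def indicator_def ennreal_mult[symmetric] ac_simps)
    qed (simp add: rl_ker_def)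
  qed
  also have "(\<integral>\<^sup>+v. ennreal (rl_ker \<alpha> s v) * (\<integral>\<^sup>+u. ennreal (rl_ker \<alpha> t u) * ennreal ((u - v) powr (2*H - 2) * indicator {v<..} u) \<partial>lborel) \<partial>lborel)
     = (\<integral>\<^sup>+u. ennreal \<beta> * ennreal ((s - u) powr (\<alpha> - 1) * (t - u) powr \<rho> * indicator {0..<s} u) \<partial>lborel)"
  proof (rule nn_integral_cong)
    fix u
    show "ennreal (rl_ker \<alpha> s u) * (\<integral>\<^sup>+v. ennreal (rl_ker \<alpha> t v) * ennreal ((v - u) powr (2*H - 2) * indicator {u<..} v) \<partial>lborel)
      = ennreal \<beta> * ennreal ((s - u) powr (\<alpha> - 1) * (t - u) powr \<rho> * indicator {0..<s} u)"
    proof (cases "0 \<le> u")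
      case True
      then show ?thesis using assms \<beta>
        by (simp add: nn_integral_rl_ker_powr \<beta>_def[symmetric] \<rho>_def)
          (auto simp: rl_ker_def indicator_def ennreal_mult[symmetric] ac_simps)
    qed (simp add: rl_ker_def)
  qed
  also have "(\<integral>\<^sup>+u. ennreal \<beta> * ennreal ((t - u) powr (\<alpha> - 1) * (s - u) powr \<rho> * indicator {0..<s} u) \<partial>lborel)
       + (\<integral>\<^sup>+u. ennreal \<beta> * ennreal ((s - u) powr (\<alpha> - 1) * (t - u) powr \<rho> * indicator {0..<s} u) \<partial>lborel)
     = ennreal \<beta> * (\<integral>\<^sup>+u. ennreal (((t - u) powr (\<alpha> - 1) * (s - u) powr \<rho> + (s - u) powr (\<alpha> - 1) * (t - u) powr \<rho>) * indicator {0..<s} u) \<partial>lborel)"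
    by (simp add: nn_integral_cmult nn_integral_add[symmetric] ring_distribs[symmetric]
       ennreal_plus[symmetric] del: ennreal_plus)
  also have "(\<integral>\<^sup>+u. ennreal (((t - u) powr (\<alpha> - 1) * (s - u) powr \<rho> + (s - u) powr (\<alpha> - 1) * (t - u) powr \<rho>) * indicator {0..<s} u) \<partial>lborel)
     = ennreal \<bar>-1\<bar> * (\<integral>\<^sup>+w. ennreal (((t - (s + -1 * w)) powr (\<alpha> - 1) * (s - (s + -1 * w)) powr \<rho> +
          (s - (s + -1 * w)) powr (\<alpha> - 1) * (t - (s + -1 * w)) powr \<rho>) * indicator {0..<s} (s + -1 * w)) \<partial>lborel)"
    by (rule nn_integral_real_affine) auto
  also have "\<dots> = (\<integral>\<^sup>+w. ennreal (((t - s + w) powr (\<alpha> - 1) * w powr \<rho> + w powr (\<alpha> - 1) * (t - s + w) powr \<rho>) * indicator {0..s} w) \<partial>lborel)"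
  proof -
    have "ennreal (((t - (s + -1 * w)) powr (\<alpha> - 1) * (s - (s + -1 * w)) powr \<rho> +
          (s - (s + -1 * w)) powr (\<alpha> - 1) * (t - (s + -1 * w)) powr \<rho>) * indicator {0..<s} (s + -1 * w))
       = ennreal (((t - s + w) powr (\<alpha> - 1) * w powr \<rho> + w powr (\<alpha> - 1) * (t - s + w) powr \<rho>) * indicator {0..s} w)" for w
      by (cases "w = 0") (auto simp: indicator_def algebra_simps)
    then show ?thesis by simp
  qed
  finally show ?thesis using assms \<beta> by (simp add: \<beta>_def ennreal_mult mult.assoc)
qed

lemma fbm_cov_eq_nn_integral:
  assumes "1/2 < H" "0 \<le> s" "0 \<le> t"
  shows "(\<integral>\<^sup>+p. ennreal (indicator {0..<t} (fst p) * indicator {0..<s} (snd p)) \<partial>fbm_measure H)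
    = ennreal (fbm_cov H t s)" and "0 \<le> fbm_cov H t s"
proof -
  have e: "indicator {0..<t} u = rl_ker 1 t u" for t u :: real
    by (auto simp: rl_ker_def indicator_def)
  have B: "H * (2*H - 1) * Beta 1 (2*H - 1) = H"
  proof -
    have "Gamma (1 + (2*H - 1)) = (2*H - 1) * Gamma (2*H - 1)"
      using Gamma_plus1[of "2*H - 1"] assms by (simp add: add.commute nonpos_Ints_def)
    moreover have "0 < Gamma (2*H - 1)" using assms by (intro Gamma_real_pos) auto
    then have "Gamma (2*H - 1) \<noteq> 0" by linarith
    ultimately show ?thesis using assms by (simp add: Beta_def)
  qed
  have main: "(\<integral>\<^sup>+p. ennreal (rl_ker 1 t (fst p) * rl_ker 1 s (snd p)) \<partial>fbm_measure H)
    = ennreal (fbm_cov H t s) \<and> 0 \<le> fbm_cov H t s" if "0 \<le> s" "s \<le> t" for s t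
  proof -
    have "(\<integral>\<^sup>+w. ennreal (((t - s + w) powr (1 - 1) * w powr (1 + 2*H - 2) + w powr (1 - 1) * (t - s + w) powr (1 + 2*H - 2)) * indicator {0..s} w) \<partial>lborel)
      = (\<integral>\<^sup>+w. ennreal ((0 + w) powr (2*H - 1) * indicator {0..s} w) + ennreal ((t - s + w) powr (2*H - 1) * indicator {0..s} w) \<partial>lborel)"
      by (intro nn_integral_cong_AE AE_I'[of "{0}"]) (use that in \<open>auto simp: indicator_def ennreal_plus\<close>)
    also have "\<dots> = (\<integral>\<^sup>+w. ennreal ((0 + w) powr (2*H - 1) * indicator {0..s} w) \<partial>lborel)
        + (\<integral>\<^sup>+w. ennreal ((t - s + w) powr (2*H - 1) * indicator {0..s} w) \<partial>lborel)"
      by (rule nn_integral_add) auto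
    also have "\<dots> = ennreal ((s powr (2*H)) / (2*H)) + ennreal ((t powr (2*H) - (t - s) powr (2*H)) / (2*H))"
      using powr_shift_lborel(1)[of "2*H" 0 s 0] powr_shift_lborel(1)[of "2*H" 0 s "t - s"] assms that
      by simp
    also have "\<dots> = ennreal ((s powr (2*H)) / (2*H) + (t powr (2*H) - (t - s) powr (2*H)) / (2*H))"
      using assms that by (intro ennreal_plus[symmetric]) (auto intro!: divide_nonneg_nonneg powr_mono2)
    finally have 1: "(\<integral>\<^sup>+w. ennreal (((t - s + w) powr (1 - 1) * w powr (1 + 2*H - 2) + w powr (1 - 1) * (t - s + w) powr (1 + 2*H - 2)) * indicator {0..s} w) \<partial>lborel)
      = ennreal ((s powr (2*H)) / (2*H) + (t powr (2*H) - (t - s) powr (2*H)) / (2*H))" .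
    have "(t - s) powr (2*H) \<le> t powr (2*H)" using assms that by (intro powr_mono2) auto
    then have nn: "0 \<le> fbm_cov H t s" using that by (simp add: fbm_cov_def add_increasing2)
    have "H * ((s powr (2*H)) / (2*H) + (t powr (2*H) - (t - s) powr (2*H)) / (2*H)) = fbm_cov H t s"
      using assms that by (simp add: fbm_cov_def field_simps)
    then show ?thesis
      using nn_integral_rl_ker_fbm[of 1 H s t] assms that nn unfolding 1 B
      by (simp add: ennreal_mult'[symmetric])
  qed
  have "(\<integral>\<^sup>+p. ennreal (rl_ker 1 t (fst p) * rl_ker 1 s (snd p)) \<partial>fbm_measure H)
    = ennreal (fbm_cov H t s) \<and> 0 \<le> fbm_cov H t s"
  proof (cases "s \<le> t")
    case True
    then show ?thesis using main assms by auto
  next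
    case False
    have "(\<integral>\<^sup>+p. ennreal (rl_ker 1 t (fst p) * rl_ker 1 s (snd p)) \<partial>fbm_measure H)
        = (\<integral>\<^sup>+p. ennreal (rl_ker 1 s (fst p) * rl_ker 1 t (snd p)) \<partial>fbm_measure H)"
      using assms(1) by (intro nn_integral_fbm_measure_swap) auto
    moreover have "fbm_cov H t s = fbm_cov H s t" by (simp add: fbm_cov_def abs_minus_commute)
    ultimately show ?thesis using main[of t s] False assms by simp
  qed
  then show "(\<integral>\<^sup>+p. ennreal (indicator {0..<t} (fst p) * indicator {0..<s} (snd p)) \<partial>fbm_measure H)
    = ennreal (fbm_cov H t s)" "0 \<le> fbm_cov H t s"
    by (simp_all add: e)
qed

lemma fbm_cov_eq_integral:
  assumes "1/2 < H" "0 \<le> s" "0 \<le> t"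
  shows "has_bochner_integral (fbm_measure H)
    (\<lambda>p. indicator {0..<t} (fst p) * indicator {0..<s} (snd p)) (fbm_cov H t s)"
  using fbm_cov_eq_nn_integral[OF assms]
  by (intro has_bochner_integral_nn_integral) auto

lemma centered_gaussian_rv_second_moment:
  assumes "prob_space P" "centered_gaussian_rv P X v" "0 \<le> v"
  shows "has_bochner_integral P (\<lambda>w. (X w)\<^sup>2) v"
proof (cases "v = 0")
  case True
  then have "AE w in P. (X w)\<^sup>2 = 0" and [measurable]: "X \<in> borel_measurable P"
    using assms by (auto simp: centered_gaussian_rv_def)
  then show ?thesis using True
    by (subst has_bochner_integral_cong_AE[where g="\<lambda>_. 0"]) auto
next
  case False
  then have v: "0 < sqrt v" "distributed P lborel X (normal_density 0 (sqrt v))"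
    using assms by (auto simp: centered_gaussian_rv_def)
  have "has_bochner_integral lborel (\<lambda>x. normal_density 0 (sqrt v) x * x\<^sup>2) v"
    using normal_moment_even[OF v(1), of 0 1] assms(3) by (simp add: fact_2)
  then show ?thesis
    using distributed_integrable[OF v(2), of "\<lambda>x. x\<^sup>2"] distributed_integral[OF v(2), of "\<lambda>x. x\<^sup>2"]
    by (auto simp: has_bochner_integral_iff)
qed

lemma fbm_covariance:
  fixes B :: "real \<Rightarrow> 'w \<Rightarrow> real^'d"
  assumes "prob_space P" "is_fBm P H B" "1/2 < H" "0 \<le> s" "0 \<le> t"
  shows "has_bochner_integral P (\<lambda>w. B t w \<bullet> B s w) (real CARD('d) * fbm_cov H t s)"
    and "B t \<in> borel_measurable P"
proof -
  have G: "centered_gaussian_rv P (\<lambda>w. \<Sum>p\<in>I. c p * (B (fst p) w $ snd p))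
          (\<Sum>p\<in>I. \<Sum>q\<in>I. c p * c q * (if snd p = snd q then fbm_cov H (fst p) (fst q) else 0))"
    if "finite I" "I \<subseteq> {0..} \<times> UNIV" for I :: "(real \<times> 'd) set" and c
    using assms(2) that unfolding is_fBm_def by blast
  have g1: "centered_gaussian_rv P (\<lambda>w. B t w $ i) (fbm_cov H t t)" if "0 \<le> t" for t i
    using G[of "{(t, i)}" "\<lambda>_. 1"] that by simp
  have m: "has_bochner_integral P (\<lambda>w. (B t w $ i)\<^sup>2) (fbm_cov H t t)" if "0 \<le> t" for t i
    using centered_gaussian_rv_second_moment[OF assms(1) g1[OF that]] fbm_cov_eq_nn_integral(2)[of H t t] assms that
    by auto
  have "has_bochner_integral P (\<lambda>w. B t w $ i * B s w $ i) (fbm_cov H t s)" for i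
  proof (cases "s = t")
    case True
    then show ?thesis using m[of t i] assms by (simp add: power2_eq_square)
  next
    case False
    have sym: "fbm_cov H s t = fbm_cov H t s" by (simp add: fbm_cov_def abs_minus_commute)
    have "centered_gaussian_rv P (\<lambda>w. B t w $ i + B s w $ i) (fbm_cov H t t + fbm_cov H s s + 2 * fbm_cov H t s)"
      using G[of "{(t, i), (s, i)}" "\<lambda>_. 1"] False assms sym by (simp add: algebra_simps)
    from centered_gaussian_rv_second_moment[OF assms(1) this]
    have "has_bochner_integral P (\<lambda>w. (B t w $ i + B s w $ i)\<^sup>2) (fbm_cov H t t + fbm_cov H s s + 2 * fbm_cov H t s)"
      using fbm_cov_eq_nn_integral(2)[of H] assms by simp
    from has_bochner_integral_diff[OF has_bochner_integral_diff[OF this m[of t i]] m[of s i]]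
    have "has_bochner_integral P (\<lambda>w. (B t w $ i + B s w $ i)\<^sup>2 - (B t w $ i)\<^sup>2 - (B s w $ i)\<^sup>2) (2 * fbm_cov H t s)"
      using assms by simp
    from has_bochner_integral_mult_right[OF this, of "1/2"] show ?thesis
      by (simp add: power2_sum)
  qed
  then have "has_bochner_integral P (\<lambda>w. \<Sum>i\<in>UNIV. B t w $ i * B s w $ i) (\<Sum>i\<in>(UNIV::'d set). fbm_cov H t s)"
    by (intro has_bochner_integral_sum) auto
  then show "has_bochner_integral P (\<lambda>w. B t w \<bullet> B s w) (real CARD('d) * fbm_cov H t s)"
    by (simp add: inner_vec_def)
  show "B t \<in> borel_measurable P"
    using g1[OF assms(5)]
    by (subst borel_measurable_euclidean_space)
      (auto simp: centered_gaussian_rv_def Basis_vec_def cart_eq_inner_axis[symmetric])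
qed

section \<open>The Riemann--Liouville integral of fractional Brownian motion\<close>

inductive wiener_elementary :: "(real \<Rightarrow> 'w \<Rightarrow> 'a::euclidean_space) \<Rightarrow> ('w \<Rightarrow> 'a) \<Rightarrow> (real \<Rightarrow> real) \<Rightarrow> bool"
  for B where
  wiener_base: "0 \<le> t \<Longrightarrow> wiener_elementary B (B t) (indicator {0..<t})"
| wiener_add: "wiener_elementary B Y f \<Longrightarrow> wiener_elementary B Z g \<Longrightarrow>
     wiener_elementary B (\<lambda>w. Y w + Z w) (\<lambda>u. f u + g u)"
| wiener_scale: "wiener_elementary B Y f \<Longrightarrow> wiener_elementary B (\<lambda>w. c *\<^sub>R Y w) (\<lambda>u. c * f u)"

lemma wiener_diff:
  assumes "wiener_elementary B Y f" "wiener_elementary B Z g"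
  shows "wiener_elementary B (\<lambda>w. Y w - Z w) (\<lambda>u. f u - g u)"
  using wiener_add[OF assms(1) wiener_scale[OF assms(2), of "-1"]] by simp

lemma wiener_sum:
  assumes "\<And>i. i < (n::nat) \<Longrightarrow> wiener_elementary B (Y i) (f i)"
  shows "wiener_elementary B (\<lambda>w. \<Sum>i<n. Y i w) (\<lambda>u. \<Sum>i<n. f i u)"
  using assms
proof (induction n)
  case 0
  show ?case using wiener_scale[OF wiener_base[of 0 B], of 0] by simp
next
  case (Suc n)
  then show ?case using wiener_add[of B "\<lambda>w. \<Sum>i<n. Y i w" _ "Y n"] by simp
qed

lemma wiener_elementary_measurable:
  assumes "wiener_elementary B Y f" "\<And>t. 0 \<le> t \<Longrightarrow> B t \<in> borel_measurable P"
  shows "Y \<in> borel_measurable P" "f \<in> borel_measurable borel"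
proof -
  have "Y \<in> borel_measurable P \<and> f \<in> borel_measurable borel"
    using assms(1) by induction (auto simp: assms(2))
  then show "Y \<in> borel_measurable P" "f \<in> borel_measurable borel" by auto
qed

lemma wiener_isometry:
  fixes B :: "real \<Rightarrow> 'w \<Rightarrow> real^'d"
  assumes "prob_space P" "is_fBm P H B" "1/2 < H"
    and "wiener_elementary B Y f" "wiener_elementary B Z g"
  shows "\<exists>v. has_bochner_integral P (\<lambda>w. Y w \<bullet> Z w) (real CARD('d) * v) \<and>
             has_bochner_integral (fbm_measure H) (\<lambda>p. f (fst p) * g (snd p)) v"
  using assms(4)
proof induction
  case (wiener_base t)
  show ?case using assms(5)
  proof induction
    case (wiener_base s)
    show ?case using fbm_covariance(1)[OF assms(1-3)] fbm_cov_eq_integral[OF assms(3)] wiener_base \<open>0 \<le> t\<close>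
      by blast
  next
    case (wiener_add Y f Z g)
    then obtain v v' where "has_bochner_integral P (\<lambda>w. B t w \<bullet> Y w) (real CARD('d) * v)"
      "has_bochner_integral (fbm_measure H) (\<lambda>p. indicator {0..<t} (fst p) * f (snd p)) v"
      "has_bochner_integral P (\<lambda>w. B t w \<bullet> Z w) (real CARD('d) * v')"
      "has_bochner_integral (fbm_measure H) (\<lambda>p. indicator {0..<t} (fst p) * g (snd p)) v'" by blast
    from has_bochner_integral_add[OF this(1,3)] has_bochner_integral_add[OF this(2,4)]
    show ?case by (intro exI[of _ "v + v'"]) (simp add: inner_add_right ring_distribs)
  next
    case (wiener_scale Y f c)
    then obtain v where "has_bochner_integral P (\<lambda>w. B t w \<bullet> Y w) (real CARD('d) * v)"
      "has_bochner_integral (fbm_measure H) (\<lambda>p. indicator {0..<t} (fst p) * f (snd p)) v" by blast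
    from has_bochner_integral_mult_right[OF this(1), of c] has_bochner_integral_mult_right[OF this(2), of c]
    show ?case by (intro exI[of _ "c * v"]) (simp add: ac_simps)
  qed
next
  case (wiener_add Y f Y' f')
  then obtain v v' where "has_bochner_integral P (\<lambda>w. Y w \<bullet> Z w) (real CARD('d) * v)"
    "has_bochner_integral (fbm_measure H) (\<lambda>p. f (fst p) * g (snd p)) v"
    "has_bochner_integral P (\<lambda>w. Y' w \<bullet> Z w) (real CARD('d) * v')"
    "has_bochner_integral (fbm_measure H) (\<lambda>p. f' (fst p) * g (snd p)) v'" by blast
  from has_bochner_integral_add[OF this(1,3)] has_bochner_integral_add[OF this(2,4)]
  show ?case by (intro exI[of _ "v + v'"]) (simp add: inner_add_left ring_distribs)
next
  case (wiener_scale Y f c)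
  then obtain v where "has_bochner_integral P (\<lambda>w. Y w \<bullet> Z w) (real CARD('d) * v)"
    "has_bochner_integral (fbm_measure H) (\<lambda>p. f (fst p) * g (snd p)) v" by blast
  from has_bochner_integral_mult_right[OF this(1), of c] has_bochner_integral_mult_right[OF this(2), of c]
  show ?case by (intro exI[of _ "c * v"]) (simp add: ac_simps)
qed

definition rl_step :: "real \<Rightarrow> real \<Rightarrow> nat \<Rightarrow> real \<Rightarrow> real" where
  "rl_step \<alpha> t n u = (\<Sum>i<n. (t - t * real i / real n) powr (\<alpha> - 1) *
      (indicator {0..<t * real (Suc i) / real n} u - indicator {0..<t * real i / real n} u))"

lemma wiener_rl_step:
  fixes B :: "real \<Rightarrow> 'w \<Rightarrow> 'a::euclidean_space"
  assumes "0 \<le> t"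
  shows "wiener_elementary B (\<lambda>w. \<Sum>i<n. ((t - t * real i / real n) powr (\<alpha> - 1)) *\<^sub>R
                 (B (t * real (Suc i) / real n) w - B (t * real i / real n) w)) (rl_step \<alpha> t n)"
  unfolding rl_step_def
  by (intro wiener_sum wiener_scale wiener_diff wiener_base) (use assms in auto)

lemma rl_step_eq:
  assumes "0 \<le> t" "0 < n"
  shows "rl_step \<alpha> t n u =
    (if 0 \<le> u \<and> u < t then (t - t * real (nat \<lfloor>real n * u / t\<rfloor>) / real n) powr (\<alpha> - 1) else 0)"
proof (cases "0 \<le> u \<and> u < t")
  case True
  define j where "j = nat \<lfloor>real n * u / t\<rfloor>"
  have t: "0 < t" using True by auto
  have n: "0 < real n" using assms by simp
  have j: "real j \<le> real n * u / t" "real n * u / t < real j + 1"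
    using True t n unfolding j_def by (auto simp: nat_0_le)
  have jn: "j < n"
  proof -
    have "real j * t \<le> real n * u" using j(1) t by (simp add: pos_le_divide_eq)
    also have "\<dots> < real n * t" using True n by simp
    finally show ?thesis using t by simp
  qed
  have ind: "indicator {0..<t * real (Suc i) / real n} u - indicator {0..<t * real i / real n} u
      = (if i = j then 1 else 0 :: real)" for i
  proof -
    have 1: "u < t * real i / real n \<longleftrightarrow> j < i" for i
    proof -
      have "u < t * real i / real n \<longleftrightarrow> real n * u / t < real i" using t n by (simp add: field_simps)
      also have "\<dots> \<longleftrightarrow> j < i"
      proof
        assume "real n * u / t < real i"
        then have "real j < real i" using j(1) by linarith
        then show "j < i" by simp
      next
        assume "j < i"
        then have "real j + 1 \<le> real i" by simp
        then show "real n * u / t < real i" using j(2) by linarith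
      qed
      finally show ?thesis .
    qed
    show ?thesis using True 1[of i] 1[of "Suc i"] by (auto simp: indicator_def)
  qed
  have "rl_step \<alpha> t n u = (\<Sum>i<n. if i = j then (t - t * real i / real n) powr (\<alpha> - 1) else 0)"
    unfolding rl_step_def ind by (intro sum.cong) auto
  also have "\<dots> = (t - t * real j / real n) powr (\<alpha> - 1)" using jn by simp
  finally show ?thesis using True by (simp add: j_def)
next
  case False
  have "indicator {0..<t * real (Suc i) / real n} u - indicator {0..<t * real i / real n} u = (0 :: real)"
    if "i < n" for i
  proof -
    have "t * real (Suc i) / real n \<le> t" "t * real i / real n \<le> t"
      using that assms by (auto simp: field_simps simp del: of_nat_Suc intro!: mult_left_mono)
    with False show ?thesis by (auto simp: indicator_def)
  qed
  then have "rl_step \<alpha> t n u = 0" by (simp add: rl_step_def del: of_nat_Suc)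
  with False show ?thesis by auto
qed

lemma rl_step_bounds:
  assumes "0 \<le> t" "\<alpha> < 1"
  shows "0 \<le> rl_step \<alpha> t n u" "rl_step \<alpha> t n u \<le> rl_ker \<alpha> t u"
proof -
  have "0 \<le> rl_step \<alpha> t n u \<and> rl_step \<alpha> t n u \<le> rl_ker \<alpha> t u"
  proof (cases "0 < n \<and> 0 \<le> u \<and> u < t")
    case True
    then have t: "0 < t" and n: "0 < real n" by auto
    have "real (nat \<lfloor>real n * u / t\<rfloor>) \<le> real n * u / t" using True by (simp add: nat_0_le)
    then have "t * real (nat \<lfloor>real n * u / t\<rfloor>) / real n \<le> u" using t n by (simp add: field_simps)
    then show ?thesis using True assms by (auto simp: rl_step_eq rl_ker_def intro!: powr_mono2')
  next
    case False
    then show ?thesis using assms by (cases "n = 0") (auto simp: rl_step_eq, simp_all add: rl_step_def)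
  qed
  then show "0 \<le> rl_step \<alpha> t n u" "rl_step \<alpha> t n u \<le> rl_ker \<alpha> t u" by auto
qed

lemma rl_step_tendsto:
  assumes "0 \<le> t"
  shows "(\<lambda>n. rl_step \<alpha> t n u) \<longlonglongrightarrow> rl_ker \<alpha> t u"
proof (cases "0 \<le> u \<and> u < t")
  case True
  then have t: "0 < t" by auto
  have "(\<lambda>n. t * real (nat \<lfloor>real n * u / t\<rfloor>) / real n) \<longlonglongrightarrow> u"
  proof (rule real_tendsto_sandwich)
    show "(\<lambda>n. u - t / real n) \<longlonglongrightarrow> u"
      using tendsto_diff[OF tendsto_const lim_const_over_n[of t], of u] by simp
    show "\<forall>\<^sub>F n in sequentially. u - t / real n \<le> t * real (nat \<lfloor>real n * u / t\<rfloor>) / real n"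
      using eventually_gt_at_top[of 0]
    proof eventually_elim
      case (elim n)
      have "real n * u / t \<le> real (nat \<lfloor>real n * u / t\<rfloor>) + 1" using True by (simp add: nat_0_le)
      then have "real n * u \<le> (real (nat \<lfloor>real n * u / t\<rfloor>) + 1) * t"
        using t by (simp add: pos_divide_le_eq)
      then have "real n * u - t \<le> t * real (nat \<lfloor>real n * u / t\<rfloor>)" by (simp add: algebra_simps)
      then have "(real n * u - t) / real n \<le> t * real (nat \<lfloor>real n * u / t\<rfloor>) / real n"
        by (rule divide_right_mono) simp
      then show ?case using elim by (simp add: diff_divide_distrib)
    qed
    show "\<forall>\<^sub>F n in sequentially. t * real (nat \<lfloor>real n * u / t\<rfloor>) / real n \<le> u"
      using eventually_gt_at_top[of 0]
    proof eventually_elim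
      case (elim n)
      have "real (nat \<lfloor>real n * u / t\<rfloor>) \<le> real n * u / t" using True by (simp add: nat_0_le)
      then show ?case using t elim by (simp add: field_simps)
    qed
  qed simp
  then have "(\<lambda>n. (t - t * real (nat \<lfloor>real n * u / t\<rfloor>) / real n) powr (\<alpha> - 1)) \<longlonglongrightarrow> (t - u) powr (\<alpha> - 1)"
    using True by (intro tendsto_intros) auto
  moreover have "\<forall>\<^sub>F n in sequentially. (t - t * real (nat \<lfloor>real n * u / t\<rfloor>) / real n) powr (\<alpha> - 1) = rl_step \<alpha> t n u"
    using eventually_gt_at_top[of 0] by eventually_elim (use True assms in \<open>simp add: rl_step_eq\<close>)
  ultimately show ?thesis using True by (simp add: rl_ker_def tendsto_cong)
next
  case False
  have "\<forall>\<^sub>F n in sequentially. rl_step \<alpha> t n u = 0"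
    using eventually_gt_at_top[of 0] by eventually_elim (use False assms in \<open>auto simp: rl_step_eq\<close>)
  moreover have "rl_ker \<alpha> t u = 0" using False by (simp add: rl_ker_def indicator_def)
  ultimately show ?thesis by (simp add: tendsto_eventually)
qed

lemma L2_norm_tendsto:
  fixes V :: "'w \<Rightarrow> 'a::euclidean_space"
  assumes "\<And>n. integrable P (\<lambda>w. (norm (V w))\<^sup>2)" "\<And>n. integrable P (\<lambda>w. (norm (Y n w - V w))\<^sup>2)"
    and "(\<lambda>n. \<integral>w. (norm (Y n w - V w))\<^sup>2 \<partial>P) \<longlonglongrightarrow> 0"
    and [measurable]: "V \<in> borel_measurable P" "\<And>n. Y n \<in> borel_measurable P"
  shows "(\<lambda>n. \<integral>w. (norm (Y n w))\<^sup>2 \<partial>P) \<longlonglongrightarrow> (\<integral>w. (norm (V w))\<^sup>2 \<partial>P)"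
proof -
  define A where "A = sqrt (\<integral>w. (norm (V w))\<^sup>2 \<partial>P)"
  define e where "e = (\<lambda>n. sqrt (\<integral>w. (norm (Y n w - V w))\<^sup>2 \<partial>P))"
  have V: "L2_le P V A" unfolding A_def by (rule L2_leI) (auto intro: assms integral_nonneg)
  have D: "L2_le P (\<lambda>w. Y n w - V w) (e n)" for n
    unfolding e_def by (rule L2_leI) (auto intro: assms integral_nonneg)
  have nn: "0 \<le> A" "0 \<le> e n" for n using V D by (auto simp: L2_le_def)
  have e0: "e \<longlonglongrightarrow> 0" unfolding e_def using tendsto_real_sqrt[OF assms(3)] by simp
  have bound: "\<bar>(\<integral>w. (norm (Y n w))\<^sup>2 \<partial>P) - A\<^sup>2\<bar> \<le> e n * (2 * A + e n)" for n
  proof -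
    have le: "L2_le P (Y n) (A + e n)"
      using L2_le_add[OF V D[of n]] by simp
    define a where "a = sqrt (\<integral>w. (norm (Y n w))\<^sup>2 \<partial>P)"
    have a: "0 \<le> a" "a\<^sup>2 = (\<integral>w. (norm (Y n w))\<^sup>2 \<partial>P)"
      unfolding a_def by (auto simp: integral_nonneg)
    have "L2_le P (Y n) a" unfolding a_def using le
      by (intro L2_leI) (auto dest: L2_leD(3) simp: integral_nonneg)
    from L2_leD(4)[OF L2_le_diff[OF this D[of n]]] have "A\<^sup>2 \<le> (a + e n)\<^sup>2"
      by (simp add: A_def integral_nonneg)
    then have "A \<le> a + e n" by (rule power2_le_imp_le) (use a nn in auto)
    moreover have "a\<^sup>2 \<le> (A + e n)\<^sup>2" using L2_leD(4)[OF le] a by simp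
    then have "a \<le> A + e n" by (rule power2_le_imp_le) (use nn in auto)
    ultimately have "\<bar>a - A\<bar> \<le> e n" by linarith
    have "\<bar>a\<^sup>2 - A\<^sup>2\<bar> = \<bar>a - A\<bar> * (a + A)"
      unfolding power2_eq_square square_diff_square_factored abs_mult using a(1) nn by simp
    also have "\<dots> \<le> e n * (2 * A + e n)"
      using \<open>\<bar>a - A\<bar> \<le> e n\<close> \<open>a \<le> A + e n\<close> a nn by (intro mult_mono) auto
    finally show ?thesis using a by simp
  qed
  have "(\<lambda>n. (\<integral>w. (norm (Y n w))\<^sup>2 \<partial>P) - A\<^sup>2) \<longlonglongrightarrow> 0"
  proof (rule Lim_null_comparison)
    show "\<forall>\<^sub>F n in sequentially. norm ((\<integral>w. (norm (Y n w))\<^sup>2 \<partial>P) - A\<^sup>2) \<le> e n * (2 * A + e n)"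
      using bound by simp
    show "(\<lambda>n. e n * (2 * A + e n)) \<longlonglongrightarrow> 0"
      using tendsto_mult[OF e0 tendsto_add[OF tendsto_const e0], of "2 * A"] by simp
  qed
  then have "(\<lambda>n. \<integral>w. (norm (Y n w))\<^sup>2 \<partial>P) \<longlonglongrightarrow> A\<^sup>2" by (simp add: LIM_zero_iff)
  then show ?thesis by (simp add: A_def integral_nonneg)
qed

lemma norm_diff_sq_le:
  fixes x y :: "'a::real_inner"
  shows "(norm (x - y))\<^sup>2 \<le> 2 * (norm x)\<^sup>2 + 2 * (norm y)\<^sup>2"
proof -
  have "0 \<le> (norm (x + y))\<^sup>2" by simp
  then show ?thesis by (simp add: power2_norm_eq_inner inner_add inner_diff inner_commute algebra_simps)
qed

lemma integrable_rl_ker_fbm: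
  fixes \<alpha> H s t :: real
  assumes "0 < \<alpha>" "\<alpha> < 1" "1/2 < H" "1 < \<alpha> + H" "0 \<le> s" "s \<le> t"
  defines "\<rho> \<equiv> \<alpha> + 2*H - 2"
  defines "g \<equiv> \<lambda>w. (t - s + w) powr (\<alpha> - 1) * w powr \<rho> + w powr (\<alpha> - 1) * (t - s + w) powr \<rho>"
  shows "set_integrable lborel {0..s} g"
    and "has_bochner_integral (fbm_measure H) (\<lambda>p. rl_ker \<alpha> t (fst p) * rl_ker \<alpha> s (snd p))
          (H * (2*H - 1) * Beta \<alpha> (2*H - 1) * (LINT w:{0..s}|lborel. g w))"
proof -
  define p where "p = \<alpha> + \<rho>"
  have p: "0 < p" using assms by (simp add: p_def)
  have [measurable]: "g \<in> borel_measurable borel" unfolding g_def by measurable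
  have g0: "0 \<le> g w" for w by (simp add: g_def)
  have i1: "set_integrable lborel {0..s} (\<lambda>w. 2 * (0 + w) powr (p - 1) + t powr \<rho> * (0 + w) powr (\<alpha> - 1))"
    using assms p by (intro set_integral_add(1) set_integrable_mult_right powr_shift_lborel(2)) auto
  show int: "set_integrable lborel {0..s} g"
  proof (rule set_integrable_bound[OF i1])
    show "AE x in lborel. x \<in> {0..s} \<longrightarrow>
       norm (g x) \<le> norm (2 * (0 + x) powr (p - 1) + t powr \<rho> * (0 + x) powr (\<alpha> - 1))"
    proof (intro AE_I2 impI)
      fix w assume w: "w \<in> {0..s}"
      show "norm (g w) \<le> norm (2 * (0 + w) powr (p - 1) + t powr \<rho> * (0 + w) powr (\<alpha> - 1))"
      proof (cases "w = 0")
        case False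
        then have w: "0 < w" "w \<le> s" using w by auto
        have ab: "w powr (\<alpha> - 1) * w powr \<rho> = w powr (p - 1)" by (simp add: p_def powr_add[symmetric] algebra_simps)
        have "(t - s + w) powr (\<alpha> - 1) * w powr \<rho> \<le> w powr (\<alpha> - 1) * w powr \<rho>"
          using w assms by (intro mult_right_mono powr_mono2') auto
        moreover have "(t - s + w) powr \<rho> \<le> w powr \<rho> + t powr \<rho>"
        proof (cases "0 \<le> \<rho>")
          case True
          then have "(t - s + w) powr \<rho> \<le> t powr \<rho>" using w assms by (intro powr_mono2) auto
          then show ?thesis by (simp add: add_increasing)
        next
          case False
          then have "(t - s + w) powr \<rho> \<le> w powr \<rho>" using w assms by (intro powr_mono2') auto
          then show ?thesis by (simp add: add_increasing2)
        qed
        then have "w powr (\<alpha> - 1) * (t - s + w) powr \<rho> \<le> w powr (\<alpha> - 1) * (w powr \<rho> + t powr \<rho>)"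
          by (intro mult_left_mono) auto
        ultimately have "g w \<le> 2 * w powr (p - 1) + t powr \<rho> * w powr (\<alpha> - 1)"
          using ab unfolding g_def distrib_left mult.commute[of "t powr \<rho>"] by linarith
        then show ?thesis using g0[of w] by simp
      qed (simp add: g_def)
    qed
  qed (simp add: set_borel_measurable_def)
  have "(\<integral>\<^sup>+w. ennreal (g w * indicator {0..s} w) \<partial>lborel) = ennreal (LINT w:{0..s}|lborel. g w)"
    using int g0 unfolding set_integrable_def set_lebesgue_integral_def
    by (subst nn_integral_eq_integral[symmetric]) (auto simp: mult.commute)
  moreover have "0 \<le> (LINT w:{0..s}|lborel. g w)" using g0 by (simp add: set_lebesgue_integral_def)
  moreover have "0 \<le> H * (2*H - 1) * Beta \<alpha> (2*H - 1)" using assms by (simp add: Beta_def Gamma_real_nonneg)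
  ultimately show "has_bochner_integral (fbm_measure H) (\<lambda>p. rl_ker \<alpha> t (fst p) * rl_ker \<alpha> s (snd p))
          (H * (2*H - 1) * Beta \<alpha> (2*H - 1) * (LINT w:{0..s}|lborel. g w))"
    using nn_integral_rl_ker_fbm[of \<alpha> H s t] assms(1,3,5,6)
    by (intro has_bochner_integral_nn_integral) (auto simp: g_def \<rho>_def ennreal_mult)
qed

lemma rl_ker_increment_energy:
  fixes \<alpha> H s t :: real
  assumes "0 < \<alpha>" "\<alpha> < 1" "1/2 < H" "H < 1" "1 < \<alpha> + H" "0 \<le> s" "s \<le> t"
  defines "\<rho> \<equiv> \<alpha> + 2*H - 2"
  defines "f \<equiv> \<lambda>w. ((t - s + w) powr (\<alpha> - 1) - w powr (\<alpha> - 1)) * ((t - s + w) powr \<rho> - w powr \<rho>)"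
  shows "set_integrable lborel {0..s} f"
    and "has_bochner_integral (fbm_measure H)
      (\<lambda>p. (rl_ker \<alpha> t (fst p) - rl_ker \<alpha> s (fst p)) * (rl_ker \<alpha> t (snd p) - rl_ker \<alpha> s (snd p)))
      (2 * (H * (2*H - 1) * Beta \<alpha> (2*H - 1)) * ((t - s) powr (\<alpha> + \<rho>) / (\<alpha> + \<rho>) + (LINT w:{0..s}|lborel. f w)))"
proof -
  define p where "p = \<alpha> + \<rho>"
  define c where "c = H * (2*H - 1) * Beta \<alpha> (2*H - 1)"
  define g where "g = (\<lambda>w. (t - s + w) powr (\<alpha> - 1) * w powr \<rho> + w powr (\<alpha> - 1) * (t - s + w) powr \<rho>)"
  have p: "0 < p" using assms by (simp add: p_def)
  have mul: "x powr (\<alpha> - 1) * x powr \<rho> = x powr (p - 1)" for x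
    by (simp add: p_def powr_add[symmetric] algebra_simps)
  have R: "has_bochner_integral (fbm_measure H) (\<lambda>p. rl_ker \<alpha> t (fst p) * rl_ker \<alpha> t (snd p)) (c * (2 * (t powr p / p)))"
    if "0 \<le> t" for t
  proof -
    have "(LINT w:{0..t}|lborel. (t - t + w) powr (\<alpha> - 1) * w powr \<rho> + w powr (\<alpha> - 1) * (t - t + w) powr \<rho>)
       = (LINT w:{0..t}|lborel. 2 * (0 + w) powr (p - 1))"
      using mul by (intro set_lebesgue_integral_cong) auto
    also have "\<dots> = 2 * (t powr p / p)"
      using powr_shift_lborel(3)[of p 0 t 0] p that by simp
    finally show ?thesis using integrable_rl_ker_fbm(2)[of \<alpha> H t t] assms that by (simp add: c_def \<rho>_def)
  qed
  have Rts: "has_bochner_integral (fbm_measure H) (\<lambda>p. rl_ker \<alpha> t (fst p) * rl_ker \<alpha> s (snd p)) (c * (LINT w:{0..s}|lborel. g w))"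
    using integrable_rl_ker_fbm(2)[of \<alpha> H s t] assms by (simp add: c_def \<rho>_def g_def)
  have "0 \<le> (\<integral>p. rl_ker \<alpha> t (fst p) * rl_ker \<alpha> s (snd p) \<partial>fbm_measure H)"
    by (simp add: integral_nonneg)
  then have c0: "0 \<le> c * (LINT w:{0..s}|lborel. g w)"
    by (metis Rts has_bochner_integral_integral_eq)
  have "(\<integral>\<^sup>+p. ennreal (rl_ker \<alpha> s (fst p) * rl_ker \<alpha> t (snd p)) \<partial>fbm_measure H)
        = (\<integral>\<^sup>+p. ennreal (rl_ker \<alpha> t (fst p) * rl_ker \<alpha> s (snd p)) \<partial>fbm_measure H)"
    using assms(3) by (intro nn_integral_fbm_measure_swap) auto
  also have "\<dots> = ennreal (c * (LINT w:{0..s}|lborel. g w))"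
    using Rts by (subst nn_integral_eq_integral) (auto simp: has_bochner_integral_iff)
  finally have Rst: "has_bochner_integral (fbm_measure H) (\<lambda>p. rl_ker \<alpha> s (fst p) * rl_ker \<alpha> t (snd p)) (c * (LINT w:{0..s}|lborel. g w))"
    using c0 by (intro has_bochner_integral_nn_integral) auto
  have gint: "set_integrable lborel {0..s} g"
    using integrable_rl_ker_fbm(1)[of \<alpha> H s t] assms by (simp add: g_def \<rho>_def)
  have i1: "set_integrable lborel {0..s} (\<lambda>w. (t - s + w) powr (p - 1))"
      "(LINT w:{0..s}|lborel. (t - s + w) powr (p - 1)) = (t powr p - (t - s) powr p) / p"
    using powr_shift_lborel(2,3)[of p 0 s "t - s"] p assms by auto
  have i2: "set_integrable lborel {0..s} (\<lambda>w. w powr (p - 1))"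
      "(LINT w:{0..s}|lborel. w powr (p - 1)) = s powr p / p"
    using powr_shift_lborel(2,3)[of p 0 s 0] p assms by auto
  have fg: "f w = (t - s + w) powr (p - 1) + w powr (p - 1) - g w" for w
    using mul[of w] mul[of "t - s + w"] by (simp add: f_def g_def algebra_simps)
  show fint: "set_integrable lborel {0..s} f" unfolding fg
    by (intro set_integral_diff(1) set_integral_add(1) i1 i2 gint)
  have fI: "(LINT w:{0..s}|lborel. f w) = (t powr p - (t - s) powr p) / p + s powr p / p - (LINT w:{0..s}|lborel. g w)"
    unfolding fg using i1 i2 gint by (simp add: set_integral_diff(2) set_integral_add)
  have "has_bochner_integral (fbm_measure H)
      (\<lambda>p. rl_ker \<alpha> t (fst p) * rl_ker \<alpha> t (snd p) + rl_ker \<alpha> s (fst p) * rl_ker \<alpha> s (snd p)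
         - rl_ker \<alpha> t (fst p) * rl_ker \<alpha> s (snd p) - rl_ker \<alpha> s (fst p) * rl_ker \<alpha> t (snd p))
      (c * (2 * (t powr p / p)) + c * (2 * (s powr p / p)) - c * (LINT w:{0..s}|lborel. g w) - c * (LINT w:{0..s}|lborel. g w))"
    using assms by (intro has_bochner_integral_diff has_bochner_integral_add R Rts Rst) auto
  also have "c * (2 * (t powr p / p)) + c * (2 * (s powr p / p)) - c * (LINT w:{0..s}|lborel. g w) - c * (LINT w:{0..s}|lborel. g w)
     = 2 * c * ((t - s) powr p / p + (LINT w:{0..s}|lborel. f w))"
    unfolding fI using p by (simp add: field_simps)
  finally show "has_bochner_integral (fbm_measure H)
      (\<lambda>p. (rl_ker \<alpha> t (fst p) - rl_ker \<alpha> s (fst p)) * (rl_ker \<alpha> t (snd p) - rl_ker \<alpha> s (snd p)))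
      (2 * (H * (2*H - 1) * Beta \<alpha> (2*H - 1)) * ((t - s) powr (\<alpha> + \<rho>) / (\<alpha> + \<rho>) + (LINT w:{0..s}|lborel. f w)))"
    by (simp add: c_def p_def algebra_simps)
qed

lemma rl_ker_increment_energy_le:
  fixes \<alpha> H :: real
  assumes "0 < \<alpha>" "\<alpha> < 1" "1/2 < H" "H < 1" "1 < \<alpha> + H"
  obtains C where "0 \<le> C"
    "\<And>s t. 0 \<le> s \<Longrightarrow> s \<le> t \<Longrightarrow> \<exists>v. has_bochner_integral (fbm_measure H)
      (\<lambda>p. (rl_ker \<alpha> t (fst p) - rl_ker \<alpha> s (fst p)) * (rl_ker \<alpha> t (snd p) - rl_ker \<alpha> s (snd p))) v
      \<and> v \<le> C * (t - s) powr (2 * (\<alpha> + H - 1)) \<and> (\<alpha> = 2 - 2*H \<longrightarrow> v = C * (t - s) powr (2 * (\<alpha> + H - 1)))"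
proof -
  define \<rho> where "\<rho> = \<alpha> + 2*H - 2"
  define p where "p = 2 * (\<alpha> + H - 1)"
  define c where "c = H * (2*H - 1) * Beta \<alpha> (2*H - 1)"
  define K where "K = (if \<rho> < 0 then 1 / p + 1 / (1 - p) else 0)"
  have p: "0 < p" "\<alpha> + \<rho> = p" using assms by (auto simp: p_def \<rho>_def)
  have c: "0 \<le> c" using assms by (simp add: c_def Beta_def Gamma_real_nonneg)
  have K: "0 \<le> K" using p assms by (auto simp: K_def)
  show ?thesis
  proof (rule that[of "2 * c * (1 / p + K)"])
    show "0 \<le> 2 * c * (1 / p + K)" using c p K by simp
    fix s t :: real assume st: "0 \<le> s" "s \<le> t"
    define f where "f = (\<lambda>w. ((t - s + w) powr (\<alpha> - 1) - w powr (\<alpha> - 1)) * ((t - s + w) powr \<rho> - w powr \<rho>))"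
    have [measurable]: "f \<in> borel_measurable borel" unfolding f_def by measurable
    have f: "set_integrable lborel {0..s} f" "has_bochner_integral (fbm_measure H)
      (\<lambda>p. (rl_ker \<alpha> t (fst p) - rl_ker \<alpha> s (fst p)) * (rl_ker \<alpha> t (snd p) - rl_ker \<alpha> s (snd p)))
      (2 * c * ((t - s) powr p / p + (LINT w:{0..s}|lborel. f w)))"
      using rl_ker_increment_energy[OF assms st] unfolding p(2)[symmetric] by (auto simp: f_def \<rho>_def c_def)
    have neg: "(t - s + w) powr (\<alpha> - 1) \<le> w powr (\<alpha> - 1)" if "0 < w" for w
      using assms st that by (intro powr_mono2') auto
    have "(\<integral>\<^sup>+w. ennreal (indicator {0..s} w *\<^sub>R f w) \<partial>lborel) \<le> ennreal (K * (t - s) powr p)"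
    proof (cases "\<rho> < 0 \<and> s < t")
      case True
      then have "p < 1" using assms p by linarith
      have "(\<integral>\<^sup>+w. ennreal (indicator {0..s} w *\<^sub>R f w) \<partial>lborel)
        \<le> (\<integral>\<^sup>+w. ennreal (w powr (p - 1) * min 1 ((t - s) / w) * indicator {0<..} w) \<partial>lborel)"
      proof (rule nn_integral_mono_AE)
        have "AE w in lborel. w \<noteq> (0::real)" by (rule AE_lborel_singleton)
        then show "AE w in lborel. ennreal (indicator {0..s} w *\<^sub>R f w)
            \<le> ennreal (w powr (p - 1) * min 1 ((t - s) / w) * indicator {0<..} w)"
        proof eventually_elim
          case (elim w)
          show ?case
          proof (cases "w \<in> {0..s}")
            case w: True
            with elim have w: "0 < w" "w \<le> s" by auto
            have "f w = (w powr (\<alpha> - 1) - (t - s + w) powr (\<alpha> - 1)) * (w powr \<rho> - (t - s + w) powr \<rho>)"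
              by (simp add: f_def algebra_simps)
            also have "\<dots> \<le> w powr (\<alpha> - 1) * (w powr \<rho> * min 1 ((t - s) / w))"
            proof (rule mult_mono)
              show "w powr \<rho> - (t - s + w) powr \<rho> \<le> w powr \<rho> * min 1 ((t - s) / w)"
                using w st assms by (intro powr_diff_le_min) (auto simp: \<rho>_def)
              show "0 \<le> w powr \<rho> - (t - s + w) powr \<rho>"
                using w st True by (simp add: powr_mono2')
            qed auto
            also have "\<dots> = w powr (p - 1) * min 1 ((t - s) / w)"
              unfolding p(2)[symmetric] using w by (simp add: powr_add powr_diff)
            finally show ?thesis using w by (simp add: ennreal_leI)
          qed simp
        qed
      qed
      also have "\<dots> \<le> ennreal ((t - s) powr p * (1 / p + 1 / (1 - p)))"
        using True p \<open>p < 1\<close> by (intro nn_integral_powr_min_le) auto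
      finally show ?thesis using True by (simp add: K_def mult.commute)
    next
      case False
      have "(\<integral>\<^sup>+w. ennreal (indicator {0..s} w *\<^sub>R f w) \<partial>lborel) \<le> (\<integral>\<^sup>+w. 0 \<partial>(lborel :: real measure))"
      proof (rule nn_integral_mono_AE)
        have "AE w in lborel. w \<noteq> (0::real)" by (rule AE_lborel_singleton)
        then show "AE w in lborel. ennreal (indicator {0..s} w *\<^sub>R f w) \<le> 0"
        proof eventually_elim
          case (elim w)
          have "f w \<le> 0" if w: "0 < w" "w \<le> s"
          proof (cases "s < t")
            case True
            then have "w powr \<rho> \<le> (t - s + w) powr \<rho>"
              using w False by (intro powr_mono2) auto
            then show ?thesis using neg[OF w(1)] by (simp add: f_def mult_nonpos_nonneg)
          qed (use st in \<open>simp add: f_def\<close>)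
          then show ?case using elim by (auto simp: indicator_def ennreal_neg)
        qed
      qed
      then show ?thesis by simp
    qed
    then have fle: "(LINT w:{0..s}|lborel. f w) \<le> K * (t - s) powr p"
      unfolding set_lebesgue_integral_def by (intro integral_real_bounded) (use K in auto)
    have feq: "(LINT w:{0..s}|lborel. f w) = 0 \<and> K = 0" if "\<alpha> = 2 - 2*H"
    proof -
      have "\<rho> = 0" using that by (simp add: \<rho>_def)
      moreover have "(LINT w:{0..s}|lborel. f w) = 0"
        unfolding set_lebesgue_integral_def
      proof (rule integral_eq_zero_AE)
        have "AE w in lborel. w \<noteq> (0::real)" by (rule AE_lborel_singleton)
        then show "AE w in lborel. indicator {0..s} w *\<^sub>R f w = 0"
          by eventually_elim (use st \<open>\<rho> = 0\<close> in \<open>auto simp: f_def indicator_def\<close>)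
      qed
      ultimately show ?thesis by (simp add: K_def)
    qed
    show "\<exists>v. has_bochner_integral (fbm_measure H)
      (\<lambda>p. (rl_ker \<alpha> t (fst p) - rl_ker \<alpha> s (fst p)) * (rl_ker \<alpha> t (snd p) - rl_ker \<alpha> s (snd p))) v
      \<and> v \<le> 2 * c * (1 / p + K) * (t - s) powr (2 * (\<alpha> + H - 1))
      \<and> (\<alpha> = 2 - 2*H \<longrightarrow> v = 2 * c * (1 / p + K) * (t - s) powr (2 * (\<alpha> + H - 1)))"
    proof (intro exI conjI impI, rule f(2))
      have "2 * c * ((t - s) powr p / p + (LINT w:{0..s}|lborel. f w)) \<le> 2 * c * ((t - s) powr p / p + K * (t - s) powr p)"
        using fle c by (intro mult_left_mono add_left_mono) auto
      also have "\<dots> = 2 * c * (1 / p + K) * (t - s) powr p" by (simp add: ring_distribs)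
      finally show "2 * c * ((t - s) powr p / p + (LINT w:{0..s}|lborel. f w)) \<le> 2 * c * (1 / p + K) * (t - s) powr (2 * (\<alpha> + H - 1))"
        unfolding p_def .
    qed (use feq in \<open>simp add: p_def\<close>)
  qed
qed

lemma RL_fBm_increments:
  fixes P :: "'w measure" and B G :: "real \<Rightarrow> 'w \<Rightarrow> real^'d"
  assumes P: "prob_space P" and T: "0 < T" and \<alpha>: "0 < \<alpha>" "\<alpha> < 1" and H: "1/2 < H" "H < 1"
    and \<sigma>: "0 < \<sigma>" and B: "is_fBm P H B" and G: "is_RL_fBm_integral P \<alpha> \<sigma> B T G"
  shows "1 < \<alpha> + H"
    and "\<exists>C\<ge>0. \<forall>s\<in>{0..T}. \<forall>t\<in>{0..T}. integrable P (\<lambda>w. (norm (G t w - G s w))\<^sup>2) \<and>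
        (\<integral>w. (norm (G t w - G s w))\<^sup>2 \<partial>P) \<le> C * \<bar>t - s\<bar> powr (2 * (\<alpha> + H - 1)) \<and>
        (\<alpha> = 2 - 2*H \<longrightarrow> (\<integral>w. (norm (G t w - G s w))\<^sup>2 \<partial>P) = C * \<bar>t - s\<bar> powr (2 * (\<alpha> + H - 1)))"
    and "AE w in P. G 0 w = 0"
proof -
  define d where "d = real CARD('d)"
  define c where "c = \<sigma> / Gamma \<alpha>"
  have c: "0 < c" using \<sigma> \<alpha> by (simp add: c_def)
  have d: "0 < d" by (simp add: d_def)
  define W where "W = (\<lambda>t n w. \<Sum>i<n. ((t - t * real i / real n) powr (\<alpha> - 1)) *\<^sub>R
                 (B (t * real (Suc i) / real n) w - B (t * real i / real n) w))"
  have Bm: "B t \<in> borel_measurable P" if "0 \<le> t" for t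
    using fbm_covariance(2)[OF P B H(1) that that] .
  have we: "wiener_elementary B (W t n) (rl_step \<alpha> t n)" if "0 \<le> t" for t n
    unfolding W_def by (rule wiener_rl_step[OF that])
  have Wm: "W t n \<in> borel_measurable P" if "0 \<le> t" for t n
    using wiener_elementary_measurable(1)[OF we[OF that] Bm] .
  have sm [measurable]: "rl_step \<alpha> t n \<in> borel_measurable borel" for t n
    unfolding rl_step_def by measurable
  have Gt: "G t \<in> borel_measurable P" "integrable P (\<lambda>w. (norm (c *\<^sub>R W t n w - G t w))\<^sup>2)"
    "(\<lambda>n. \<integral>w. (norm (c *\<^sub>R W t n w - G t w))\<^sup>2 \<partial>P) \<longlonglongrightarrow> 0" if "t \<in> {0..T}" for t n
    using G that unfolding is_RL_fBm_integral_def L2_lim_def W_def c_def by auto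
  have Gi: "integrable P (\<lambda>w. (norm (G t w))\<^sup>2)" if "t \<in> {0..T}" for t
    using Gt(2)[OF that, of 0] by (simp add: W_def)
  have lim: "(\<lambda>n. c\<^sup>2 * (d * (\<integral>p. (rl_step \<alpha> t n (fst p) - rl_step \<alpha> s n (fst p)) * (rl_step \<alpha> t n (snd p) - rl_step \<alpha> s n (snd p)) \<partial>fbm_measure H)))
      \<longlonglongrightarrow> (\<integral>w. (norm (G t w - G s w))\<^sup>2 \<partial>P) \<and> integrable P (\<lambda>w. (norm (G t w - G s w))\<^sup>2)"
    if t: "t \<in> {0..T}" and s: "s \<in> {0..T}" for s t
  proof -
    note [measurable] = Gt(1)[OF t] Gt(1)[OF s]
    have t0: "0 \<le> t" "0 \<le> s" using t s by auto
    have [measurable]: "W t n \<in> borel_measurable P" "W s n \<in> borel_measurable P" for n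
      using Wm t0 by auto
    define Y where "Y = (\<lambda>n w. c *\<^sub>R (W t n w - W s n w))"
    have [measurable]: "Y n \<in> borel_measurable P" for n unfolding Y_def by measurable
    have Vi: "integrable P (\<lambda>w. (norm (G t w - G s w))\<^sup>2)"
    proof (rule Bochner_Integration.integrable_bound)
      show "integrable P (\<lambda>w. 2 * (norm (G t w))\<^sup>2 + 2 * (norm (G s w))\<^sup>2)" using Gi t s by simp
      show "AE w in P. norm ((norm (G t w - G s w))\<^sup>2) \<le> norm (2 * (norm (G t w))\<^sup>2 + 2 * (norm (G s w))\<^sup>2)"
        using norm_diff_sq_le by (intro AE_I2) auto
    qed auto
    have bd: "(norm (Y n w - (G t w - G s w)))\<^sup>2 \<le> 2 * (norm (c *\<^sub>R W t n w - G t w))\<^sup>2 + 2 * (norm (c *\<^sub>R W s n w - G s w))\<^sup>2" for n w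
      using norm_diff_sq_le[of "c *\<^sub>R W t n w - G t w" "c *\<^sub>R W s n w - G s w"]
      by (simp add: Y_def algebra_simps)
    have bi: "integrable P (\<lambda>w. 2 * (norm (c *\<^sub>R W t n w - G t w))\<^sup>2 + 2 * (norm (c *\<^sub>R W s n w - G s w))\<^sup>2)" for n
      using Gt(2) t s by simp
    have Yi: "integrable P (\<lambda>w. (norm (Y n w - (G t w - G s w)))\<^sup>2)" for n
      by (rule Bochner_Integration.integrable_bound[OF bi[of n]]) (use bd in auto)
    have "(\<lambda>n. \<integral>w. (norm (Y n w - (G t w - G s w)))\<^sup>2 \<partial>P) \<longlonglongrightarrow> 0"
    proof (rule real_tendsto_sandwich)
      show "\<forall>\<^sub>F n in sequentially. 0 \<le> (\<integral>w. (norm (Y n w - (G t w - G s w)))\<^sup>2 \<partial>P)" by simp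
      show "\<forall>\<^sub>F n in sequentially. (\<integral>w. (norm (Y n w - (G t w - G s w)))\<^sup>2 \<partial>P)
         \<le> 2 * (\<integral>w. (norm (c *\<^sub>R W t n w - G t w))\<^sup>2 \<partial>P) + 2 * (\<integral>w. (norm (c *\<^sub>R W s n w - G s w))\<^sup>2 \<partial>P)"
      proof (intro always_eventually allI)
        fix n
        show "(\<integral>w. (norm (Y n w - (G t w - G s w)))\<^sup>2 \<partial>P)
         \<le> 2 * (\<integral>w. (norm (c *\<^sub>R W t n w - G t w))\<^sup>2 \<partial>P) + 2 * (\<integral>w. (norm (c *\<^sub>R W s n w - G s w))\<^sup>2 \<partial>P)"
          using integral_mono[OF Yi[of n] bi[of n]] bd Gt(2) t s by simp
      qed
      show "(\<lambda>n. 2 * (\<integral>w. (norm (c *\<^sub>R W t n w - G t w))\<^sup>2 \<partial>P) + 2 * (\<integral>w. (norm (c *\<^sub>R W s n w - G s w))\<^sup>2 \<partial>P)) \<longlonglongrightarrow> 0"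
        by (rule tendsto_eq_intros Gt(3)[OF t] Gt(3)[OF s] refl | simp)+
    qed simp
    from L2_norm_tendsto[OF Vi Yi this]
    have "(\<lambda>n. \<integral>w. (norm (Y n w))\<^sup>2 \<partial>P) \<longlonglongrightarrow> (\<integral>w. (norm (G t w - G s w))\<^sup>2 \<partial>P)" by simp
    moreover have "(\<integral>w. (norm (Y n w))\<^sup>2 \<partial>P) = c\<^sup>2 * (d * (\<integral>p. (rl_step \<alpha> t n (fst p) - rl_step \<alpha> s n (fst p)) * (rl_step \<alpha> t n (snd p) - rl_step \<alpha> s n (snd p)) \<partial>fbm_measure H))" for n
    proof -
      have w: "wiener_elementary B (\<lambda>w. W t n w - W s n w) (\<lambda>u. rl_step \<alpha> t n u - rl_step \<alpha> s n u)"
        using we t0 by (intro wiener_diff) auto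
      from wiener_isometry[OF P B H(1) w w]
      have "(\<integral>w. (W t n w - W s n w) \<bullet> (W t n w - W s n w) \<partial>P) = d * (\<integral>p. (rl_step \<alpha> t n (fst p) - rl_step \<alpha> s n (fst p)) * (rl_step \<alpha> t n (snd p) - rl_step \<alpha> s n (snd p)) \<partial>fbm_measure H)"
        by (auto simp: has_bochner_integral_iff d_def)
      then show ?thesis by (simp add: Y_def power_mult_distrib power2_norm_eq_inner)
    qed
    ultimately show ?thesis using Vi by simp
  qed
  have ker0: "rl_step \<alpha> 0 n u = 0" for n u
    unfolding rl_step_def by simp
  show G0: "AE w in P. G 0 w = 0"
  proof -
    have W0: "W 0 n w = 0" for n w by (simp add: W_def)
    have "(\<integral>w. (norm (G 0 w))\<^sup>2 \<partial>P) = 0"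
      using Gt(3)[of 0] T W0 by (simp add: LIMSEQ_const_iff)
    then have "AE w in P. (norm (G 0 w))\<^sup>2 = 0"
      using Gi[of 0] T by (subst (asm) integral_nonneg_eq_0_iff_AE) auto
    then show ?thesis by simp
  qed
  \<comment> \<open>Otherwise, by Fatou's lemma, the variances of the Riemann sums would be unbounded.\<close>
  show aH: "1 < \<alpha> + H"
  proof (rule ccontr)
    assume "\<not> 1 < \<alpha> + H"
    then have neg: "2 * (\<alpha> + H - 1) \<le> 0" by simp
    define e where "e = (\<integral>w. (norm (G T w - G 0 w))\<^sup>2 \<partial>P)"
    define I where "I = (\<lambda>n. \<integral>p. rl_step \<alpha> T n (fst p) * rl_step \<alpha> T n (snd p) \<partial>fbm_measure H)"
    have "(\<lambda>n. c\<^sup>2 * (d * I n)) \<longlonglongrightarrow> e"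
      using lim[of T 0] T by (simp add: I_def e_def ker0)
    from tendsto_divide[OF this tendsto_const, of "c\<^sup>2 * d"] have I: "I \<longlonglongrightarrow> e / (c\<^sup>2 * d)"
      using c d by simp
    have "(\<integral>\<^sup>+p. ennreal (rl_ker \<alpha> T (fst p) * rl_ker \<alpha> T (snd p)) \<partial>fbm_measure H)
      = (\<integral>\<^sup>+p. liminf (\<lambda>n. ennreal (rl_step \<alpha> T n (fst p) * rl_step \<alpha> T n (snd p))) \<partial>fbm_measure H)"
    proof (rule nn_integral_cong)
      fix p :: "real \<times> real"
      have "(\<lambda>n. ennreal (rl_step \<alpha> T n (fst p) * rl_step \<alpha> T n (snd p))) \<longlonglongrightarrow> ennreal (rl_ker \<alpha> T (fst p) * rl_ker \<alpha> T (snd p))"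
        using T by (intro tendsto_ennrealI tendsto_mult rl_step_tendsto) auto
      from lim_imp_Liminf[OF _ this] show "ennreal (rl_ker \<alpha> T (fst p) * rl_ker \<alpha> T (snd p))
        = liminf (\<lambda>n. ennreal (rl_step \<alpha> T n (fst p) * rl_step \<alpha> T n (snd p)))" by simp
    qed
    also have "\<dots> \<le> liminf (\<lambda>n. \<integral>\<^sup>+p. ennreal (rl_step \<alpha> T n (fst p) * rl_step \<alpha> T n (snd p)) \<partial>fbm_measure H)"
      by (rule nn_integral_liminf) auto
    also have "(\<lambda>n. \<integral>\<^sup>+p. ennreal (rl_step \<alpha> T n (fst p) * rl_step \<alpha> T n (snd p)) \<partial>fbm_measure H) = (\<lambda>n. ennreal (I n))"
    proof
      fix n
      have "integrable (fbm_measure H) (\<lambda>p. rl_step \<alpha> T n (fst p) * rl_step \<alpha> T n (snd p))"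
        using wiener_isometry[OF P B H(1) we we, of T T n n] T by (auto simp: has_bochner_integral_iff)
      then show "(\<integral>\<^sup>+p. ennreal (rl_step \<alpha> T n (fst p) * rl_step \<alpha> T n (snd p)) \<partial>fbm_measure H) = ennreal (I n)"
        unfolding I_def using T \<alpha> by (intro nn_integral_eq_integral) (auto simp: rl_step_bounds)
    qed
    also have "liminf (\<lambda>n. ennreal (I n)) = ennreal (e / (c\<^sup>2 * d))"
      using I by (intro lim_imp_Liminf tendsto_ennrealI) auto
    finally have fin: "(\<integral>\<^sup>+p. ennreal (rl_ker \<alpha> T (fst p) * rl_ker \<alpha> T (snd p)) \<partial>fbm_measure H) < \<infinity>"
      by (auto simp: less_top[symmetric] top_unique)
    have beta: "0 < H * (2*H - 1) * Beta \<alpha> (2*H - 1)" using H \<alpha> by (simp add: Beta_def Gamma_real_pos)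
    have "(\<infinity>::ennreal) = (\<integral>\<^sup>+w. ennreal (w powr (2 * (\<alpha> + H - 1) - 1) * indicator {0..T} w) \<partial>lborel)"
      using nn_integral_powr_eq_top[OF neg T] by simp
    also have "\<dots> \<le> (\<integral>\<^sup>+w. ennreal (((T - T + w) powr (\<alpha> - 1) * w powr (\<alpha> + 2*H - 2) + w powr (\<alpha> - 1) * (T - T + w) powr (\<alpha> + 2*H - 2)) * indicator {0..T} w) \<partial>lborel)"
    proof (rule nn_integral_mono)
      fix w
      have "w powr (2 * (\<alpha> + H - 1) - 1) = w powr (\<alpha> - 1) * w powr (\<alpha> + 2*H - 2)"
        by (simp add: powr_add[symmetric] algebra_simps)
      then show "ennreal (w powr (2 * (\<alpha> + H - 1) - 1) * indicator {0..T} w)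
        \<le> ennreal (((T - T + w) powr (\<alpha> - 1) * w powr (\<alpha> + 2*H - 2) + w powr (\<alpha> - 1) * (T - T + w) powr (\<alpha> + 2*H - 2)) * indicator {0..T} w)"
        by (intro ennreal_leI mult_right_mono) auto
    qed
    finally have inf: "(\<integral>\<^sup>+w. ennreal (((T - T + w) powr (\<alpha> - 1) * w powr (\<alpha> + 2*H - 2) + w powr (\<alpha> - 1) * (T - T + w) powr (\<alpha> + 2*H - 2)) * indicator {0..T} w) \<partial>lborel) = \<infinity>"
      by (simp add: top_unique)
    have "(\<integral>\<^sup>+p. ennreal (rl_ker \<alpha> T (fst p) * rl_ker \<alpha> T (snd p)) \<partial>fbm_measure H)
        = ennreal (H * (2*H - 1) * Beta \<alpha> (2*H - 1)) * \<infinity>"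
      using nn_integral_rl_ker_fbm[OF \<alpha>(1) H(1), of T T] T unfolding inf by simp
    also have "\<dots> = \<infinity>" using beta by (auto simp: ennreal_mult_top)
    finally show False using fin by simp
  qed
  obtain C where C: "0 \<le> C" "\<And>s t. 0 \<le> s \<Longrightarrow> s \<le> t \<Longrightarrow> \<exists>v. has_bochner_integral (fbm_measure H)
      (\<lambda>p. (rl_ker \<alpha> t (fst p) - rl_ker \<alpha> s (fst p)) * (rl_ker \<alpha> t (snd p) - rl_ker \<alpha> s (snd p))) v
      \<and> v \<le> C * (t - s) powr (2 * (\<alpha> + H - 1)) \<and> (\<alpha> = 2 - 2*H \<longrightarrow> v = C * (t - s) powr (2 * (\<alpha> + H - 1)))"
    by (rule rl_ker_increment_energy_le[OF \<alpha> H aH]) auto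
  have main: "(\<integral>w. (norm (G t w - G s w))\<^sup>2 \<partial>P) \<le> c\<^sup>2 * d * C * (t - s) powr (2 * (\<alpha> + H - 1)) \<and>
        (\<alpha> = 2 - 2*H \<longrightarrow> (\<integral>w. (norm (G t w - G s w))\<^sup>2 \<partial>P) = c\<^sup>2 * d * C * (t - s) powr (2 * (\<alpha> + H - 1)))"
    if st: "s \<in> {0..T}" "t \<in> {0..T}" "s \<le> t" for s t
  proof -
    have st0: "0 \<le> s" "0 \<le> t" using st by auto
    obtain v where v: "has_bochner_integral (fbm_measure H)
      (\<lambda>p. (rl_ker \<alpha> t (fst p) - rl_ker \<alpha> s (fst p)) * (rl_ker \<alpha> t (snd p) - rl_ker \<alpha> s (snd p))) v"
      "v \<le> C * (t - s) powr (2 * (\<alpha> + H - 1))" "\<alpha> = 2 - 2*H \<longrightarrow> v = C * (t - s) powr (2 * (\<alpha> + H - 1))"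
      using C(2)[of s t] st by auto
    have R: "integrable (fbm_measure H) (\<lambda>p. rl_ker \<alpha> a (fst p) * rl_ker \<alpha> b (snd p))" if "0 \<le> a" "0 \<le> b" for a b
    proof -
      have "(\<integral>\<^sup>+p. ennreal (rl_ker \<alpha> a (fst p) * rl_ker \<alpha> b (snd p)) \<partial>fbm_measure H) < \<infinity>"
      proof (cases "b \<le> a")
        case True
        with integrable_rl_ker_fbm(2)[of \<alpha> H b a] \<alpha> H aH that show ?thesis
          by (auto simp: has_bochner_integral_iff nn_integral_eq_integral)
      next
        case False
        have "(\<integral>\<^sup>+p. ennreal (rl_ker \<alpha> a (fst p) * rl_ker \<alpha> b (snd p)) \<partial>fbm_measure H)
          = (\<integral>\<^sup>+p. ennreal (rl_ker \<alpha> b (fst p) * rl_ker \<alpha> a (snd p)) \<partial>fbm_measure H)"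
          using H(1) by (intro nn_integral_fbm_measure_swap) auto
        with False integrable_rl_ker_fbm(2)[of \<alpha> H a b] \<alpha> H aH that show ?thesis
          by (auto simp: has_bochner_integral_iff nn_integral_eq_integral)
      qed
      then show ?thesis by (intro integrableI_nonneg) auto
    qed
    have "(\<lambda>n. \<integral>p. (rl_step \<alpha> t n (fst p) - rl_step \<alpha> s n (fst p)) * (rl_step \<alpha> t n (snd p) - rl_step \<alpha> s n (snd p)) \<partial>fbm_measure H)
       \<longlonglongrightarrow> (\<integral>p. (rl_ker \<alpha> t (fst p) - rl_ker \<alpha> s (fst p)) * (rl_ker \<alpha> t (snd p) - rl_ker \<alpha> s (snd p)) \<partial>fbm_measure H)"
    proof (rule integral_dominated_convergence[where w="\<lambda>p. (rl_ker \<alpha> t (fst p) + rl_ker \<alpha> s (fst p)) * (rl_ker \<alpha> t (snd p) + rl_ker \<alpha> s (snd p))"])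
      have "(\<lambda>p. (rl_ker \<alpha> t (fst p) + rl_ker \<alpha> s (fst p)) * (rl_ker \<alpha> t (snd p) + rl_ker \<alpha> s (snd p)))
        = (\<lambda>p. rl_ker \<alpha> t (fst p) * rl_ker \<alpha> t (snd p) + rl_ker \<alpha> t (fst p) * rl_ker \<alpha> s (snd p)
           + rl_ker \<alpha> s (fst p) * rl_ker \<alpha> t (snd p) + rl_ker \<alpha> s (fst p) * rl_ker \<alpha> s (snd p))"
        by (simp add: fun_eq_iff algebra_simps)
      then show "integrable (fbm_measure H) (\<lambda>p. (rl_ker \<alpha> t (fst p) + rl_ker \<alpha> s (fst p)) * (rl_ker \<alpha> t (snd p) + rl_ker \<alpha> s (snd p)))"
        using R st0 by auto
      show "AE p in fbm_measure H. (\<lambda>n. (rl_step \<alpha> t n (fst p) - rl_step \<alpha> s n (fst p)) * (rl_step \<alpha> t n (snd p) - rl_step \<alpha> s n (snd p)))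
        \<longlonglongrightarrow> (rl_ker \<alpha> t (fst p) - rl_ker \<alpha> s (fst p)) * (rl_ker \<alpha> t (snd p) - rl_ker \<alpha> s (snd p))"
        using st0 by (intro AE_I2 tendsto_mult tendsto_diff rl_step_tendsto)
      have "\<bar>rl_step \<alpha> t n u - rl_step \<alpha> s n u\<bar> \<le> rl_ker \<alpha> t u + rl_ker \<alpha> s u" for n u
        using rl_step_bounds[OF st0(1) \<alpha>(2), of n u] rl_step_bounds[OF st0(2) \<alpha>(2), of n u] by linarith
      then show "AE p in fbm_measure H. norm ((rl_step \<alpha> t n (fst p) - rl_step \<alpha> s n (fst p)) * (rl_step \<alpha> t n (snd p) - rl_step \<alpha> s n (snd p)))
        \<le> (rl_ker \<alpha> t (fst p) + rl_ker \<alpha> s (fst p)) * (rl_ker \<alpha> t (snd p) + rl_ker \<alpha> s (snd p))" for n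
        by (intro AE_I2) (auto simp: abs_mult intro!: mult_mono add_nonneg_nonneg)
    qed measurable
    then have "(\<lambda>n. c\<^sup>2 * (d * (\<integral>p. (rl_step \<alpha> t n (fst p) - rl_step \<alpha> s n (fst p)) * (rl_step \<alpha> t n (snd p) - rl_step \<alpha> s n (snd p)) \<partial>fbm_measure H)))
        \<longlonglongrightarrow> c\<^sup>2 * (d * v)"
      using v(1) by (auto simp: has_bochner_integral_iff intro!: tendsto_mult)
    then have e: "(\<integral>w. (norm (G t w - G s w))\<^sup>2 \<partial>P) = c\<^sup>2 * d * v"
      using lim[OF st(2,1)] LIMSEQ_unique by (auto simp: mult.assoc)
    have "c\<^sup>2 * d * v \<le> c\<^sup>2 * d * (C * (t - s) powr (2 * (\<alpha> + H - 1)))"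
      using v(2) d by (intro mult_left_mono) auto
    then show ?thesis unfolding e using v(3) by (simp add: mult.assoc)
  qed
  show "\<exists>C\<ge>0. \<forall>s\<in>{0..T}. \<forall>t\<in>{0..T}. integrable P (\<lambda>w. (norm (G t w - G s w))\<^sup>2) \<and>
        (\<integral>w. (norm (G t w - G s w))\<^sup>2 \<partial>P) \<le> C * \<bar>t - s\<bar> powr (2 * (\<alpha> + H - 1)) \<and>
        (\<alpha> = 2 - 2*H \<longrightarrow> (\<integral>w. (norm (G t w - G s w))\<^sup>2 \<partial>P) = C * \<bar>t - s\<bar> powr (2 * (\<alpha> + H - 1)))"
  proof (intro exI[of _ "c\<^sup>2 * d * C"] conjI ballI)
    show "0 \<le> c\<^sup>2 * d * C" using C d by simp
    fix s t assume st: "s \<in> {0..T}" "t \<in> {0..T}"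
    show "integrable P (\<lambda>w. (norm (G t w - G s w))\<^sup>2)" using lim st by blast
    have sym: "(\<integral>w. (norm (G t w - G s w))\<^sup>2 \<partial>P) = (\<integral>w. (norm (G s w - G t w))\<^sup>2 \<partial>P)"
      by (simp add: norm_minus_commute)
    show "(\<integral>w. (norm (G t w - G s w))\<^sup>2 \<partial>P) \<le> c\<^sup>2 * d * C * \<bar>t - s\<bar> powr (2 * (\<alpha> + H - 1))"
      "\<alpha> = 2 - 2*H \<longrightarrow> (\<integral>w. (norm (G t w - G s w))\<^sup>2 \<partial>P) = c\<^sup>2 * d * C * \<bar>t - s\<bar> powr (2 * (\<alpha> + H - 1))"
      using main[of s t] main[of t s] st sym by (cases "s \<le> t"; simp add: abs_if)+
  qed
qed

section \<open>Moments and regularity of the solution\<close>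

lemma floor_approx_tendsto:
  fixes t :: real
  shows "(\<lambda>n. real_of_int \<lfloor>real (Suc n) * t\<rfloor> / real (Suc n)) \<longlonglongrightarrow> t"
proof (rule real_tendsto_sandwich)
  show "(\<lambda>n. t - 1 / real (Suc n)) \<longlonglongrightarrow> t"
    using tendsto_diff[OF tendsto_const LIMSEQ_inverse_real_of_nat, of t] by (simp add: inverse_eq_divide)
  show "\<forall>\<^sub>F n in sequentially. t - 1 / real (Suc n) \<le> real_of_int \<lfloor>real (Suc n) * t\<rfloor> / real (Suc n)"
  proof (intro always_eventually allI)
    fix n
    have "real (Suc n) * t - 1 \<le> real_of_int \<lfloor>real (Suc n) * t\<rfloor>" by linarith
    then have "(real (Suc n) * t - 1) / real (Suc n) \<le> real_of_int \<lfloor>real (Suc n) * t\<rfloor> / real (Suc n)"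
      by (rule divide_right_mono) simp
    then show "t - 1 / real (Suc n) \<le> real_of_int \<lfloor>real (Suc n) * t\<rfloor> / real (Suc n)"
      by (simp add: diff_divide_distrib del: of_nat_Suc)
  qed
  show "\<forall>\<^sub>F n in sequentially. real_of_int \<lfloor>real (Suc n) * t\<rfloor> / real (Suc n) \<le> t"
  proof (intro always_eventually allI)
    fix n
    have "real_of_int \<lfloor>real (Suc n) * t\<rfloor> \<le> t * real (Suc n)" using of_int_floor_le[of "real (Suc n) * t"] by (simp only: mult.commute)
    then show "real_of_int \<lfloor>real (Suc n) * t\<rfloor> / real (Suc n) \<le> t"
      by (simp add: pos_divide_le_eq del: of_nat_Suc)
  qed
qed simp

lemma borel_measurable_joint_continuous:
  fixes f :: "real \<Rightarrow> 'w \<Rightarrow> 'a::euclidean_space"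
  assumes "\<And>t. f t \<in> borel_measurable P"
    and "\<And>w. w \<in> space P \<Longrightarrow> continuous_on UNIV (\<lambda>t. f t w)"
  shows "(\<lambda>p. f (fst p) (snd p)) \<in> borel_measurable (lborel \<Otimes>\<^sub>M P)"
proof (rule borel_measurable_LIMSEQ_metric)
  fix n :: nat
  show "(\<lambda>p. f (real_of_int \<lfloor>real (Suc n) * fst p\<rfloor> / real (Suc n)) (snd p)) \<in> borel_measurable (lborel \<Otimes>\<^sub>M P)"
    by (rule measurable_compose_countable[of "\<lambda>i p. f (real_of_int i / real (Suc n)) (snd p)"])
      (use assms(1) in measurable)
next
  fix p :: "real \<times> 'w" assume "p \<in> space (lborel \<Otimes>\<^sub>M P)"
  then have "snd p \<in> space P" by (auto simp: space_pair_measure)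
  then have "isCont (\<lambda>t. f t (snd p)) (fst p)"
    using assms(2) by (simp add: continuous_on_eq_continuous_at)
  moreover have "(\<lambda>n. real_of_int \<lfloor>real (Suc n) * fst p\<rfloor> / real (Suc n)) \<longlonglongrightarrow> fst p"
    by (rule floor_approx_tendsto)
  ultimately show "(\<lambda>n. f (real_of_int \<lfloor>real (Suc n) * fst p\<rfloor> / real (Suc n)) (snd p)) \<longlonglongrightarrow> f (fst p) (snd p)"
    by (rule isCont_tendsto_compose)
qed

locale rl_solution =
  fixes P :: "'w measure" and T \<alpha> H L CG :: real
    and x0 :: "'w \<Rightarrow> real^'d" and G x :: "real \<Rightarrow> 'w \<Rightarrow> real^'d" and b :: "real^'d \<Rightarrow> real^'d"
  assumes P: "prob_space P" and T: "0 < T" and \<alpha>: "0 < \<alpha>" "\<alpha> < 1" and H: "1/2 < H" "H < 1" "1 < \<alpha> + H"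
    and x0 [measurable]: "x0 \<in> borel_measurable P" and x0_L2: "integrable P (\<lambda>w. (norm (x0 w))\<^sup>2)"
    and L: "0 \<le> L" "\<And>u v. norm (b u - b v) \<le> L * norm (u - v)"
    and G_meas: "\<And>t. t \<in> {0..T} \<Longrightarrow> G t \<in> borel_measurable P"
    and CG: "0 \<le> CG"
    and G_incr: "\<And>s t. s \<in> {0..T} \<Longrightarrow> t \<in> {0..T} \<Longrightarrow> L2_le P (\<lambda>w. G t w - G s w) (CG * \<bar>t - s\<bar> powr (\<alpha> + H - 1))"
    and G_0: "AE w in P. G 0 w = 0"
    and sol: "is_RL_solution P \<alpha> b x0 G T x"
begin

sublocale prob_space P by (rule P)

definition clamp :: "real \<Rightarrow> real" where "clamp t = max 0 (min T t)"

text \<open>\<open>y\<close> extends \<open>x\<close> continuously from \<open>[0, T]\<close> to the real line, which makes it jointly measurable.\<close>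

definition y :: "real \<Rightarrow> 'w \<Rightarrow> real^'d" where "y t w = x (clamp t) w"

definition K :: "real \<Rightarrow> real \<Rightarrow> real" where
  "K t s = (if 0 \<le> s \<and> s \<le> t then (t - s) powr (\<alpha> - 1) / Gamma \<alpha> else 0)"

definition D :: "real \<Rightarrow> 'w \<Rightarrow> real^'d" where "D t w = (\<integral>s. K t s *\<^sub>R b (y s w) \<partial>lborel)"

lemma clamp_in: "clamp t \<in> {0..T}" using T by (auto simp: clamp_def)

lemma clamp_id: "t \<in> {0..T} \<Longrightarrow> clamp t = t" by (auto simp: clamp_def)

lemma y_eq: "t \<in> {0..T} \<Longrightarrow> y t = x t" by (simp add: y_def clamp_id fun_eq_iff)

lemma Gam: "0 < Gamma \<alpha>" using \<alpha> by (simp add: Gamma_real_pos)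

lemma b_continuous: "continuous_on UNIV b"
proof (rule continuous_on_eq_continuous_within[THEN iffD2], intro ballI)
  fix u
  have "L-lipschitz_on UNIV b" using L by (auto simp: lipschitz_on_def dist_norm)
  then show "isCont b u" by (meson UNIV_I continuous_on_eq_continuous_at lipschitz_on_continuous_on open_UNIV)
qed

lemma b_measurable [measurable]: "b \<in> borel_measurable borel"
  using b_continuous by (rule borel_measurable_continuous_onI)

lemma y_measurable [measurable]: "y t \<in> borel_measurable P"
  using sol clamp_in unfolding is_RL_solution_def y_def by (metis (full_types))

lemma y_continuous: "w \<in> space P \<Longrightarrow> continuous_on UNIV (\<lambda>t. y t w)"
proof -
  assume "w \<in> space P"
  then have "continuous_on {0..T} (\<lambda>t. x t w)" using sol by (auto simp: is_RL_solution_def)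
  moreover have "continuous_on UNIV clamp" unfolding clamp_def by (intro continuous_intros)
  ultimately show ?thesis unfolding y_def
    by (rule continuous_on_compose2) (use clamp_in in auto)
qed

lemma y_joint [measurable]: "(\<lambda>p. y (fst p) (snd p)) \<in> borel_measurable (lborel \<Otimes>\<^sub>M P)"
  by (rule borel_measurable_joint_continuous) (use y_continuous in auto)

lemmas y_joint' = measurable_joint_compose[of y, OF y_joint]

lemma y_path [measurable]: "w \<in> space P \<Longrightarrow> (\<lambda>s. y s w) \<in> borel_measurable borel"
  by (rule borel_measurable_continuous_onI[OF y_continuous])

lemma y_bounded: "w \<in> space P \<Longrightarrow> \<exists>m. \<forall>t. norm (y t w) \<le> m"
proof -
  assume w: "w \<in> space P"
  then have "continuous_on {0..T} (\<lambda>t. x t w)" using sol by (auto simp: is_RL_solution_def)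
  then have "compact ((\<lambda>t. x t w) ` {0..T})" by (rule compact_continuous_image) simp
  then obtain m where "\<forall>z\<in>(\<lambda>t. x t w) ` {0..T}. norm z \<le> m"
    using compact_imp_bounded bounded_iff by blast
  then show ?thesis using clamp_in by (intro exI[of _ m]) (auto simp: y_def)
qed

lemma b_bound: "norm (b u) \<le> norm (b 0) + L * norm u"
  using L(2)[of u 0] norm_triangle_sub[of "b u" "b 0"] by simp

lemma drift_bounded: "w \<in> space P \<Longrightarrow> \<exists>m\<ge>0. \<forall>t. norm (b (y t w)) \<le> m"
proof -
  assume "w \<in> space P"
  then obtain m where m: "\<And>t. norm (y t w) \<le> m" using y_bounded by blast
  have "norm (b (y t w)) \<le> norm (b 0) + L * m" for t
    using b_bound[of "y t w"] mult_left_mono[OF m L(1)] by (meson add_left_mono order_trans)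
  then show ?thesis by (meson norm_ge_zero order_trans)
qed

lemma K_measurable [measurable (raw)]:
  assumes "f \<in> borel_measurable M" "g \<in> borel_measurable M"
  shows "(\<lambda>z. K (f z) (g z)) \<in> borel_measurable M"
  using assms unfolding K_def by measurable

lemma K_nonneg [simp]: "0 \<le> K t s" using Gam by (simp add: K_def)

lemma K_altdef: "K t s = (1 / Gamma \<alpha>) * ((t - s) powr (\<alpha> - 1) * indicator {0..t} s)"
  by (simp add: K_def indicator_def)

lemma K_integral:
  assumes "0 \<le> t"
  shows "integrable lborel (K t)" "(\<integral>s. K t s \<partial>lborel) = t powr \<alpha> / (\<alpha> * Gamma \<alpha>)"
    "(\<integral>\<^sup>+s. ennreal (K t s) \<partial>lborel) = ennreal (t powr \<alpha> / (\<alpha> * Gamma \<alpha>))"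
proof -
  have "set_integrable lborel {0..t} (\<lambda>s. (t - s) powr (\<alpha> - 1))"
    "(LINT s:{0..t}|lborel. (t - s) powr (\<alpha> - 1)) = t powr \<alpha> / \<alpha>"
    using powr_reflect_lborel(2,3)[of \<alpha> 0 t t] assms \<alpha> by auto
  then show i: "integrable lborel (K t)" "(\<integral>s. K t s \<partial>lborel) = t powr \<alpha> / (\<alpha> * Gamma \<alpha>)"
    unfolding K_altdef set_integrable_def set_lebesgue_integral_def by (auto simp: mult.commute)
  show "(\<integral>\<^sup>+s. ennreal (K t s) \<partial>lborel) = ennreal (t powr \<alpha> / (\<alpha> * Gamma \<alpha>))"
    using nn_integral_eq_integral[OF i(1)] i(2) by simp
qed

lemma integrable_K_bounded:
  fixes f :: "real \<Rightarrow> real^'d"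
  assumes "0 \<le> t" "f \<in> borel_measurable borel" "\<And>s. norm (f s) \<le> m"
  shows "integrable lborel (\<lambda>s. K t s *\<^sub>R f s)"
proof (rule Bochner_Integration.integrable_bound)
  show "integrable lborel (\<lambda>s. m * K t s)" using K_integral(1)[OF assms(1)] by simp
  have "0 \<le> m" using assms(3) norm_ge_zero order_trans by blast
  then show "AE s in lborel. norm (K t s *\<^sub>R f s) \<le> norm (m * K t s)"
    using assms(3) by (intro AE_I2) (auto simp: mult.commute[of m] intro!: mult_left_mono)
qed (use assms(2) in measurable)

lemma D_integrable: "0 \<le> t \<Longrightarrow> w \<in> space P \<Longrightarrow> integrable lborel (\<lambda>s. K t s *\<^sub>R b (y s w))"
  using drift_bounded[of w] by (auto intro!: integrable_K_bounded)

lemma D_joint: "(\<lambda>p. D (fst p) (snd p)) \<in> borel_measurable (lborel \<Otimes>\<^sub>M P)"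
  unfolding D_def
  by (rule lborel.borel_measurable_lebesgue_integral)
    (auto simp: case_prod_unfold intro!: borel_measurable_scaleR K_measurable measurable_compose[OF y_joint' b_measurable])

lemmas D_joint' = measurable_joint_compose[of D, OF D_joint]

lemma D_measurable [measurable]: "D t \<in> borel_measurable P"
  using D_joint'[of "\<lambda>_. t" P "\<lambda>w. w"] by simp

lemma y_solution: "t \<in> {0..T} \<Longrightarrow> AE w in P. y t w = x0 w + D t w + G t w"
proof -
  assume t: "t \<in> {0..T}"
  have "(1 / Gamma \<alpha>) *\<^sub>R (LINT s:{0..t}|lborel. ((t - s) powr (\<alpha> - 1)) *\<^sub>R b (x s w)) = D t w"
    if w: "w \<in> space P" for w
  proof -
    have "(LINT s:{0..t}|lborel. ((t - s) powr (\<alpha> - 1)) *\<^sub>R b (x s w))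
       = (\<integral>s. Gamma \<alpha> *\<^sub>R (K t s *\<^sub>R b (y s w)) \<partial>lborel)"
      unfolding set_lebesgue_integral_def
      by (intro Bochner_Integration.integral_cong) (use t Gam in \<open>auto simp: K_def indicator_def y_eq\<close>)
    also have "\<dots> = Gamma \<alpha> *\<^sub>R D t w"
      unfolding D_def by (rule integral_scaleR_right)
    finally show ?thesis using Gam by simp
  qed
  moreover have "AE w in P. x t w = x0 w + (1 / Gamma \<alpha>) *\<^sub>R
                 (LINT s:{0..t}|lborel. ((t - s) powr (\<alpha> - 1)) *\<^sub>R b (x s w)) + G t w"
    using sol t unfolding is_RL_solution_def by blast
  ultimately show ?thesis using AE_space t by (auto simp: y_eq elim: eventually_elim2)
qed

lemma G_L2: "t \<in> {0..T} \<Longrightarrow> L2_le P (G t) (CG * T powr (\<alpha> + H - 1))"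
proof -
  assume t: "t \<in> {0..T}"
  have "L2_le P (\<lambda>w. G t w - G 0 w) (CG * \<bar>t - 0\<bar> powr (\<alpha> + H - 1))"
    using t T by (intro G_incr) auto
  then have "L2_le P (\<lambda>w. G t w - G 0 w) (CG * T powr (\<alpha> + H - 1))"
    by (rule L2_le_mono) (use t CG H in \<open>auto intro!: mult_left_mono powr_mono2\<close>)
  then show ?thesis
    by (rule L2_le_cong_AE) (use G_meas[OF t] G_0 in auto)
qed

lemma y_moment_step:
  fixes A :: "'w set"
  assumes A [measurable]: "A \<in> sets P" and X0: "L2_le P x0 X0" and \<mu>: "0 < \<mu>"
    and \<mu>_le: "\<And>t. t \<in> {0..T} \<Longrightarrow> (\<integral>\<^sup>+s. ennreal ((t - s) powr (\<alpha> - 1) * exp (\<mu> * s) * indicator {0..t} s) \<partial>lborel)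
        \<le> ennreal (Gamma \<alpha> / (2 * (L + 1)) * exp (\<mu> * t))"
    and S: "\<And>t. t \<in> {0..T} \<Longrightarrow> L2_le P (\<lambda>w. indicator A w *\<^sub>R y t w) (S * exp (\<mu> * t))" and t: "t \<in> {0..T}"
  defines "A0 \<equiv> X0 + norm (b 0) * (T powr \<alpha> / (\<alpha> * Gamma \<alpha>)) + CG * T powr (\<alpha> + H - 1)"
  shows "L2_le P (\<lambda>w. indicator A w *\<^sub>R y t w) ((A0 + S / 2) * exp (\<mu> * t))"
proof -
  have "0 \<le> S * exp (\<mu> * t)" using S[OF t] by (simp add: L2_le_def)
  then have S0: "0 \<le> S" by (simp add: zero_le_mult_iff)
  define \<phi> where "\<phi> = (\<lambda>s. norm (b 0) + L * (S * exp (\<mu> * s)))"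
  have i: "norm (indicator A w *\<^sub>R z) \<le> norm z" for w and z :: "real^'d"
    by (simp add: indicator_def)
  have 1: "L2_le P (\<lambda>w. indicator A w *\<^sub>R b (y s w)) (\<phi> s)" if "s \<in> {0..T}" for s
  proof -
    have "L2_le P (\<lambda>w. norm (b 0) + L * norm (indicator A w *\<^sub>R y s w)) (\<phi> s)"
      unfolding \<phi>_def using L2_le_const[of "norm (b 0)"]
      by (intro L2_le_add L2_le_norm_bound[OF S[OF that]]) (use L in auto)
    then show ?thesis
    proof (rule L2_le_bound)
      show "AE w in P. norm (indicator A w *\<^sub>R b (y s w)) \<le> norm (norm (b 0) + L * norm (indicator A w *\<^sub>R y s w))"
        using b_bound L by (intro AE_I2) (auto simp: indicator_def)
    qed measurable
  qed
  have "L2_le P (\<lambda>w. \<integral>s. K t s *\<^sub>R (indicator A w *\<^sub>R b (y s w)) \<partial>lborel)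
      (norm (b 0) * (T powr \<alpha> / (\<alpha> * Gamma \<alpha>)) + S / 2 * exp (\<mu> * t))"
  proof (rule L2_le_integral[where \<phi>=\<phi>])
    show "sigma_finite_measure P" by unfold_locales
    show "(\<lambda>p. indicator A (snd p) *\<^sub>R b (y (fst p) (snd p))) \<in> borel_measurable (lborel \<Otimes>\<^sub>M P)" by measurable
    show "L2_le P (\<lambda>w. indicator A w *\<^sub>R b (y s w)) (\<phi> s)" if "K t s \<noteq> 0" for s
      using that t by (intro 1) (auto simp: K_def split: if_splits)
    have "(\<integral>\<^sup>+s. ennreal (\<bar>K t s\<bar> * \<phi> s) \<partial>lborel)
       = (\<integral>\<^sup>+s. ennreal (norm (b 0)) * ennreal (K t s) + ennreal (L * S / Gamma \<alpha>) * ennreal ((t - s) powr (\<alpha> - 1) * exp (\<mu> * s) * indicator {0..t} s) \<partial>lborel)"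
      using L S0 Gam by (intro nn_integral_cong)
        (simp add: \<phi>_def ennreal_mult[symmetric] ennreal_plus[symmetric] K_altdef algebra_simps add_divide_distrib del: ennreal_plus)
    also have "\<dots> = ennreal (norm (b 0)) * ennreal (t powr \<alpha> / (\<alpha> * Gamma \<alpha>))
        + ennreal (L * S / Gamma \<alpha>) * (\<integral>\<^sup>+s. ennreal ((t - s) powr (\<alpha> - 1) * exp (\<mu> * s) * indicator {0..t} s) \<partial>lborel)"
      using t by (simp add: nn_integral_add nn_integral_cmult K_integral(3))
    also have "\<dots> \<le> ennreal (norm (b 0)) * ennreal (T powr \<alpha> / (\<alpha> * Gamma \<alpha>))
        + ennreal (L * S / Gamma \<alpha>) * ennreal (Gamma \<alpha> / (2 * (L + 1)) * exp (\<mu> * t))"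
      using t \<alpha> Gam by (intro add_mono mult_left_mono \<mu>_le ennreal_leI divide_right_mono powr_mono2) auto
    also have "\<dots> = ennreal (norm (b 0) * (T powr \<alpha> / (\<alpha> * Gamma \<alpha>)) + L * S / Gamma \<alpha> * (Gamma \<alpha> / (2 * (L + 1)) * exp (\<mu> * t)))"
      using L S0 Gam \<alpha> by (simp add: ennreal_mult[symmetric] ennreal_plus[symmetric] del: ennreal_plus)
    also have "\<dots> \<le> ennreal (norm (b 0) * (T powr \<alpha> / (\<alpha> * Gamma \<alpha>)) + S / 2 * exp (\<mu> * t))"
    proof (intro ennreal_leI add_left_mono)
      have "L * S / Gamma \<alpha> * (Gamma \<alpha> / (2 * (L + 1)) * exp (\<mu> * t)) = (L / (L + 1)) * (S / 2 * exp (\<mu> * t))"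
        using Gam by (simp add: field_simps)
      also have "\<dots> \<le> 1 * (S / 2 * exp (\<mu> * t))" using L S0 by (intro mult_right_mono) auto
      finally show "L * S / Gamma \<alpha> * (Gamma \<alpha> / (2 * (L + 1)) * exp (\<mu> * t)) \<le> S / 2 * exp (\<mu> * t)" by simp
    qed
    finally show "(\<integral>\<^sup>+s. ennreal (\<bar>K t s\<bar> * \<phi> s) \<partial>lborel) \<le> ennreal (norm (b 0) * (T powr \<alpha> / (\<alpha> * Gamma \<alpha>)) + S / 2 * exp (\<mu> * t))" .
    show "0 \<le> norm (b 0) * (T powr \<alpha> / (\<alpha> * Gamma \<alpha>)) + S / 2 * exp (\<mu> * t)" using S0 \<alpha> Gam by simp
  qed (auto simp: \<phi>_def)
  then have "L2_le P (\<lambda>w. indicator A w *\<^sub>R x0 w + (\<integral>s. K t s *\<^sub>R (indicator A w *\<^sub>R b (y s w)) \<partial>lborel) + indicator A w *\<^sub>R G t w)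
      (X0 + (norm (b 0) * (T powr \<alpha> / (\<alpha> * Gamma \<alpha>)) + S / 2 * exp (\<mu> * t)) + CG * T powr (\<alpha> + H - 1))"
    using i G_meas[OF t]
    by (intro L2_le_add L2_le_bound[OF X0] L2_le_bound[OF G_L2[OF t]]) auto
  then have "L2_le P (\<lambda>w. indicator A w *\<^sub>R y t w)
      (X0 + (norm (b 0) * (T powr \<alpha> / (\<alpha> * Gamma \<alpha>)) + S / 2 * exp (\<mu> * t)) + CG * T powr (\<alpha> + H - 1))"
  proof (rule L2_le_cong_AE)
    show "AE w in P. indicator A w *\<^sub>R y t w =
       indicator A w *\<^sub>R x0 w + (\<integral>s. K t s *\<^sub>R (indicator A w *\<^sub>R b (y s w)) \<partial>lborel) + indicator A w *\<^sub>R G t w"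
      using y_solution[OF t] by eventually_elim (auto simp: indicator_def D_def)
  qed measurable
  then show ?thesis
  proof (rule L2_le_mono)
    have "0 \<le> A0" unfolding A0_def using X0 \<alpha> Gam CG by (auto simp: L2_le_def)
    moreover have "1 \<le> exp (\<mu> * t)" using t \<mu> by simp
    ultimately have "A0 * 1 \<le> A0 * exp (\<mu> * t)" by (intro mult_left_mono)
    then show "X0 + (norm (b 0) * (T powr \<alpha> / (\<alpha> * Gamma \<alpha>)) + S / 2 * exp (\<mu> * t)) + CG * T powr (\<alpha> + H - 1)
      \<le> (A0 + S / 2) * exp (\<mu> * t)" by (simp add: A0_def algebra_simps)
  qed
qed

text \<open>
  Moments of the solution are not assumed to exist: the bound is first shown on the events where
  the path is bounded by \<open>m\<close>. There the initial bound \<open>m\<close> is improved by iterating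
  \<open>S \<mapsto> A0 + S/2\<close>, whose fixed point \<open>2 A0\<close> does not depend on \<open>m\<close>.
\<close>

lemma y_moment: "\<exists>C. \<forall>t. L2_le P (y t) C"
proof -
  define X0 where "X0 = sqrt (\<integral>w. (norm (x0 w))\<^sup>2 \<partial>P)"
  have X0: "L2_le P x0 X0" unfolding X0_def by (rule L2_leI) (auto simp: x0_L2)
  obtain \<mu> where \<mu>: "0 < \<mu>" "\<And>t. t \<in> {0..T} \<Longrightarrow> (\<integral>\<^sup>+s. ennreal ((t - s) powr (\<alpha> - 1) * exp (\<mu> * s) * indicator {0..t} s) \<partial>lborel)
        \<le> ennreal (Gamma \<alpha> / (2 * (L + 1)) * exp (\<mu> * t))"
    using exists_exponential_weight[OF \<alpha> T, of "Gamma \<alpha> / (2 * (L + 1))"] Gam L by auto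
  define A0 where "A0 = X0 + norm (b 0) * (T powr \<alpha> / (\<alpha> * Gamma \<alpha>)) + CG * T powr (\<alpha> + H - 1)"
  define A where "A = (\<lambda>m::nat. {w \<in> space P. \<forall>(n::nat) (i::int). norm (y (real_of_int i / real (Suc n)) w) \<le> real m})"
  have A [measurable]: "A m \<in> sets P" for m unfolding A_def by measurable
  have Am: "norm (y t w) \<le> real m" if "w \<in> A m" for w m t
  proof -
    from that have w: "w \<in> space P" by (simp add: A_def)
    have "(\<lambda>n. y (real_of_int \<lfloor>real (Suc n) * t\<rfloor> / real (Suc n)) w) \<longlonglongrightarrow> y t w"
      using y_continuous[OF w] floor_approx_tendsto[of t]
      by (intro isCont_tendsto_compose[of _ "\<lambda>t. y t w"]) (auto simp: continuous_on_eq_continuous_at)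
    then show ?thesis
      by (intro LIMSEQ_le_const2[OF tendsto_norm]) (use that in \<open>auto simp: A_def\<close>)
  qed
  have bound: "L2_le P (\<lambda>w. indicator (A m) w *\<^sub>R y t w) (2 * A0 * exp (\<mu> * t))" if t: "t \<in> {0..T}" for m t
  proof -
    have iter: "\<forall>t\<in>{0..T}. L2_le P (\<lambda>w. indicator (A m) w *\<^sub>R y t w) ((2 * A0 + (real m - 2 * A0) / 2 ^ j) * exp (\<mu> * t))" for j
    proof (induction j)
      case 0
      show ?case
      proof
        fix t assume t: "t \<in> {0..T}"
        have "L2_le P (\<lambda>w. indicator (A m) w *\<^sub>R y t w) (norm (real m))"
          by (rule L2_le_bound[OF L2_le_const]) (use Am in \<open>auto simp: indicator_def\<close>)
        then have "L2_le P (\<lambda>w. indicator (A m) w *\<^sub>R y t w) (real m * exp (\<mu> * t))"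
          by (rule L2_le_mono) (use t \<mu> in \<open>simp add: mult_le_cancel_left1\<close>)
        then show "L2_le P (\<lambda>w. indicator (A m) w *\<^sub>R y t w) ((2 * A0 + (real m - 2 * A0) / 2 ^ 0) * exp (\<mu> * t))" by simp
      qed
    next
      case (Suc j)
      show ?case
      proof
        fix t assume t: "t \<in> {0..T}"
        have "L2_le P (\<lambda>w. indicator (A m) w *\<^sub>R y t w) ((A0 + (2 * A0 + (real m - 2 * A0) / 2 ^ j) / 2) * exp (\<mu> * t))"
          unfolding A0_def
          by (rule y_moment_step[OF A X0 \<mu>]) (use Suc t in \<open>auto simp: A0_def\<close>)
        then show "L2_le P (\<lambda>w. indicator (A m) w *\<^sub>R y t w) ((2 * A0 + (real m - 2 * A0) / 2 ^ Suc j) * exp (\<mu> * t))"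
          by (simp add: field_simps)
      qed
    qed
    have lim: "(\<lambda>j. (2 * A0 + (real m - 2 * A0) / 2 ^ j) * exp (\<mu> * t)) \<longlonglongrightarrow> (2 * A0 + 0) * exp (\<mu> * t)"
      by (intro tendsto_intros LIMSEQ_divide_realpow_zero) auto
    show ?thesis using L2_le_tendsto[OF bspec[OF iter t] lim] by simp
  qed
  have "L2_le P (y t) (2 * A0 * exp (\<mu> * T))" for t
  proof -
    have c: "y t = y (clamp t)" by (simp add: y_def clamp_id[OF clamp_in] fun_eq_iff)
    have "L2_le P (y (clamp t)) (2 * A0 * exp (\<mu> * clamp t))"
    proof (rule L2_le_Fatou[of _ "\<lambda>m w. indicator (A m) w *\<^sub>R y (clamp t) w"])
      show "AE w in P. (\<lambda>m. indicator (A m) w *\<^sub>R y (clamp t) w) \<longlonglongrightarrow> y (clamp t) w"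
      proof (rule AE_I2)
        fix w assume w: "w \<in> space P"
        then obtain m where m: "\<And>t. norm (y t w) \<le> m" using y_bounded by blast
        have "\<forall>\<^sub>F k in sequentially. indicator (A k) w *\<^sub>R y (clamp t) w = y (clamp t) w"
          using eventually_ge_at_top[of "nat \<lceil>m\<rceil>"]
        proof eventually_elim
          case (elim k)
          then have "m \<le> real k" by linarith
          then have "w \<in> A k" using w m order_trans by (auto simp: A_def)
          then show ?case by simp
        qed
        then show "(\<lambda>m. indicator (A m) w *\<^sub>R y (clamp t) w) \<longlonglongrightarrow> y (clamp t) w"
          by (rule tendsto_eventually)
      qed
    qed (use bound clamp_in in auto)
    then show ?thesis unfolding c[symmetric]
    proof (rule L2_le_mono)
      have "0 \<le> A0" unfolding A0_def using X0 \<alpha> Gam CG by (auto simp: L2_le_def)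
      then show "2 * A0 * exp (\<mu> * clamp t) \<le> 2 * A0 * exp (\<mu> * T)"
        using \<mu> clamp_in[of t] by (intro mult_left_mono) auto
    qed
  qed
  then show ?thesis by blast
qed

end

definition cell :: "real \<Rightarrow> nat \<Rightarrow> real set" where "cell k j = {real (j - 1) * k..<real j * k}"

definition grid_floor :: "real \<Rightarrow> real \<Rightarrow> real" where "grid_floor k s = real_of_int \<lfloor>s / k\<rfloor> * k"

lemma cell_sets [measurable]: "cell k j \<in> sets borel" by (simp add: cell_def)

lemma grid_floor_measurable [measurable]: "grid_floor k \<in> borel_measurable borel"
  unfolding grid_floor_def by measurable

lemma sum_indicator_cell:
  assumes "0 < k"
  shows "(\<Sum>j\<in>{1..n}. indicator (cell k j) u) = (indicator {0..<real n * k} u :: real)"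
proof (induction n)
  case (Suc n)
  have "real n * k \<le> real (Suc n) * k" using assms by (intro mult_right_mono) auto
  moreover have "0 \<le> real n * k" using assms by simp
  ultimately have "indicator {0..<real n * k} u + indicator (cell k (Suc n)) u = (indicator {0..<real (Suc n) * k} u :: real)"
    unfolding cell_def indicator_def by auto
  then show ?case using Suc by (simp add: atLeastAtMostSuc_conv del: of_nat_Suc)
qed simp

lemma grid_floor_cell:
  assumes "0 < k" "0 < j" "u \<in> cell k j"
  shows "grid_floor k u = real (j - 1) * k"
proof -
  have "\<lfloor>u / k\<rfloor> = int (j - 1)"
    using assms by (intro floor_unique) (auto simp: cell_def pos_le_divide_eq pos_divide_less_eq)
  then show ?thesis by (simp add: grid_floor_def)
qed

lemma grid_floor_bounds:
  assumes "0 < k"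
  shows "grid_floor k s \<le> s" "s - grid_floor k s < k" "0 \<le> s \<Longrightarrow> 0 \<le> grid_floor k s"
proof -
  have "real_of_int \<lfloor>s / k\<rfloor> \<le> s / k" "s / k < real_of_int \<lfloor>s / k\<rfloor> + 1" by linarith+
  then have "real_of_int \<lfloor>s / k\<rfloor> * k \<le> s" "s < (real_of_int \<lfloor>s / k\<rfloor> + 1) * k"
    using assms by (simp_all only: pos_le_divide_eq pos_divide_less_eq)
  then show "grid_floor k s \<le> s" "s - grid_floor k s < k"
    by (auto simp: grid_floor_def algebra_simps)
  show "0 \<le> grid_floor k s" if "0 \<le> s" using that assms by (simp add: grid_floor_def)
qed

lemma set_integral_cell:
  fixes f :: "real \<Rightarrow> 'a::euclidean_space"
  assumes [measurable]: "f \<in> borel_measurable borel"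
  shows "(LINT u:{real (j - 1) * k .. real j * k}|lborel. f u) = (LINT u:cell k j|lborel. f u)"
proof -
  have "AE u in lborel. u \<noteq> real j * k" by (rule AE_lborel_singleton)
  then have "AE u in lborel. (u \<in> {real (j - 1) * k .. real j * k}) = (u \<in> cell k j)"
    by eventually_elim (auto simp: cell_def)
  then show ?thesis
    by (intro set_integral_cong_set[symmetric]) (auto simp: set_borel_measurable_def)
qed

context rl_solution
begin

lemma K_diff_nn_integral:
  assumes "0 \<le> s" "s \<le> t"
  shows "(\<integral>\<^sup>+r. ennreal \<bar>K t r - K s r\<bar> \<partial>lborel) \<le> ennreal (2 / (\<alpha> * Gamma \<alpha>) * (t - s) powr \<alpha>)"
proof -
  define f where "f = (\<lambda>r. K s r - K t r * indicator {0..s} r + K t r * indicator {s..t} r)"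
  have i: "integrable lborel (\<lambda>r. K t r * indicator {0..s} r)" "integrable lborel (\<lambda>r. K t r * indicator {s..t} r)"
    using K_integral(1)[of t] assms by (auto intro!: integrable_real_mult_indicator)
  have e1: "(\<integral>r. K t r * indicator {0..s} r \<partial>lborel) = (t powr \<alpha> - (t - s) powr \<alpha>) / (\<alpha> * Gamma \<alpha>)"
  proof -
    have "(\<integral>r. K t r * indicator {0..s} r \<partial>lborel) = (\<integral>r. (1 / Gamma \<alpha>) * (indicator {0..s} r * (t - r) powr (\<alpha> - 1)) \<partial>lborel)"
      using assms by (intro Bochner_Integration.integral_cong) (auto simp: K_def indicator_def)
    also have "\<dots> = (1 / Gamma \<alpha>) * ((t powr \<alpha> - (t - s) powr \<alpha>) / \<alpha>)"
      using powr_reflect_lborel(3)[of \<alpha> 0 s t] assms \<alpha> by (simp add: set_lebesgue_integral_def)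
    finally show ?thesis by (simp add: mult.commute)
  qed
  have e2: "(\<integral>r. K t r * indicator {s..t} r \<partial>lborel) = (t - s) powr \<alpha> / (\<alpha> * Gamma \<alpha>)"
  proof -
    have "(\<integral>r. K t r * indicator {s..t} r \<partial>lborel) = (\<integral>r. (1 / Gamma \<alpha>) * (indicator {s..t} r * (t - r) powr (\<alpha> - 1)) \<partial>lborel)"
      using assms by (intro Bochner_Integration.integral_cong) (auto simp: K_def indicator_def)
    also have "\<dots> = (1 / Gamma \<alpha>) * ((t - s) powr \<alpha> / \<alpha>)"
      using powr_reflect_lborel(3)[of \<alpha> s t t] assms \<alpha> by (simp add: set_lebesgue_integral_def)
    finally show ?thesis by (simp add: mult.commute)
  qed
  have fi: "integrable lborel f" unfolding f_def using i K_integral(1)[of s] assms by simp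
  have AE: "AE r in lborel. \<bar>K t r - K s r\<bar> = f r"
  proof -
    have "AE r in lborel. r \<noteq> s" by (rule AE_lborel_singleton)
    then show ?thesis
    proof eventually_elim
      case (elim r)
      show ?case
      proof (cases "0 \<le> r \<and> r < s")
        case True
        then have "(t - r) powr (\<alpha> - 1) \<le> (s - r) powr (\<alpha> - 1)" using assms \<alpha> by (intro powr_mono2') auto
        then have "K t r \<le> K s r" using True assms Gam by (simp add: K_def divide_right_mono)
        then show ?thesis using True by (simp add: f_def)
      next
        case False
        then show ?thesis using elim assms Gam by (auto simp: f_def K_def indicator_def)
      qed
    qed
  qed
  have "(\<integral>\<^sup>+r. ennreal \<bar>K t r - K s r\<bar> \<partial>lborel) = (\<integral>\<^sup>+r. ennreal (f r) \<partial>lborel)"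
    using AE by (intro nn_integral_cong_AE) auto
  also have "\<dots> = ennreal (\<integral>r. f r \<partial>lborel)"
    using AE by (intro nn_integral_eq_integral fi) (auto elim!: eventually_mono)
  also have "(\<integral>r. f r \<partial>lborel) = (s powr \<alpha> - t powr \<alpha> + 2 * (t - s) powr \<alpha>) / (\<alpha> * Gamma \<alpha>)"
    unfolding f_def using i K_integral[of s] e1 e2 assms by (simp add: diff_divide_distrib add_divide_distrib)
  also have "\<dots> \<le> 2 / (\<alpha> * Gamma \<alpha>) * (t - s) powr \<alpha>"
  proof -
    have "s powr \<alpha> \<le> t powr \<alpha>" using assms \<alpha> by (intro powr_mono2) auto
    then have "(s powr \<alpha> - t powr \<alpha> + 2 * (t - s) powr \<alpha>) / (\<alpha> * Gamma \<alpha>) \<le> (2 * (t - s) powr \<alpha>) / (\<alpha> * Gamma \<alpha>)"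
      using \<alpha> Gam by (intro divide_right_mono) auto
    then show ?thesis by simp
  qed
  finally show ?thesis by (simp add: ennreal_leI)
qed

lemma D_diff:
  assumes "0 \<le> s" "0 \<le> t" "w \<in> space P"
  shows "D t w - D s w = (\<integral>r. (K t r - K s r) *\<^sub>R b (y r w) \<partial>lborel)"
  unfolding D_def scaleR_left_diff_distrib
  using assms by (intro Bochner_Integration.integral_diff[symmetric] D_integrable)

lemma drift_moment: "\<exists>C\<ge>0. \<forall>t. L2_le P (\<lambda>w. b (y t w)) C"
proof -
  obtain C where C: "\<And>t. L2_le P (y t) C" using y_moment by blast
  have "L2_le P (\<lambda>w. b (y t w)) (norm (b 0) + L * C)" for t
  proof -
    have "L2_le P (\<lambda>w. norm (b 0) + L * norm (y t w)) (norm (b 0) + L * C)"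
      using L2_le_const[of "norm (b 0)"] by (intro L2_le_add L2_le_norm_bound[OF C]) (use L in auto)
    then show ?thesis
      by (rule L2_le_bound) (use b_bound L in auto)
  qed
  then show ?thesis by (meson L2_leD(2))
qed

lemma D_Holder: "\<exists>C\<ge>0. \<forall>s\<in>{0..T}. \<forall>t\<in>{0..T}. L2_le P (\<lambda>w. D t w - D s w) (C * \<bar>t - s\<bar> powr \<alpha>)"
proof -
  obtain C where C: "0 \<le> C" "\<And>t. L2_le P (\<lambda>w. b (y t w)) C" using drift_moment by blast
  have main: "L2_le P (\<lambda>w. D t w - D s w) (C * (2 / (\<alpha> * Gamma \<alpha>)) * (t - s) powr \<alpha>)" if st: "0 \<le> s" "s \<le> t" for s t
  proof -
    have "L2_le P (\<lambda>w. \<integral>r. (K t r - K s r) *\<^sub>R b (y r w) \<partial>lborel) (C * (2 / (\<alpha> * Gamma \<alpha>)) * (t - s) powr \<alpha>)"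
    proof (rule L2_le_integral[where \<phi>="\<lambda>_. C"])
      show "sigma_finite_measure P" by unfold_locales
      have "(\<integral>\<^sup>+r. ennreal (\<bar>K t r - K s r\<bar> * C) \<partial>lborel) = (\<integral>\<^sup>+r. ennreal \<bar>K t r - K s r\<bar> \<partial>lborel) * ennreal C"
        using C by (simp add: ennreal_mult nn_integral_multc)
      also have "\<dots> \<le> ennreal (2 / (\<alpha> * Gamma \<alpha>) * (t - s) powr \<alpha>) * ennreal C"
        by (intro mult_right_mono K_diff_nn_integral st) auto
      also have "\<dots> = ennreal (C * (2 / (\<alpha> * Gamma \<alpha>)) * (t - s) powr \<alpha>)"
        using C \<alpha> Gam by (simp add: ennreal_mult[symmetric] ac_simps)
      finally show "(\<integral>\<^sup>+r. ennreal (\<bar>K t r - K s r\<bar> * C) \<partial>lborel) \<le> ennreal (C * (2 / (\<alpha> * Gamma \<alpha>)) * (t - s) powr \<alpha>)" .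
      show "0 \<le> C * (2 / (\<alpha> * Gamma \<alpha>)) * (t - s) powr \<alpha>" using C \<alpha> Gam by simp
    qed (use C in auto)
    then show ?thesis
      by (rule L2_le_cong_AE) (use D_diff st in auto)
  qed
  have "L2_le P (\<lambda>w. D t w - D s w) (C * (2 / (\<alpha> * Gamma \<alpha>)) * \<bar>t - s\<bar> powr \<alpha>)" if "0 \<le> s" "0 \<le> t" for s t
  proof (cases "s \<le> t")
    case False
    then show ?thesis using L2_le_scaleR[OF main[of t s], of "-1"] that by simp
  qed (use main[of s t] that in simp)
  then show ?thesis using C \<alpha> Gam by (intro exI[of _ "C * (2 / (\<alpha> * Gamma \<alpha>))"]) auto
qed

lemma y_Holder: "\<exists>C\<ge>0. \<forall>s\<in>{0..T}. \<forall>t\<in>{0..T}. L2_le P (\<lambda>w. y t w - y s w) (C * \<bar>t - s\<bar> powr (\<alpha> + H - 1))"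
proof -
  obtain C where C: "0 \<le> C" "\<And>s t. s \<in> {0..T} \<Longrightarrow> t \<in> {0..T} \<Longrightarrow> L2_le P (\<lambda>w. D t w - D s w) (C * \<bar>t - s\<bar> powr \<alpha>)"
    using D_Holder by blast
  have "L2_le P (\<lambda>w. y t w - y s w) ((C * T powr (1 - H) + CG) * \<bar>t - s\<bar> powr (\<alpha> + H - 1))"
    if s: "s \<in> {0..T}" and t: "t \<in> {0..T}" for s t
  proof -
    have "L2_le P (\<lambda>w. (D t w - D s w) + (G t w - G s w)) (C * \<bar>t - s\<bar> powr \<alpha> + CG * \<bar>t - s\<bar> powr (\<alpha> + H - 1))"
      by (intro L2_le_add C G_incr s t)
    then have "L2_le P (\<lambda>w. y t w - y s w) (C * \<bar>t - s\<bar> powr \<alpha> + CG * \<bar>t - s\<bar> powr (\<alpha> + H - 1))"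
    proof (rule L2_le_cong_AE)
      show "AE w in P. y t w - y s w = (D t w - D s w) + (G t w - G s w)"
        using y_solution[OF s] y_solution[OF t] by eventually_elim simp
    qed measurable
    then show ?thesis
    proof (rule L2_le_mono)
      have "\<bar>t - s\<bar> powr \<alpha> = \<bar>t - s\<bar> powr (1 - H) * \<bar>t - s\<bar> powr (\<alpha> + H - 1)" by (simp flip: powr_add)
      also have "\<dots> \<le> T powr (1 - H) * \<bar>t - s\<bar> powr (\<alpha> + H - 1)"
        using s t H by (intro mult_right_mono powr_mono2) auto
      finally have "C * \<bar>t - s\<bar> powr \<alpha> \<le> C * (T powr (1 - H) * \<bar>t - s\<bar> powr (\<alpha> + H - 1))"
        using C(1) by (rule mult_left_mono)
      then show "C * \<bar>t - s\<bar> powr \<alpha> + CG * \<bar>t - s\<bar> powr (\<alpha> + H - 1) \<le> (C * T powr (1 - H) + CG) * \<bar>t - s\<bar> powr (\<alpha> + H - 1)"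
        by (simp add: algebra_simps)
    qed
  qed
  then show ?thesis using C CG by (intro exI[of _ "C * T powr (1 - H) + CG"]) auto
qed

end

section \<open>The error of the scheme\<close>

lemma soe_kernel_measurable [measurable]: "soe_kernel \<alpha> k M \<omega> s \<in> borel_measurable borel"
  unfolding soe_kernel_def by measurable

lemma soe_kernel_error:
  assumes "soe_approx \<alpha> k T \<epsilon> M \<omega> s" "0 < Gamma \<alpha>" "0 \<le> \<epsilon>" "\<tau> \<le> T"
  shows "\<bar>soe_kernel \<alpha> k M \<omega> s \<tau> - \<tau> powr (\<alpha> - 1) / Gamma \<alpha>\<bar> \<le> \<epsilon> / Gamma \<alpha>"
proof (cases "\<tau> \<le> k")
  case False
  then have "\<bar>\<tau> powr (\<alpha> - 1) - (\<Sum>i<M. \<omega> i * exp (- s i * \<tau>))\<bar> \<le> \<epsilon>"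
    using assms by (auto simp: soe_approx_def)
  then have "\<bar>(\<Sum>i<M. \<omega> i * exp (- s i * \<tau>)) - \<tau> powr (\<alpha> - 1)\<bar> / Gamma \<alpha> \<le> \<epsilon> / Gamma \<alpha>"
    using assms(2) by (intro divide_right_mono) (auto simp: abs_minus_commute)
  then show ?thesis using False assms(2) by (simp add: soe_kernel_def diff_divide_distrib[symmetric])
qed (use assms in \<open>simp add: soe_kernel_def\<close>)

context rl_solution
begin

lemma K_floor_sum:
  fixes g :: "real \<Rightarrow> 'a::real_normed_vector"
  assumes k: "0 < k"
  shows "K (real n * k) u *\<^sub>R g (grid_floor k u)
    = (\<Sum>j\<in>{1..n}. indicator (cell k j) u *\<^sub>R (K (real n * k) u *\<^sub>R g (real (j - 1) * k)))"
proof -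
  have "(\<Sum>j\<in>{1..n}. indicator (cell k j) u *\<^sub>R (K (real n * k) u *\<^sub>R g (real (j - 1) * k)))
     = (\<Sum>j\<in>{1..n}. indicator (cell k j) u *\<^sub>R (K (real n * k) u *\<^sub>R g (grid_floor k u)))"
  proof (intro sum.cong refl)
    fix j assume "j \<in> {1..n}"
    then show "indicator (cell k j) u *\<^sub>R (K (real n * k) u *\<^sub>R g (real (j - 1) * k))
      = (indicator (cell k j) u :: real) *\<^sub>R (K (real n * k) u *\<^sub>R g (grid_floor k u))"
      using grid_floor_cell[OF k, of j u] by (cases "u \<in> cell k j") simp_all
  qed
  also have "\<dots> = (indicator {0..<real n * k} u :: real) *\<^sub>R (K (real n * k) u *\<^sub>R g (grid_floor k u))"
    unfolding scaleR_sum_left[symmetric] sum_indicator_cell[OF k] ..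
  also have "\<dots> = K (real n * k) u *\<^sub>R g (grid_floor k u)"
    by (auto simp: indicator_def K_def)
  finally show ?thesis by simp
qed

lemma K_cell_integrable: "0 \<le> t \<Longrightarrow> integrable lborel (\<lambda>u. indicator (cell k j) u * K t u)"
  using K_integral(1)[of t] by (subst mult.commute) (auto intro!: integrable_real_mult_indicator)

definition residual :: "real \<Rightarrow> nat \<Rightarrow> 'w \<Rightarrow> real^'d" where
  "residual k n w = (\<integral>s. K (real n * k) s *\<^sub>R (b (y (grid_floor k s) w) - b (y s w)) \<partial>lborel)"

lemma residual_eq:
  assumes k: "0 < k" and w: "w \<in> space P"
  shows "residual k n w = (\<Sum>j\<in>{1..n}. (\<integral>u. indicator (cell k j) u * K (real n * k) u \<partial>lborel) *\<^sub>R b (y (real (j - 1) * k) w))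
     - D (real n * k) w"
proof -
  define t where "t = real n * k"
  have t: "0 \<le> t" using k by (simp add: t_def)
  obtain m where m: "\<And>s. norm (b (y s w)) \<le> m" using drift_bounded[OF w] by blast
  have i: "integrable lborel (\<lambda>s. K t s *\<^sub>R b (y (grid_floor k s) w))"
    using m w by (intro integrable_K_bounded[OF t]) (auto intro: measurable_compose[OF grid_floor_measurable measurable_compose[OF y_path b_measurable]])
  have "residual k n w = (\<integral>s. K t s *\<^sub>R b (y (grid_floor k s) w) \<partial>lborel) - D t w"
    unfolding residual_def D_def t_def[symmetric] scaleR_diff_right
    by (rule Bochner_Integration.integral_diff[OF i D_integrable[OF t w]])
  also have "(\<integral>s. K t s *\<^sub>R b (y (grid_floor k s) w) \<partial>lborel)
      = (\<integral>s. (\<Sum>j\<in>{1..n}. indicator (cell k j) s *\<^sub>R (K t s *\<^sub>R b (y (real (j - 1) * k) w))) \<partial>lborel)"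
    unfolding t_def using K_floor_sum[OF k, of n _ "\<lambda>s. b (y s w)"] by simp
  also have "\<dots> = (\<Sum>j\<in>{1..n}. (\<integral>s. (indicator (cell k j) s * K t s) *\<^sub>R b (y (real (j - 1) * k) w) \<partial>lborel))"
    using K_cell_integrable[OF t] by (subst Bochner_Integration.integral_sum) auto
  also have "\<dots> = (\<Sum>j\<in>{1..n}. (\<integral>s. indicator (cell k j) s * K t s \<partial>lborel) *\<^sub>R b (y (real (j - 1) * k) w))"
    using K_cell_integrable[OF t] by (intro sum.cong integral_scaleR_left) auto
  finally show ?thesis by (simp add: t_def)
qed

lemma scheme_error:
  "\<exists>C0\<ge>0. \<forall>(N::nat) \<epsilon> (M::nat) \<omega> s X A.
     0 < N \<and> 0 < \<epsilon> \<and> \<epsilon> \<le> 1 \<and> soe_approx \<alpha> (T / real N) T \<epsilon> M \<omega> s \<and>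
     fast_scheme P \<alpha> T N M \<omega> s x0 b G X \<and> (\<forall>n\<le>N. L2_le P (residual (T / real N) n) A) \<longrightarrow>
     (\<forall>n\<le>N. L2_le P (\<lambda>w. X n w - x (real n * (T / real N)) w) (C0 * (A + \<epsilon>)))"
proof -
  obtain Cb where Cb: "0 \<le> Cb" "\<And>t. L2_le P (\<lambda>w. b (y t w)) Cb" using drift_moment by blast
  define c1 where "c1 = (1 + T powr (1 - \<alpha>)) / Gamma \<alpha>"
  have c1: "0 < c1" using Gam by (simp add: c1_def add_pos_nonneg)
  obtain \<mu> where \<mu>: "0 < \<mu>" "\<And>t. t \<in> {0..T} \<Longrightarrow> (\<integral>\<^sup>+s. ennreal ((t - s) powr (\<alpha> - 1) * exp (\<mu> * s) * indicator {0..t} s) \<partial>lborel)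
        \<le> ennreal (1 / (c1 * 2 * (L + 1)) * exp (\<mu> * t))"
    using exists_exponential_weight[OF \<alpha> T, of "1 / (c1 * 2 * (L + 1))"] c1 L by auto
  define C0 where "C0 = 2 * exp (\<mu> * T) * (1 + T * Cb / Gamma \<alpha>)"
  have C0: "0 \<le> C0" using Cb Gam T by (simp add: C0_def)
  have main: "L2_le P (\<lambda>w. X n w - x (real n * (T / real N)) w) (C0 * (A + \<epsilon>))"
    if N: "0 < N" and \<epsilon>: "0 < \<epsilon>" "\<epsilon> \<le> 1" and soe: "soe_approx \<alpha> (T / real N) T \<epsilon> M \<omega> s"
      and sch: "fast_scheme P \<alpha> T N M \<omega> s x0 b G X" and res: "\<And>n. n \<le> N \<Longrightarrow> L2_le P (residual (T / real N) n) A" and n: "n \<le> N"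
    for N M n :: nat and \<epsilon> \<omega> s X A
  proof -
    define k where "k = T / real N"
    have k: "0 < k" using T N by (simp add: k_def)
    have tT: "real n * k \<in> {0..T}" if "n \<le> N" for n
      using that T N by (auto simp: k_def field_simps intro!: mult_left_mono)
    define \<gamma> where "\<gamma> = soe_kernel \<alpha> k M \<omega> s"
    have [measurable]: "\<gamma> \<in> borel_measurable borel" by (simp add: \<gamma>_def)
    define I where "I = (\<lambda>n j. \<integral>u. indicator (cell k j) u * \<gamma> (real n * k - u) \<partial>lborel)"
    define \<kappa> where "\<kappa> = (\<lambda>n j. \<integral>u. indicator (cell k j) u * K (real n * k) u \<partial>lborel)"
    have Xeq: "X n w = x0 w + (\<Sum>j\<in>{1..n}. I n j *\<^sub>R b (X (j - 1) w)) + G (real n * k) w"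
      if "n \<le> N" "w \<in> space P" for n w
    proof -
      have "(LINT u:{real (j - 1) * k .. real j * k}|lborel. soe_kernel \<alpha> k M \<omega> s (real n * k - u)) = I n j" for j
        by (subst set_integral_cell) (auto simp: I_def \<gamma>_def set_lebesgue_integral_def)
      then show ?thesis using sch that unfolding fast_scheme_def k_def[symmetric] Let_def by presburger
    qed
    have X_meas: "X n \<in> borel_measurable P" if "n \<le> N" for n
      using that
    proof (induction n rule: less_induct)
      case (less n)
      have "(\<lambda>w. x0 w + (\<Sum>j\<in>{1..n}. I n j *\<^sub>R b (X (j - 1) w)) + G (real n * k) w) \<in> borel_measurable P"
        using less G_meas[OF tT[OF less.prems]]
        by (intro borel_measurable_add borel_measurable_sum borel_measurable_scaleR borel_measurable_const x0
            measurable_compose[OF less.IH b_measurable]) auto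
      then show ?case
        by (rule measurable_cong[THEN iffD1, rotated]) (use Xeq less.prems in auto)
    qed
    have cell_sub: "cell k j \<subseteq> {0..<real n * k}" if "j \<in> {1..n}" for j n
    proof -
      have "real j * k \<le> real n * k" using that k by (intro mult_right_mono) auto
      then show ?thesis using k by (auto simp: cell_def intro: order_trans[OF mult_nonneg_nonneg])
    qed
    have g_err: "\<bar>\<gamma> (t - u) - K t u\<bar> \<le> \<epsilon> / Gamma \<alpha>" if "0 \<le> u" "u < t" "t \<le> T" for t u
      using soe_kernel_error[OF soe Gam, of "t - u"] that \<epsilon> by (simp add: \<gamma>_def k_def K_def)
    have len: "(\<integral>u. indicator (cell k j) u * c \<partial>lborel) = k * c" "integrable lborel (\<lambda>u. indicator (cell k j) u * c)" if "0 < j" for j c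
    proof -
      have "real (j - 1) * k \<le> real j * k" "real j * k - real (j - 1) * k = k"
        using k that by (auto simp: of_nat_diff algebra_simps)
      then have "emeasure lborel (cell k j) = ennreal k" unfolding cell_def by simp
      then show "(\<integral>u. indicator (cell k j) u * c \<partial>lborel) = k * c" "integrable lborel (\<lambda>u. indicator (cell k j) u * c)"
        using k by (auto simp: measure_def)
    qed
    have I_int: "integrable lborel (\<lambda>u. indicator (cell k j) u * \<gamma> (real n * k - u))"
      and I_err: "\<bar>I n j - \<kappa> n j\<bar> \<le> k * (\<epsilon> / Gamma \<alpha>)" if n: "n \<le> N" and j: "j \<in> {1..n}" for n j
    proof -
      have j0: "0 < j" using j by simp
      have bd: "\<bar>indicator (cell k j) u * (\<gamma> (real n * k - u) - K (real n * k) u)\<bar> \<le> indicator (cell k j) u * (\<epsilon> / Gamma \<alpha>)" for u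
        using cell_sub[OF j] g_err[of u "real n * k"] tT[OF n] by (auto simp: indicator_def subset_iff)
      have di: "integrable lborel (\<lambda>u. indicator (cell k j) u * (\<gamma> (real n * k - u) - K (real n * k) u))"
      proof (rule Bochner_Integration.integrable_bound)
        show "integrable lborel (\<lambda>u. indicator (cell k j) u * (\<epsilon> / Gamma \<alpha>))" using len(2) j by simp
        show "AE u in lborel. norm (indicator (cell k j) u * (\<gamma> (real n * k - u) - K (real n * k) u)) \<le> norm (indicator (cell k j) u * (\<epsilon> / Gamma \<alpha>))"
          unfolding real_norm_def by (intro AE_I2 order_trans[OF bd abs_ge_self])
      qed measurable
      have Ki: "integrable lborel (\<lambda>u. indicator (cell k j) u * K (real n * k) u)"
        using k by (intro K_cell_integrable) auto
      show Ii: "integrable lborel (\<lambda>u. indicator (cell k j) u * \<gamma> (real n * k - u))"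
        using Bochner_Integration.integrable_add[OF di Ki] by (simp add: algebra_simps)
      have "I n j - \<kappa> n j = (\<integral>u. indicator (cell k j) u * (\<gamma> (real n * k - u) - K (real n * k) u) \<partial>lborel)"
        unfolding I_def \<kappa>_def using Ii Ki by (simp add: right_diff_distrib)
      also have "\<bar>\<dots>\<bar> \<le> (\<integral>u. \<bar>indicator (cell k j) u * (\<gamma> (real n * k - u) - K (real n * k) u)\<bar> \<partial>lborel)"
        by (rule integral_abs_bound)
      also have "\<dots> \<le> (\<integral>u. indicator (cell k j) u * (\<epsilon> / Gamma \<alpha>) \<partial>lborel)"
        by (intro integral_mono integrable_abs di len(2) bd) (use j in auto)
      finally show "\<bar>I n j - \<kappa> n j\<bar> \<le> k * (\<epsilon> / Gamma \<alpha>)" unfolding len(1)[OF j0] .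
    qed
    have weight: "(\<Sum>j\<in>{1..n}. \<bar>I n j\<bar> * exp (\<mu> * (real (j - 1) * k))) \<le> exp (\<mu> * (real n * k)) / (2 * (L + 1))" if n: "n \<le> N" for n
    proof -
      define t where "t = real n * k"
      have t: "t \<in> {0..T}" using tT[OF n] by (simp add: t_def)
      have "ennreal (\<Sum>j\<in>{1..n}. \<bar>I n j\<bar> * exp (\<mu> * (real (j - 1) * k))) = (\<Sum>j\<in>{1..n}. ennreal (\<bar>I n j\<bar> * exp (\<mu> * (real (j - 1) * k))))"
        by (simp add: sum_ennreal)
      also have "\<dots> \<le> (\<Sum>j\<in>{1..n}. \<integral>\<^sup>+u. ennreal (indicator (cell k j) u * (c1 * ((t - u) powr (\<alpha> - 1) * exp (\<mu> * u)))) \<partial>lborel)"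
      proof (rule sum_mono)
        fix j assume j: "j \<in> {1..n}"
        have "ennreal (\<bar>I n j\<bar> * exp (\<mu> * (real (j - 1) * k))) = ennreal (exp (\<mu> * (real (j - 1) * k))) * ennreal (norm (I n j))"
          by (simp add: ennreal_mult[symmetric] mult.commute)
        also have "\<dots> \<le> ennreal (exp (\<mu> * (real (j - 1) * k))) * (\<integral>\<^sup>+u. ennreal (norm (indicator (cell k j) u * \<gamma> (real n * k - u))) \<partial>lborel)"
          unfolding I_def by (intro mult_left_mono integral_norm_bound_ennreal I_int[OF n j]) auto
        also have "\<dots> = (\<integral>\<^sup>+u. ennreal (exp (\<mu> * (real (j - 1) * k))) * ennreal (norm (indicator (cell k j) u * \<gamma> (real n * k - u))) \<partial>lborel)"
          by (simp add: nn_integral_cmult)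
        also have "\<dots> \<le> (\<integral>\<^sup>+u. ennreal (indicator (cell k j) u * (c1 * ((t - u) powr (\<alpha> - 1) * exp (\<mu> * u)))) \<partial>lborel)"
        proof (rule nn_integral_mono)
          fix u
          show "ennreal (exp (\<mu> * (real (j - 1) * k))) * ennreal (norm (indicator (cell k j) u * \<gamma> (real n * k - u)))
            \<le> ennreal (indicator (cell k j) u * (c1 * ((t - u) powr (\<alpha> - 1) * exp (\<mu> * u))))"
          proof (cases "u \<in> cell k j")
            case True
            then have u: "0 \<le> u" "u < t" using cell_sub[OF j] by (auto simp: t_def)
            have "1 = (t - u) powr (1 - \<alpha>) * (t - u) powr (\<alpha> - 1)" using u by (simp flip: powr_add)
            also have "\<dots> \<le> T powr (1 - \<alpha>) * (t - u) powr (\<alpha> - 1)"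
              using u t \<alpha> by (intro mult_right_mono powr_mono2) auto
            finally have 1: "1 \<le> T powr (1 - \<alpha>) * (t - u) powr (\<alpha> - 1)" .
            have "\<bar>\<gamma> (t - u) - K t u\<bar> \<le> \<epsilon> / Gamma \<alpha>" using g_err[OF u] t by auto
            then have "\<bar>\<gamma> (t - u)\<bar> \<le> K t u + \<epsilon> / Gamma \<alpha>" using K_nonneg[of t u] by linarith
            also have "\<dots> \<le> K t u + T powr (1 - \<alpha>) * (t - u) powr (\<alpha> - 1) / Gamma \<alpha>"
              using 1 \<epsilon> Gam by (intro add_left_mono divide_right_mono) auto
            also have "\<dots> = c1 * (t - u) powr (\<alpha> - 1)" using u by (simp add: c1_def K_def add_divide_distrib distrib_right)
            finally have "\<bar>\<gamma> (t - u)\<bar> \<le> c1 * (t - u) powr (\<alpha> - 1)" .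
            moreover have "exp (\<mu> * (real (j - 1) * k)) \<le> exp (\<mu> * u)"
              using True \<mu> by (auto simp: cell_def)
            ultimately have "exp (\<mu> * (real (j - 1) * k)) * \<bar>\<gamma> (t - u)\<bar> \<le> exp (\<mu> * u) * (c1 * (t - u) powr (\<alpha> - 1))"
              by (intro mult_mono) auto
            then show ?thesis using True unfolding t_def[symmetric] by (simp add: ennreal_mult[symmetric] ennreal_leI ac_simps)
          qed simp
        qed
        finally show "ennreal (\<bar>I n j\<bar> * exp (\<mu> * (real (j - 1) * k))) \<le> (\<integral>\<^sup>+u. ennreal (indicator (cell k j) u * (c1 * ((t - u) powr (\<alpha> - 1) * exp (\<mu> * u)))) \<partial>lborel)" .
      qed
      also have "\<dots> = (\<integral>\<^sup>+u. (\<Sum>j\<in>{1..n}. ennreal (indicator (cell k j) u * (c1 * ((t - u) powr (\<alpha> - 1) * exp (\<mu> * u))))) \<partial>lborel)"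
        by (rule nn_integral_sum[symmetric]) auto
      also have "\<dots> = (\<integral>\<^sup>+u. ennreal (indicator {0..<t} u * (c1 * ((t - u) powr (\<alpha> - 1) * exp (\<mu> * u)))) \<partial>lborel)"
        using c1 by (intro nn_integral_cong) (simp add: sum_ennreal sum_distrib_right[symmetric] sum_indicator_cell[OF k, simplified] t_def)
      also have "\<dots> \<le> (\<integral>\<^sup>+u. ennreal c1 * ennreal ((t - u) powr (\<alpha> - 1) * exp (\<mu> * u) * indicator {0..t} u) \<partial>lborel)"
        using c1 by (intro nn_integral_mono) (auto simp: indicator_def ennreal_mult[symmetric])
      also have "\<dots> = ennreal c1 * (\<integral>\<^sup>+u. ennreal ((t - u) powr (\<alpha> - 1) * exp (\<mu> * u) * indicator {0..t} u) \<partial>lborel)"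
        by (rule nn_integral_cmult) auto
      also have "\<dots> \<le> ennreal c1 * ennreal (1 / (c1 * 2 * (L + 1)) * exp (\<mu> * t))"
        by (intro mult_left_mono \<mu> t) auto
      also have "\<dots> = ennreal (exp (\<mu> * t) / (2 * (L + 1)))"
        using c1 L by (simp add: ennreal_mult[symmetric])
      finally show ?thesis using L by (simp add: t_def)
    qed
    have A: "0 \<le> A" using res[of 0] by (simp add: L2_le_def)
    define A' where "A' = A + T * (\<epsilon> / Gamma \<alpha>) * Cb"
    have A': "0 \<le> A'" using A Cb Gam \<epsilon> T by (simp add: A'_def)
    have ind: "L2_le P (\<lambda>w. X n w - y (real n * k) w) (2 * A' * exp (\<mu> * (real n * k)))" if "n \<le> N" for n
      using that
    proof (induction n rule: less_induct)
      case (less n)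
      note n = less.prems
      note [measurable] = X_meas[OF n]
      have 1: "L2_le P (\<lambda>w. \<Sum>j\<in>{1..n}. I n j *\<^sub>R (b (X (j - 1) w) - b (y (real (j - 1) * k) w)))
         (\<Sum>j\<in>{1..n}. \<bar>I n j\<bar> * (L * (2 * A' * exp (\<mu> * (real (j - 1) * k)))))"
      proof (intro L2_le_sum L2_le_scaleR)
        fix j assume j: "j \<in> {1..n}"
        then have [measurable]: "X (j - 1) \<in> borel_measurable P" using X_meas n by auto
        show "L2_le P (\<lambda>w. b (X (j - 1) w) - b (y (real (j - 1) * k) w)) (L * (2 * A' * exp (\<mu> * (real (j - 1) * k))))"
        proof (rule L2_le_norm_bound)
          show "L2_le P (\<lambda>w. X (j - 1) w - y (real (j - 1) * k) w) (2 * A' * exp (\<mu> * (real (j - 1) * k)))"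
            using j n by (intro less.IH) auto
          show "(\<lambda>w. b (X (j - 1) w) - b (y (real (j - 1) * k) w)) \<in> borel_measurable P" by measurable
        qed (use L in auto)
      qed simp
      have 2: "L2_le P (\<lambda>w. \<Sum>j\<in>{1..n}. (I n j - \<kappa> n j) *\<^sub>R b (y (real (j - 1) * k) w)) (\<Sum>j\<in>{1..n}. \<bar>I n j - \<kappa> n j\<bar> * Cb)"
        by (intro L2_le_sum L2_le_scaleR Cb) simp
      have 3: "L2_le P (residual k n) A" using res[OF n] by (simp add: k_def)
      have "L2_le P (\<lambda>w. X n w - y (real n * k) w)
         ((\<Sum>j\<in>{1..n}. \<bar>I n j\<bar> * (L * (2 * A' * exp (\<mu> * (real (j - 1) * k))))) + (\<Sum>j\<in>{1..n}. \<bar>I n j - \<kappa> n j\<bar> * Cb) + A)"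
      proof (rule L2_le_cong_AE[OF L2_le_add[OF L2_le_add[OF 1 2] 3]])
        show "AE w in P. X n w - y (real n * k) w = (\<Sum>j\<in>{1..n}. I n j *\<^sub>R (b (X (j - 1) w) - b (y (real (j - 1) * k) w)))
            + (\<Sum>j\<in>{1..n}. (I n j - \<kappa> n j) *\<^sub>R b (y (real (j - 1) * k) w)) + residual k n w"
          using y_solution[OF tT[OF n]] AE_space
        proof eventually_elim
          case (elim w)
          show ?case
            unfolding residual_eq[OF k elim(2)] Xeq[OF n elim(2)] elim(1)
            by (simp add: \<kappa>_def scaleR_diff_right scaleR_diff_left sum_subtractf)
        qed
      qed measurable
      then show ?case
      proof (rule L2_le_mono)
        have "(\<Sum>j\<in>{1..n}. \<bar>I n j\<bar> * (L * (2 * A' * exp (\<mu> * (real (j - 1) * k)))))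
            = L * (2 * A') * (\<Sum>j\<in>{1..n}. \<bar>I n j\<bar> * exp (\<mu> * (real (j - 1) * k)))"
          by (simp add: sum_distrib_left ac_simps)
        also have "\<dots> \<le> L * (2 * A') * (exp (\<mu> * (real n * k)) / (2 * (L + 1)))"
          using L A' by (intro mult_left_mono weight n) auto
        also have "\<dots> = (L / (L + 1)) * (A' * exp (\<mu> * (real n * k)))" using L by (simp add: field_simps)
        also have "\<dots> \<le> 1 * (A' * exp (\<mu> * (real n * k)))" using L A' by (intro mult_right_mono) auto
        finally have a: "(\<Sum>j\<in>{1..n}. \<bar>I n j\<bar> * (L * (2 * A' * exp (\<mu> * (real (j - 1) * k))))) \<le> A' * exp (\<mu> * (real n * k))" by simp
        have "(\<Sum>j\<in>{1..n}. \<bar>I n j - \<kappa> n j\<bar> * Cb) \<le> (\<Sum>j\<in>{1..n}. k * (\<epsilon> / Gamma \<alpha>) * Cb)"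
          by (intro sum_mono mult_right_mono I_err n Cb)
        also have "\<dots> = (real n * k) * ((\<epsilon> / Gamma \<alpha>) * Cb)" by simp
        also have "\<dots> \<le> T * ((\<epsilon> / Gamma \<alpha>) * Cb)"
          using tT[OF n] \<epsilon> Gam Cb by (intro mult_right_mono) auto
        finally have "(\<Sum>j\<in>{1..n}. \<bar>I n j - \<kappa> n j\<bar> * Cb) + A \<le> A'" by (simp add: A'_def)
        moreover have "A' * 1 \<le> A' * exp (\<mu> * (real n * k))"
          using A' \<mu> k by (intro mult_left_mono) auto
        ultimately show "(\<Sum>j\<in>{1..n}. \<bar>I n j\<bar> * (L * (2 * A' * exp (\<mu> * (real (j - 1) * k))))) + (\<Sum>j\<in>{1..n}. \<bar>I n j - \<kappa> n j\<bar> * Cb) + A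
          \<le> 2 * A' * exp (\<mu> * (real n * k))" using a by linarith
      qed
    qed
    have "L2_le P (\<lambda>w. X n w - y (real n * k) w) (C0 * (A + \<epsilon>))"
    proof (rule L2_le_mono[OF ind[OF n]])
      have "2 * A' * exp (\<mu> * (real n * k)) \<le> 2 * A' * exp (\<mu> * T)"
        using A' \<mu> tT[OF n] by (intro mult_left_mono) auto
      moreover have "A' \<le> (1 + T * Cb / Gamma \<alpha>) * (A + \<epsilon>)"
      proof -
        define c where "c = T * Cb / Gamma \<alpha>"
        have "0 \<le> c * A" using A T Cb Gam by (simp add: c_def)
        then have "A + c * \<epsilon> \<le> (1 + c) * (A + \<epsilon>)" using \<epsilon> by (simp add: algebra_simps)
        then show ?thesis by (simp add: A'_def c_def mult.commute mult.left_commute)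
      qed
      then have "2 * exp (\<mu> * T) * A' \<le> C0 * (A + \<epsilon>)"
        unfolding C0_def mult.assoc by (intro mult_left_mono) (auto simp: mult.assoc)
      ultimately show "2 * A' * exp (\<mu> * (real n * k)) \<le> C0 * (A + \<epsilon>)" by (simp add: mult.commute mult.left_commute)
    qed
    then show ?thesis using tT[OF n] by (simp add: y_eq k_def)
  qed
  show ?thesis
    by (intro exI[of _ C0] conjI C0 allI impI) (elim conjE, rule main, auto)
qed

lemma residual_le:
  "\<exists>C\<ge>0. \<forall>(N::nat). 0 < N \<longrightarrow> (\<forall>n\<le>N. L2_le P (residual (T / real N) n) (C * (T / real N) powr (\<alpha> + H - 1)))"
proof -
  obtain C where C: "0 \<le> C" "\<And>s t. s \<in> {0..T} \<Longrightarrow> t \<in> {0..T} \<Longrightarrow> L2_le P (\<lambda>w. y t w - y s w) (C * \<bar>t - s\<bar> powr (\<alpha> + H - 1))"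
    using y_Holder by blast
  define C' where "C' = T powr \<alpha> / (\<alpha> * Gamma \<alpha>) * (L * C)"
  have C': "0 \<le> C'" using C L \<alpha> Gam by (simp add: C'_def)
  have "L2_le P (residual (T / real N) n) (C' * (T / real N) powr (\<alpha> + H - 1))" if N: "0 < N" and n: "n \<le> N" for N n :: nat
  proof -
    define k where "k = T / real N"
    define t where "t = real n * k"
    have k: "0 < k" using T N by (simp add: k_def)
    have t: "t \<in> {0..T}" using n T N by (auto simp: t_def k_def field_simps intro!: mult_left_mono)
    have "L2_le P (\<lambda>w. \<integral>s. K t s *\<^sub>R (b (y (grid_floor k s) w) - b (y s w)) \<partial>lborel) (C' * k powr (\<alpha> + H - 1))"
    proof (rule L2_le_integral[where \<phi>="\<lambda>_. L * (C * k powr (\<alpha> + H - 1))"])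
      show "sigma_finite_measure P" by unfold_locales
      show "(\<lambda>p. b (y (grid_floor k (fst p)) (snd p)) - b (y (fst p) (snd p))) \<in> borel_measurable (lborel \<Otimes>\<^sub>M P)"
        by (intro borel_measurable_diff measurable_compose[OF y_joint' b_measurable]) measurable
      show "L2_le P (\<lambda>w. b (y (grid_floor k s) w) - b (y s w)) (L * (C * k powr (\<alpha> + H - 1)))" if "K t s \<noteq> 0" for s
      proof (rule L2_le_norm_bound)
        have s: "s \<in> {0..T}" using that t by (auto simp: K_def split: if_splits)
        note gf = grid_floor_bounds[OF k, of s]
        have g: "grid_floor k s \<in> {0..T}" using gf s by auto
        show "L2_le P (\<lambda>w. y (grid_floor k s) w - y s w) (C * k powr (\<alpha> + H - 1))"
          by (rule L2_le_mono[OF C(2)[OF s g]]) (use C gf H in \<open>auto intro!: mult_left_mono powr_mono2\<close>)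
      qed (use L in auto)
      have "(\<integral>\<^sup>+s. ennreal (\<bar>K t s\<bar> * (L * (C * k powr (\<alpha> + H - 1)))) \<partial>lborel) = ennreal (t powr \<alpha> / (\<alpha> * Gamma \<alpha>)) * ennreal (L * (C * k powr (\<alpha> + H - 1)))"
        using t L C by (simp add: ennreal_mult'' nn_integral_multc K_integral(3))
      also have "\<dots> = ennreal (t powr \<alpha> / (\<alpha> * Gamma \<alpha>) * (L * (C * k powr (\<alpha> + H - 1))))"
        using L C \<alpha> Gam by (intro ennreal_mult[symmetric]) auto
      also have "\<dots> \<le> ennreal (T powr \<alpha> / (\<alpha> * Gamma \<alpha>) * (L * (C * k powr (\<alpha> + H - 1))))"
        using t L C \<alpha> Gam by (intro ennreal_leI mult_right_mono divide_right_mono powr_mono2) auto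
      finally show "(\<integral>\<^sup>+s. ennreal (\<bar>K t s\<bar> * (L * (C * k powr (\<alpha> + H - 1)))) \<partial>lborel) \<le> ennreal (C' * k powr (\<alpha> + H - 1))"
        by (simp add: C'_def mult.assoc)
    qed (use C' in auto)
    then show ?thesis unfolding residual_def k_def[symmetric] t_def .
  qed
  with C' show ?thesis by blast
qed

end

section \<open>Correlations and sums\<close>

lemma L2_le_inner:
  fixes Y Z :: "'w \<Rightarrow> 'a::euclidean_space"
  assumes "L2_le P Y A" "L2_le P Z C"
  shows "integrable P (\<lambda>w. Y w \<bullet> Z w)" "\<bar>\<integral>w. Y w \<bullet> Z w \<partial>P\<bar> \<le> A * C"
proof -
  note [measurable] = L2_leD(1)[OF assms(1)] L2_leD(1)[OF assms(2)]
  have nn: "(\<integral>\<^sup>+w. ennreal (norm (Y w)) * ennreal (norm (Z w)) \<partial>P) \<le> ennreal (A * C)"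
    using assms by (intro nn_integral_mult_le_L2) (auto simp: L2_le_def ennreal_power)
  have bd: "(\<integral>\<^sup>+w. ennreal (norm (Y w \<bullet> Z w)) \<partial>P) \<le> ennreal (A * C)"
    by (rule order_trans[OF nn_integral_mono nn])
      (auto simp: ennreal_mult[symmetric] Cauchy_Schwarz_ineq2 intro!: ennreal_leI)
  show i: "integrable P (\<lambda>w. Y w \<bullet> Z w)"
    by (rule integrableI_bounded) (use bd in \<open>auto intro: le_less_trans simp: less_top\<close>)
  have "ennreal (norm (\<integral>w. Y w \<bullet> Z w \<partial>P)) \<le> ennreal (A * C)"
    using integral_norm_bound_ennreal[OF i] bd by (rule order_trans)
  then show "\<bar>\<integral>w. Y w \<bullet> Z w \<partial>P\<bar> \<le> A * C"
    using assms by (simp add: ennreal_le_iff L2_le_def)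
qed

lemma expectation_inner_integral:
  fixes Y :: "'w \<Rightarrow> 'a::euclidean_space" and Z :: "real \<Rightarrow> 'w \<Rightarrow> 'a" and f :: "real \<Rightarrow> real"
  assumes "sigma_finite_measure P" and Y: "L2_le P Y A"
    and Zm: "(\<lambda>p. Z (fst p) (snd p)) \<in> borel_measurable (lborel \<Otimes>\<^sub>M P)"
    and Z: "\<And>s. f s \<noteq> 0 \<Longrightarrow> L2_le P (Z s) C" and C: "0 \<le> C"
    and f: "integrable lborel f"
    and path: "\<And>w. w \<in> space P \<Longrightarrow> integrable lborel (\<lambda>s. f s *\<^sub>R Z s w)"
  shows "(\<integral>w. Y w \<bullet> (\<integral>s. f s *\<^sub>R Z s w \<partial>lborel) \<partial>P) = (\<integral>s. f s * (\<integral>w. Y w \<bullet> Z s w \<partial>P) \<partial>lborel)"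
proof -
  interpret Pm: sigma_finite_measure P by fact
  interpret pair_sigma_finite lborel P ..
  note [measurable] = L2_leD(1)[OF Y] Zm
  have [measurable]: "f \<in> borel_measurable borel" using f by auto
  have jm: "(\<lambda>p. f (fst p) * (Y (snd p) \<bullet> Z (fst p) (snd p))) \<in> borel_measurable (lborel \<Otimes>\<^sub>M P)"
    by measurable
  have A: "0 \<le> A" using Y by (simp add: L2_le_def)
  have int: "integrable (lborel \<Otimes>\<^sub>M P) (\<lambda>p. f (fst p) * (Y (snd p) \<bullet> Z (fst p) (snd p)))"
  proof (rule integrableI_bounded[OF jm])
    have "(\<integral>\<^sup>+p. ennreal (norm (f (fst p) * (Y (snd p) \<bullet> Z (fst p) (snd p)))) \<partial>(lborel \<Otimes>\<^sub>M P))
       = (\<integral>\<^sup>+s. \<integral>\<^sup>+w. ennreal (norm (f s * (Y w \<bullet> Z s w))) \<partial>P \<partial>lborel)"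
      using Pm.nn_integral_fst[of "\<lambda>p. ennreal (norm (f (fst p) * (Y (snd p) \<bullet> Z (fst p) (snd p))))" lborel] by simp
    also have "\<dots> \<le> (\<integral>\<^sup>+s. ennreal \<bar>f s\<bar> * ennreal (A * C) \<partial>lborel)"
    proof (rule nn_integral_mono)
      fix s
      show "(\<integral>\<^sup>+w. ennreal (norm (f s * (Y w \<bullet> Z s w))) \<partial>P) \<le> ennreal \<bar>f s\<bar> * ennreal (A * C)"
      proof (cases "f s = 0")
        case False
        note Zs = Z[OF False]
        note [measurable] = L2_leD(1)[OF Zs]
        have "(\<integral>\<^sup>+w. ennreal (norm (f s * (Y w \<bullet> Z s w))) \<partial>P) \<le> (\<integral>\<^sup>+w. ennreal \<bar>f s\<bar> * (ennreal (norm (Y w)) * ennreal (norm (Z s w))) \<partial>P)"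
          by (intro nn_integral_mono) (auto simp: abs_mult ennreal_mult[symmetric] Cauchy_Schwarz_ineq2 intro!: ennreal_leI mult_left_mono)
        also have "\<dots> = ennreal \<bar>f s\<bar> * (\<integral>\<^sup>+w. ennreal (norm (Y w)) * ennreal (norm (Z s w)) \<partial>P)"
          by (rule nn_integral_cmult) measurable
        also have "\<dots> \<le> ennreal \<bar>f s\<bar> * ennreal (A * C)"
          using Y Zs by (intro mult_left_mono nn_integral_mult_le_L2) (auto simp: L2_le_def ennreal_power)
        finally show ?thesis .
      qed simp
    qed
    also have "\<dots> = (\<integral>\<^sup>+s. ennreal \<bar>f s\<bar> \<partial>lborel) * ennreal (A * C)" by (simp add: nn_integral_multc)
    also have "\<dots> < \<infinity>" using f by (auto simp: integrable_iff_bounded ennreal_mult_less_top)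
    finally show "(\<integral>\<^sup>+p. ennreal (norm (f (fst p) * (Y (snd p) \<bullet> Z (fst p) (snd p)))) \<partial>(lborel \<Otimes>\<^sub>M P)) < \<infinity>" .
  qed
  have "(\<integral>w. Y w \<bullet> (\<integral>s. f s *\<^sub>R Z s w \<partial>lborel) \<partial>P) = (\<integral>w. (\<integral>s. f s * (Y w \<bullet> Z s w) \<partial>lborel) \<partial>P)"
  proof (rule Bochner_Integration.integral_cong[OF refl])
    fix w assume w: "w \<in> space P"
    show "Y w \<bullet> (\<integral>s. f s *\<^sub>R Z s w \<partial>lborel) = (\<integral>s. f s * (Y w \<bullet> Z s w) \<partial>lborel)"
      using integral_inner_right[OF path[OF w], of "Y w"] by simp
  qed
  also have "\<dots> = (\<integral>s. (\<integral>w. f s * (Y w \<bullet> Z s w) \<partial>P) \<partial>lborel)"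
    using Fubini_integral[of "\<lambda>s w. f s * (Y w \<bullet> Z s w)"] int by (simp add: case_prod_unfold)
  finally show ?thesis by simp
qed

lemma powr_diff_le_interp:
  fixes s a k \<alpha> \<beta> :: real
  assumes "0 < s" "0 \<le> a" "a \<le> s" "s - a \<le> k" "0 < \<alpha>" "\<alpha> \<le> 1" "0 \<le> \<beta>" "\<beta> \<le> 1"
  shows "s powr \<alpha> - a powr \<alpha> \<le> k powr \<beta> * s powr (\<alpha> - \<beta>)"
proof -
  have r: "0 \<le> a / s" "a / s \<le> 1" using assms by auto
  have "a / s \<le> (a / s) powr \<alpha>"
  proof (cases "a = 0")
    case False
    then have "(a / s) powr 1 \<le> (a / s) powr \<alpha>" using assms r by (intro powr_mono') auto
    then show ?thesis using False assms by simp
  qed simp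
  then have "1 - (a / s) powr \<alpha> \<le> (s - a) / s" using assms by (simp add: diff_divide_distrib)
  also have "\<dots> \<le> ((s - a) / s) powr \<beta>"
  proof (cases "a = s")
    case False
    then have "((s - a) / s) powr 1 \<le> ((s - a) / s) powr \<beta>" using assms by (intro powr_mono') auto
    then show ?thesis using False assms by simp
  qed simp
  also have "\<dots> \<le> (k / s) powr \<beta>" using assms by (intro powr_mono2 divide_right_mono) auto
  finally have "s powr \<alpha> * (1 - (a / s) powr \<alpha>) \<le> s powr \<alpha> * (k / s) powr \<beta>"
    by (intro mult_left_mono) auto
  moreover have "s powr \<alpha> * (1 - (a / s) powr \<alpha>) = s powr \<alpha> - a powr \<alpha>"
    using assms by (simp add: powr_divide field_simps)
  moreover have "s powr \<alpha> * (k / s) powr \<beta> = k powr \<beta> * s powr (\<alpha> - \<beta>)"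
    using assms by (simp add: powr_divide powr_diff)
  ultimately show ?thesis by simp
qed

lemma powr_second_difference:
  fixes \<alpha> d p q k \<delta> :: real
  assumes "0 < \<alpha>" "\<alpha> \<le> 1" "0 \<le> p" "p \<le> k" "0 \<le> q" "q \<le> k" "0 < \<delta>" "\<delta> \<le> d - q"
  shows "\<bar>((d + p) powr \<alpha> - d powr \<alpha>) - ((d - q + p) powr \<alpha> - (d - q) powr \<alpha>)\<bar> \<le> k\<^sup>2 * \<delta> powr (\<alpha> - 2)"
proof (cases "q = 0")
  case False
  then have q: "0 < q" using assms by simp
  define \<phi> where "\<phi> = (\<lambda>z. (z + p) powr \<alpha> - z powr \<alpha>)"
  have der: "(\<phi> has_real_derivative (\<alpha> * (z + p) powr (\<alpha> - 1) - \<alpha> * z powr (\<alpha> - 1))) (at z)" if "0 < z" for z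
    unfolding \<phi>_def using that assms by (auto intro!: derivative_eq_intros simp: powr_diff)
  obtain z where z: "d - q < z" "z < d" "\<phi> d - \<phi> (d - q) = (d - (d - q)) * (\<alpha> * (z + p) powr (\<alpha> - 1) - \<alpha> * z powr (\<alpha> - 1))"
    using MVT2[of "d - q" d \<phi> "\<lambda>z. \<alpha> * (z + p) powr (\<alpha> - 1) - \<alpha> * z powr (\<alpha> - 1)"] der q assms by auto
  have z0: "0 < z" using z assms by linarith
  have m: "(z + p) powr (\<alpha> - 1) \<le> z powr (\<alpha> - 1)" using z0 assms by (intro powr_mono2') auto
  have "z powr (\<alpha> - 1) - (p + z) powr (\<alpha> - 1) \<le> z powr (\<alpha> - 1) * min 1 (p / z)"
    using z0 assms by (intro powr_diff_le_min) auto
  also have "\<dots> \<le> z powr (\<alpha> - 1) * (p / z)" by (intro mult_left_mono) auto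
  also have "\<dots> = p * z powr (\<alpha> - 2)" using z0 by (simp add: powr_diff power2_eq_square)
  also have "\<dots> \<le> k * \<delta> powr (\<alpha> - 2)" using assms z by (intro mult_mono powr_mono2') auto
  finally have 1: "z powr (\<alpha> - 1) - (z + p) powr (\<alpha> - 1) \<le> k * \<delta> powr (\<alpha> - 2)" by (simp add: add.commute)
  have "\<bar>\<phi> d - \<phi> (d - q)\<bar> = q * (\<alpha> * (z powr (\<alpha> - 1) - (z + p) powr (\<alpha> - 1)))"
    unfolding z(3) using m assms by (simp add: abs_mult right_diff_distrib[symmetric])
  also have "\<dots> \<le> k * (1 * (k * \<delta> powr (\<alpha> - 2)))"
    using 1 m assms by (intro mult_mono) auto
  finally show ?thesis by (simp add: \<phi>_def power2_eq_square)
qed (use assms in simp)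

definition corr_decay :: "real \<Rightarrow> nat \<Rightarrow> real" where
  "corr_decay \<alpha> m = (if m \<le> 1 then 1 else real (m - 1) powr (\<alpha> - 2))"

lemma corr_decay_nonneg [simp]: "0 \<le> corr_decay \<alpha> m" by (simp add: corr_decay_def)

lemma corr_decay_summable: "\<alpha> < 1 \<Longrightarrow> summable (corr_decay \<alpha>)"
proof -
  assume "\<alpha> < 1"
  then have "summable (\<lambda>m. real m powr (\<alpha> - 2))" by (subst summable_real_powr_iff) simp
  then have "summable (\<lambda>m. real (m + 1) powr (\<alpha> - 2))" by (subst summable_iff_shift)
  moreover have "(\<lambda>m. real (m + 1) powr (\<alpha> - 2)) = (\<lambda>m. corr_decay \<alpha> (m + 2))"
    by (auto simp: corr_decay_def)
  ultimately show ?thesis by (simp only: summable_iff_shift)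
qed

definition nat_dist :: "nat \<Rightarrow> nat \<Rightarrow> nat" where "nat_dist i j = (if i \<le> j then j - i else i - j)"

lemma corr_decay_row_sum:
  assumes "\<alpha> < 1"
  shows "(\<Sum>j\<in>{1..n}. corr_decay \<alpha> (nat_dist i j)) \<le> 2 * suminf (corr_decay \<alpha>)"
proof -
  note s = corr_decay_summable[OF assms]
  have "(\<Sum>j\<in>{1..n}. corr_decay \<alpha> (nat_dist i j)) \<le> (\<Sum>j\<in>{1..n}. (if i \<le> j then corr_decay \<alpha> (j - i) else 0) + (if j \<le> i then corr_decay \<alpha> (i - j) else 0))"
    by (intro sum_mono) (auto simp: nat_dist_def)
  also have "\<dots> = (\<Sum>j\<in>{1..n} \<inter> {j. i \<le> j}. corr_decay \<alpha> (j - i)) + (\<Sum>j\<in>{1..n} \<inter> {j. j \<le> i}. corr_decay \<alpha> (i - j))"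
    by (simp add: sum.distrib sum.inter_restrict)
  also have "(\<Sum>j\<in>{1..n} \<inter> {j. i \<le> j}. corr_decay \<alpha> (j - i)) = sum (corr_decay \<alpha>) ((\<lambda>j. j - i) ` ({1..n} \<inter> {j. i \<le> j}))"
    by (subst sum.reindex) (auto simp: inj_on_def)
  also have "\<dots> \<le> suminf (corr_decay \<alpha>)" by (rule sum_le_suminf[OF s]) auto
  also have "(\<Sum>j\<in>{1..n} \<inter> {j. j \<le> i}. corr_decay \<alpha> (i - j)) = sum (corr_decay \<alpha>) ((\<lambda>j. i - j) ` ({1..n} \<inter> {j. j \<le> i}))"
    by (subst sum.reindex) (auto simp: inj_on_def)
  also have "\<dots> \<le> suminf (corr_decay \<alpha>)" by (rule sum_le_suminf[OF s]) auto
  finally show ?thesis by simp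
qed

lemma schur_bound:
  fixes f :: "nat \<Rightarrow> real" and q :: "nat \<Rightarrow> nat \<Rightarrow> real"
  assumes "finite I" "\<And>i j. q i j = q j i" "\<And>i j. 0 \<le> q i j" "\<And>i. (\<Sum>j\<in>I. q i j) \<le> S"
  shows "(\<Sum>i\<in>I. \<Sum>j\<in>I. f i * f j * q i j) \<le> S * (\<Sum>i\<in>I. (f i)\<^sup>2)"
proof -
  have "(\<Sum>i\<in>I. \<Sum>j\<in>I. f i * f j * q i j) \<le> (\<Sum>i\<in>I. \<Sum>j\<in>I. (f i)\<^sup>2 / 2 * q i j + (f j)\<^sup>2 / 2 * q i j)"
  proof (intro sum_mono)
    fix i j
    have "f i * f j \<le> (f i)\<^sup>2 / 2 + (f j)\<^sup>2 / 2" using sum_squares_bound[of "f i" "f j"] by simp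
    from mult_right_mono[OF this assms(3)[of i j]] show "f i * f j * q i j \<le> (f i)\<^sup>2 / 2 * q i j + (f j)\<^sup>2 / 2 * q i j"
      by (simp add: ring_distribs)
  qed
  also have "\<dots> = (\<Sum>i\<in>I. \<Sum>j\<in>I. (f i)\<^sup>2 / 2 * q i j) + (\<Sum>i\<in>I. \<Sum>j\<in>I. (f j)\<^sup>2 / 2 * q i j)"
    by (simp add: sum.distrib)
  also have "(\<Sum>i\<in>I. \<Sum>j\<in>I. (f j)\<^sup>2 / 2 * q i j) = (\<Sum>j\<in>I. \<Sum>i\<in>I. (f j)\<^sup>2 / 2 * q j i)"
    by (subst sum.swap) (simp add: assms(2))
  also have "(\<Sum>i\<in>I. \<Sum>j\<in>I. (f i)\<^sup>2 / 2 * q i j) + (\<Sum>j\<in>I. \<Sum>i\<in>I. (f j)\<^sup>2 / 2 * q j i) = (\<Sum>i\<in>I. (f i)\<^sup>2 * (\<Sum>j\<in>I. q i j))"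
    by (simp add: sum_distrib_left sum_distrib_right sum.distrib[symmetric] ring_distribs[symmetric] mult.commute)
  also have "\<dots> \<le> (\<Sum>i\<in>I. (f i)\<^sup>2 * S)" by (intro sum_mono mult_left_mono assms) auto
  finally show ?thesis by (simp add: sum_distrib_left mult.commute)
qed

lemma sum_powr_le:
  fixes p :: real
  assumes "0 < p" "p \<le> 1"
  shows "(\<Sum>l\<in>{1..n}. real l powr (p - 1)) \<le> real n powr p / p"
proof (induction n)
  case (Suc n)
  have "p * real (Suc n) powr (p - 1) \<le> real (Suc n) powr p - real n powr p"
  proof (cases "n = 0")
    case False
    obtain z where z: "real n < z" "z < real (Suc n)" "real (Suc n) powr p - real n powr p = (real (Suc n) - real n) * (p * z powr (p - 1))"
    proof -
      have "((\<lambda>z. z powr p) has_real_derivative p * z powr (p - 1)) (at z)" if "real n \<le> z" for z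
        using that False by (intro has_real_derivative_powr) auto
      then show ?thesis using MVT2[of "real n" "real (Suc n)" "\<lambda>z. z powr p" "\<lambda>z. p * z powr (p - 1)"] that by auto
    qed
    have "real (Suc n) powr (p - 1) \<le> z powr (p - 1)" using z assms by (intro powr_mono2') auto
    then show ?thesis using z assms by simp
  qed (use assms in simp)
  then have "real (Suc n) powr (p - 1) \<le> real (Suc n) powr p / p - real n powr p / p"
    using assms by (simp add: field_simps del: of_nat_Suc)
  then show ?case using Suc by (simp add: atLeastAtMostSuc_conv del: of_nat_Suc)
qed (use assms in simp)

lemma sum_inverse_le_ln:
  assumes "0 < n"
  shows "(\<Sum>l\<in>{1..n}. real l powr (-1)) \<le> 1 + ln (real n)"
  using assms
proof (induction n)
  case (Suc n)
  show ?case
  proof (cases "n = 0")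
    case False
    have "ln (real n / real (Suc n)) \<le> real n / real (Suc n) - 1" using False by (intro ln_le_minus_one) auto
    then have "real (Suc n) powr (-1) \<le> ln (real (Suc n)) - ln (real n)"
      using False by (simp add: ln_div powr_minus_divide field_simps)
    then show ?thesis using Suc False by (simp add: atLeastAtMostSuc_conv del: of_nat_Suc)
  qed simp
qed simp

section \<open>The case of a fractional Brownian forcing\<close>

locale rl_solution_fd = rl_solution +
  fixes Bm :: "real^'b^'b"
  assumes fd: "\<alpha> = 2 - 2*H" and lin: "b = (\<lambda>v. Bm *v v)"
    and G_var: "\<And>s t. s \<in> {0..T} \<Longrightarrow> t \<in> {0..T} \<Longrightarrow>
        (\<integral>w. (norm (G t w - G s w))\<^sup>2 \<partial>P) = CG\<^sup>2 * \<bar>t - s\<bar> powr \<alpha>"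
begin

definition \<beta> :: real where "\<beta> = min (3/2 - H) (3 - 3*H)"

lemma \<beta>: "0 < \<beta>" "\<beta> < 1" "\<beta> \<le> \<alpha> + 1 - H" using H \<alpha> fd by (auto simp: \<beta>_def)

lemma K_diff_weighted:
  "\<exists>C\<ge>0. \<forall>a t. 0 \<le> a \<and> a \<le> t \<and> t \<le> T \<longrightarrow>
     (\<integral>\<^sup>+r. ennreal (\<bar>K t r - K a r\<bar> * \<bar>r - a\<bar> powr (1 - H)) \<partial>lborel) \<le> ennreal (C * (t - a) powr \<beta>)"
proof -
  define q where "q = \<alpha> + 1 - H - \<beta>"
  have q: "0 \<le> q" using \<beta> by (simp add: q_def)
  define C where "C = T powr q / Gamma \<alpha> * (1 / \<beta> + 1 / (1 - \<beta>)) + T powr q / (\<alpha> * Gamma \<alpha>)"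
  have C: "0 \<le> C" using \<beta> \<alpha> Gam by (simp add: C_def)
  have "(\<integral>\<^sup>+r. ennreal (\<bar>K t r - K a r\<bar> * \<bar>r - a\<bar> powr (1 - H)) \<partial>lborel) \<le> ennreal (C * (t - a) powr \<beta>)"
    if at: "0 \<le> a" "a < t" "t \<le> T" for a t
  proof -
    define h where "h = t - a"
    have h: "0 < h" "h \<le> T" using at by (auto simp: h_def)
    define F where "F = (\<lambda>w. ennreal (w powr (\<beta> - 1) * min 1 (h / w) * indicator {0<..} w))"
    have [measurable]: "F \<in> borel_measurable borel" unfolding F_def by measurable
    have "(\<integral>\<^sup>+r. ennreal (\<bar>K t r - K a r\<bar> * \<bar>r - a\<bar> powr (1 - H)) \<partial>lborel)
      \<le> (\<integral>\<^sup>+r. ennreal (T powr q / Gamma \<alpha>) * F (a + -1 * r) + ennreal (h powr (1 - H) / Gamma \<alpha>) * ennreal ((t - r) powr (\<alpha> - 1) * indicator {a..t} r) \<partial>lborel)"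
    proof (rule nn_integral_mono)
      fix r
      consider "r < 0" | "r = a" | "0 \<le> r" "r < a" | "a < r" "r \<le> t" | "t < r" by linarith
      then show "ennreal (\<bar>K t r - K a r\<bar> * \<bar>r - a\<bar> powr (1 - H))
        \<le> ennreal (T powr q / Gamma \<alpha>) * F (a + -1 * r) + ennreal (h powr (1 - H) / Gamma \<alpha>) * ennreal ((t - r) powr (\<alpha> - 1) * indicator {a..t} r)"
      proof cases
        case 3
        define \<tau> where "\<tau> = a - r"
        have \<tau>: "0 < \<tau>" "\<tau> \<le> T" "t - r = h + \<tau>" using 3 at by (auto simp: \<tau>_def h_def)
        have "(h + \<tau>) powr (\<alpha> - 1) \<le> \<tau> powr (\<alpha> - 1)" using \<tau> h \<alpha> by (intro powr_mono2') auto
        then have "\<bar>K t r - K a r\<bar> = (\<tau> powr (\<alpha> - 1) - (h + \<tau>) powr (\<alpha> - 1)) / Gamma \<alpha>"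
          using 3 at Gam \<tau>(3) by (simp add: K_def \<tau>_def[symmetric] diff_divide_distrib[symmetric])
        also have "\<dots> \<le> \<tau> powr (\<alpha> - 1) * min 1 (h / \<tau>) / Gamma \<alpha>"
          using \<tau> h \<alpha> Gam by (intro divide_right_mono powr_diff_le_min) auto
        finally have "\<bar>K t r - K a r\<bar> * \<tau> powr (1 - H) \<le> \<tau> powr (\<alpha> - 1) * min 1 (h / \<tau>) / Gamma \<alpha> * \<tau> powr (1 - H)"
          by (intro mult_right_mono) auto
        also have "\<dots> = \<tau> powr q * (\<tau> powr (\<beta> - 1) * min 1 (h / \<tau>) / Gamma \<alpha>)"
        proof -
          have "\<tau> powr (\<alpha> - 1) * \<tau> powr (1 - H) = \<tau> powr q * \<tau> powr (\<beta> - 1)"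
            by (simp add: q_def powr_add[symmetric] algebra_simps)
          then show ?thesis by (simp add: mult.commute mult.left_commute)
        qed
        also have "\<dots> \<le> T powr q * (\<tau> powr (\<beta> - 1) * min 1 (h / \<tau>) / Gamma \<alpha>)"
          using \<tau> h q Gam by (intro mult_right_mono powr_mono2) auto
        finally have 1: "\<bar>K t r - K a r\<bar> * \<tau> powr (1 - H) \<le> T powr q / Gamma \<alpha> * (\<tau> powr (\<beta> - 1) * min 1 (h / \<tau>))"
          by simp
        have "\<bar>r - a\<bar> = \<tau>" "a + -1 * r = \<tau>" using 3 by (auto simp: \<tau>_def)
        then have "ennreal (\<bar>K t r - K a r\<bar> * \<bar>r - a\<bar> powr (1 - H)) \<le> ennreal (T powr q / Gamma \<alpha>) * F (a + -1 * r)"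
          using 1 \<tau> h Gam by (simp add: F_def ennreal_mult[symmetric] ennreal_leI)
        then show ?thesis by (rule add_increasing2[rotated]) simp
      next
        case 4
        have "\<bar>r - a\<bar> powr (1 - H) \<le> h powr (1 - H)" using 4 H by (intro powr_mono2) (auto simp: h_def)
        then have "\<bar>K t r - K a r\<bar> * \<bar>r - a\<bar> powr (1 - H) \<le> (t - r) powr (\<alpha> - 1) / Gamma \<alpha> * h powr (1 - H)"
          using 4 at Gam by (intro mult_mono) (auto simp: K_def)
        then have "ennreal (\<bar>K t r - K a r\<bar> * \<bar>r - a\<bar> powr (1 - H)) \<le> ennreal (h powr (1 - H) / Gamma \<alpha>) * ennreal ((t - r) powr (\<alpha> - 1) * indicator {a..t} r)"
          using 4 Gam by (simp add: ennreal_mult[symmetric] ennreal_leI mult.commute)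
        then show ?thesis by (rule add_increasing[rotated]) simp
      qed (use at in \<open>auto simp: K_def\<close>)
    qed
    also have "\<dots> = ennreal (T powr q / Gamma \<alpha>) * (\<integral>\<^sup>+r. F (a + -1 * r) \<partial>lborel)
        + ennreal (h powr (1 - H) / Gamma \<alpha>) * (\<integral>\<^sup>+r. ennreal ((t - r) powr (\<alpha> - 1) * indicator {a..t} r) \<partial>lborel)"
      by (subst nn_integral_add) (auto simp: nn_integral_cmult)
    also have "(\<integral>\<^sup>+r. F (a + -1 * r) \<partial>lborel) = (\<integral>\<^sup>+w. F w \<partial>lborel)"
      using nn_integral_real_affine[of F "-1" a] by simp
    also have "(\<integral>\<^sup>+r. ennreal ((t - r) powr (\<alpha> - 1) * indicator {a..t} r) \<partial>lborel) = ennreal (h powr \<alpha> / \<alpha>)"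
      using powr_reflect_lborel(1)[of \<alpha> a t t] \<alpha> at by (simp add: h_def)
    also have "ennreal (T powr q / Gamma \<alpha>) * (\<integral>\<^sup>+w. F w \<partial>lborel) + ennreal (h powr (1 - H) / Gamma \<alpha>) * ennreal (h powr \<alpha> / \<alpha>)
       \<le> ennreal (T powr q / Gamma \<alpha>) * ennreal (h powr \<beta> * (1 / \<beta> + 1 / (1 - \<beta>))) + ennreal (h powr (1 - H) / Gamma \<alpha>) * ennreal (h powr \<alpha> / \<alpha>)"
      unfolding F_def using \<beta> h by (intro add_right_mono mult_left_mono nn_integral_powr_min_le) auto
    also have "\<dots> = ennreal (T powr q / Gamma \<alpha> * (h powr \<beta> * (1 / \<beta> + 1 / (1 - \<beta>))) + h powr (1 - H) / Gamma \<alpha> * (h powr \<alpha> / \<alpha>))"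
      using \<beta> Gam \<alpha> by (simp add: ennreal_mult[symmetric] ennreal_plus[symmetric] del: ennreal_plus)
    also have "\<dots> \<le> ennreal (C * h powr \<beta>)"
    proof (rule ennreal_leI)
      have "h powr (1 - H) * h powr \<alpha> = h powr q * h powr \<beta>" by (simp add: q_def powr_add[symmetric] algebra_simps)
      also have "\<dots> \<le> T powr q * h powr \<beta>" using h q by (intro mult_right_mono powr_mono2) auto
      finally have "h powr (1 - H) * h powr \<alpha> / (\<alpha> * Gamma \<alpha>) \<le> T powr q * h powr \<beta> / (\<alpha> * Gamma \<alpha>)"
        using \<alpha> Gam by (intro divide_right_mono) auto
      moreover have "C * h powr \<beta> = T powr q / Gamma \<alpha> * (h powr \<beta> * (1 / \<beta> + 1 / (1 - \<beta>))) + T powr q * h powr \<beta> / (\<alpha> * Gamma \<alpha>)"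
        unfolding C_def distrib_right[of _ _ "h powr \<beta>"] by simp
      moreover have "h powr (1 - H) / Gamma \<alpha> * (h powr \<alpha> / \<alpha>) = h powr (1 - H) * h powr \<alpha> / (\<alpha> * Gamma \<alpha>)"
        by simp
      ultimately show "T powr q / Gamma \<alpha> * (h powr \<beta> * (1 / \<beta> + 1 / (1 - \<beta>))) + h powr (1 - H) / Gamma \<alpha> * (h powr \<alpha> / \<alpha>) \<le> C * h powr \<beta>"
        by linarith
    qed
    finally show ?thesis by (simp add: h_def)
  qed
  note main = this
  show ?thesis
  proof (intro exI[of _ C] conjI C allI impI)
    fix a t assume "0 \<le> a \<and> a \<le> t \<and> t \<le> T"
    then show "(\<integral>\<^sup>+r. ennreal (\<bar>K t r - K a r\<bar> * \<bar>r - a\<bar> powr (1 - H)) \<partial>lborel) \<le> ennreal (C * (t - a) powr \<beta>)"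
      using main[of a t] by (cases "a = t") auto
  qed
qed

lemma D_increment_refined:
  "\<exists>C\<ge>0. \<forall>a t. 0 \<le> a \<and> a \<le> t \<and> t \<le> T \<longrightarrow>
     L2_le P (\<lambda>w. D t w - D a w) (C * ((t - a) powr \<beta> + (t powr \<alpha> - a powr \<alpha>)))"
proof -
  obtain Cb where Cb: "0 \<le> Cb" "\<And>t. L2_le P (\<lambda>w. b (y t w)) Cb" using drift_moment by blast
  obtain Cy where Cy: "0 \<le> Cy" "\<And>s t. s \<in> {0..T} \<Longrightarrow> t \<in> {0..T} \<Longrightarrow> L2_le P (\<lambda>w. y t w - y s w) (Cy * \<bar>t - s\<bar> powr (\<alpha> + H - 1))"
    using y_Holder by blast
  obtain Ck where Ck: "0 \<le> Ck" "\<And>a t. 0 \<le> a \<and> a \<le> t \<and> t \<le> T \<Longrightarrow>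
     (\<integral>\<^sup>+r. ennreal (\<bar>K t r - K a r\<bar> * \<bar>r - a\<bar> powr (1 - H)) \<partial>lborel) \<le> ennreal (Ck * (t - a) powr \<beta>)"
    using K_diff_weighted by blast
  define C where "C = L * Cy * Ck + Cb / (\<alpha> * Gamma \<alpha>)"
  have ex: "\<alpha> + H - 1 = 1 - H" using fd by simp
  have "L2_le P (\<lambda>w. D t w - D a w) (C * ((t - a) powr \<beta> + (t powr \<alpha> - a powr \<alpha>)))" if at: "0 \<le> a" "a \<le> t" "t \<le> T" for a t
  proof -
    have pm: "a powr \<alpha> \<le> t powr \<alpha>" using at \<alpha> by (intro powr_mono2) auto
    have 1: "L2_le P (\<lambda>w. \<integral>r. (K t r - K a r) *\<^sub>R (b (y r w) - b (y a w)) \<partial>lborel) (L * Cy * Ck * (t - a) powr \<beta>)"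
    proof (rule L2_le_integral[where \<phi>="\<lambda>r. L * (Cy * \<bar>r - a\<bar> powr (1 - H))"])
      show "sigma_finite_measure P" by unfold_locales
      show "(\<lambda>p. b (y (fst p) (snd p)) - b (y a (snd p))) \<in> borel_measurable (lborel \<Otimes>\<^sub>M P)"
        by (intro borel_measurable_diff measurable_compose[OF y_joint' b_measurable]) measurable
      show "L2_le P (\<lambda>w. b (y r w) - b (y a w)) (L * (Cy * \<bar>r - a\<bar> powr (1 - H)))" if "K t r - K a r \<noteq> 0" for r
      proof (rule L2_le_norm_bound)
        have "r \<in> {0..T}" using that at by (auto simp: K_def split: if_splits)
        then show "L2_le P (\<lambda>w. y r w - y a w) (Cy * \<bar>r - a\<bar> powr (1 - H))"
          using Cy(2)[of a r] at by (simp add: ex)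
      qed (use L in auto)
      have "(\<integral>\<^sup>+r. ennreal (\<bar>K t r - K a r\<bar> * (L * (Cy * \<bar>r - a\<bar> powr (1 - H)))) \<partial>lborel)
         = (\<integral>\<^sup>+r. ennreal (L * Cy) * ennreal (\<bar>K t r - K a r\<bar> * \<bar>r - a\<bar> powr (1 - H)) \<partial>lborel)"
        using L Cy by (intro nn_integral_cong) (simp add: ennreal_mult[symmetric] ac_simps)
      also have "\<dots> = ennreal (L * Cy) * (\<integral>\<^sup>+r. ennreal (\<bar>K t r - K a r\<bar> * \<bar>r - a\<bar> powr (1 - H)) \<partial>lborel)"
        by (rule nn_integral_cmult) measurable
      also have "\<dots> \<le> ennreal (L * Cy) * ennreal (Ck * (t - a) powr \<beta>)"
        using at by (intro mult_left_mono Ck) auto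
      also have "\<dots> = ennreal (L * Cy * Ck * (t - a) powr \<beta>)"
        using L Cy Ck by (simp add: ennreal_mult[symmetric] mult.assoc)
      finally show "(\<integral>\<^sup>+r. ennreal (\<bar>K t r - K a r\<bar> * (L * (Cy * \<bar>r - a\<bar> powr (1 - H)))) \<partial>lborel) \<le> ennreal (L * Cy * Ck * (t - a) powr \<beta>)" .
    qed (use L Cy Ck in auto)
    have 2: "L2_le P (\<lambda>w. ((t powr \<alpha> - a powr \<alpha>) / (\<alpha> * Gamma \<alpha>)) *\<^sub>R b (y a w)) (\<bar>(t powr \<alpha> - a powr \<alpha>) / (\<alpha> * Gamma \<alpha>)\<bar> * Cb)"
      by (intro L2_le_scaleR Cb)
    have "L2_le P (\<lambda>w. D t w - D a w) (L * Cy * Ck * (t - a) powr \<beta> + \<bar>(t powr \<alpha> - a powr \<alpha>) / (\<alpha> * Gamma \<alpha>)\<bar> * Cb)"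
    proof (rule L2_le_cong_AE[OF L2_le_add[OF 1 2]])
      show "AE w in P. D t w - D a w = (\<integral>r. (K t r - K a r) *\<^sub>R (b (y r w) - b (y a w)) \<partial>lborel) + ((t powr \<alpha> - a powr \<alpha>) / (\<alpha> * Gamma \<alpha>)) *\<^sub>R b (y a w)"
      proof (rule AE_I2)
        fix w assume w: "w \<in> space P"
        have ti: "0 \<le> t" using at by simp
        have i1: "integrable lborel (\<lambda>r. (K t r - K a r) *\<^sub>R b (y r w))"
          unfolding scaleR_left_diff_distrib using D_integrable[OF ti w] D_integrable[OF at(1) w] by (rule Bochner_Integration.integrable_diff)
        have i2: "integrable lborel (\<lambda>r. K t r - K a r)" "(\<integral>r. K t r - K a r \<partial>lborel) = (t powr \<alpha> - a powr \<alpha>) / (\<alpha> * Gamma \<alpha>)"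
          using K_integral[OF ti] K_integral[OF at(1)] by (auto simp: diff_divide_distrib)
        have "(\<integral>r. (K t r - K a r) *\<^sub>R (b (y r w) - b (y a w)) \<partial>lborel) = (\<integral>r. (K t r - K a r) *\<^sub>R b (y r w) \<partial>lborel) - (\<integral>r. (K t r - K a r) *\<^sub>R b (y a w) \<partial>lborel)"
          unfolding scaleR_diff_right by (rule Bochner_Integration.integral_diff[OF i1]) (use i2 in auto)
        also have "(\<integral>r. (K t r - K a r) *\<^sub>R b (y a w) \<partial>lborel) = ((t powr \<alpha> - a powr \<alpha>) / (\<alpha> * Gamma \<alpha>)) *\<^sub>R b (y a w)"
          unfolding i2(2)[symmetric] by (rule integral_scaleR_left) (use i2 in auto)
        finally show "D t w - D a w = (\<integral>r. (K t r - K a r) *\<^sub>R (b (y r w) - b (y a w)) \<partial>lborel) + ((t powr \<alpha> - a powr \<alpha>) / (\<alpha> * Gamma \<alpha>)) *\<^sub>R b (y a w)"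
          using D_diff[OF at(1) ti w] by simp
      qed
    qed measurable
    then show ?thesis
    proof (rule L2_le_mono)
      have "\<bar>(t powr \<alpha> - a powr \<alpha>) / (\<alpha> * Gamma \<alpha>)\<bar> * Cb = Cb / (\<alpha> * Gamma \<alpha>) * (t powr \<alpha> - a powr \<alpha>)"
        using pm \<alpha> Gam by simp
      moreover have "0 \<le> L * Cy * Ck * (t powr \<alpha> - a powr \<alpha>)" "0 \<le> Cb / (\<alpha> * Gamma \<alpha>) * (t - a) powr \<beta>"
        using pm L Cy Ck Cb \<alpha> Gam by auto
      ultimately show "L * Cy * Ck * (t - a) powr \<beta> + \<bar>(t powr \<alpha> - a powr \<alpha>) / (\<alpha> * Gamma \<alpha>)\<bar> * Cb \<le> C * ((t - a) powr \<beta> + (t powr \<alpha> - a powr \<alpha>))"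
        unfolding C_def by (simp only: distrib_right distrib_left)
    qed
  qed
  moreover have "0 \<le> C" using L Cy Ck Cb \<alpha> Gam by (simp add: C_def)
  ultimately show ?thesis by blast
qed

lemma drift_residual:
  "\<exists>C\<ge>0. \<forall>k t. 0 < k \<and> 0 \<le> t \<and> t \<le> T \<longrightarrow>
     L2_le P (\<lambda>w. \<integral>s. K t s *\<^sub>R (D s w - D (grid_floor k s) w) \<partial>lborel) (C * k powr \<beta>)"
proof -
  obtain C where C: "0 \<le> C" "\<And>a t. 0 \<le> a \<and> a \<le> t \<and> t \<le> T \<Longrightarrow>
     L2_le P (\<lambda>w. D t w - D a w) (C * ((t - a) powr \<beta> + (t powr \<alpha> - a powr \<alpha>)))"
    using D_increment_refined by blast
  define c1 where "c1 = T powr \<alpha> / (\<alpha> * Gamma \<alpha>)"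
  define c2 where "c2 = Beta \<alpha> (\<alpha> - \<beta> + 1) * T powr (2 * \<alpha> - \<beta>) / Gamma \<alpha>"
  have be: "0 < \<alpha> - \<beta> + 1" "0 \<le> 2 * \<alpha> - \<beta>" using \<beta> fd H \<alpha> by auto
  have Bpos: "0 \<le> Beta \<alpha> (\<alpha> - \<beta> + 1)" using be \<alpha> by (simp add: Beta_def Gamma_real_nonneg)
  have c: "0 \<le> c1" "0 \<le> c2" using \<alpha> Gam Bpos by (auto simp: c1_def c2_def)
  have "L2_le P (\<lambda>w. \<integral>s. K t s *\<^sub>R (D s w - D (grid_floor k s) w) \<partial>lborel) (C * (c1 + c2) * k powr \<beta>)" if k: "0 < k" and t: "0 \<le> t" "t \<le> T" for k t
  proof (rule L2_le_integral[where \<phi>="\<lambda>s. C * (k powr \<beta> + k powr \<beta> * s powr (\<alpha> - \<beta>))"])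
    show "sigma_finite_measure P" by unfold_locales
    show "(\<lambda>p. D (fst p) (snd p) - D (grid_floor k (fst p)) (snd p)) \<in> borel_measurable (lborel \<Otimes>\<^sub>M P)"
      by (intro borel_measurable_diff D_joint') measurable
    show "L2_le P (\<lambda>w. D s w - D (grid_floor k s) w) (C * (k powr \<beta> + k powr \<beta> * s powr (\<alpha> - \<beta>)))" if "K t s \<noteq> 0" for s
    proof -
      have s: "0 \<le> s" "s \<le> T" using that t by (auto simp: K_def split: if_splits)
      note gf = grid_floor_bounds[OF k, of s]
      have "L2_le P (\<lambda>w. D s w - D (grid_floor k s) w) (C * ((s - grid_floor k s) powr \<beta> + (s powr \<alpha> - grid_floor k s powr \<alpha>)))"
        using gf s by (intro C) auto
      then show ?thesis
      proof (rule L2_le_mono)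
        have "(s - grid_floor k s) powr \<beta> \<le> k powr \<beta>" using gf \<beta> by (intro powr_mono2) auto
        moreover have "s powr \<alpha> - grid_floor k s powr \<alpha> \<le> k powr \<beta> * s powr (\<alpha> - \<beta>)"
        proof (cases "s = 0")
          case False
          then show ?thesis using s gf \<alpha> \<beta> by (intro powr_diff_le_interp) auto
        qed simp
        ultimately show "C * ((s - grid_floor k s) powr \<beta> + (s powr \<alpha> - grid_floor k s powr \<alpha>)) \<le> C * (k powr \<beta> + k powr \<beta> * s powr (\<alpha> - \<beta>))"
          using C(1) by (intro mult_left_mono add_mono) auto
      qed
    qed
    have "(\<integral>\<^sup>+s. ennreal (\<bar>K t s\<bar> * (C * (k powr \<beta> + k powr \<beta> * s powr (\<alpha> - \<beta>)))) \<partial>lborel)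
       = (\<integral>\<^sup>+s. ennreal (C * k powr \<beta>) * ennreal (K t s) + ennreal (C * k powr \<beta> / Gamma \<alpha>) * ennreal ((t - s) powr (\<alpha> - 1) * (s - 0) powr (\<alpha> - \<beta> + 1 - 1) * indicator {0..t} s) \<partial>lborel)"
      using C Gam by (intro nn_integral_cong)
        (simp add: ennreal_mult[symmetric] ennreal_plus[symmetric] K_altdef field_simps del: ennreal_plus)
    also have "\<dots> = ennreal (C * k powr \<beta>) * ennreal (t powr \<alpha> / (\<alpha> * Gamma \<alpha>)) + ennreal (C * k powr \<beta> / Gamma \<alpha>) * (\<integral>\<^sup>+s. ennreal ((t - s) powr (\<alpha> - 1) * (s - 0) powr (\<alpha> - \<beta> + 1 - 1) * indicator {0..t} s) \<partial>lborel)"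
      using t by (subst nn_integral_add) (auto simp: nn_integral_cmult K_integral(3))
    also have "\<dots> \<le> ennreal (C * k powr \<beta>) * ennreal c1 + ennreal (C * k powr \<beta> / Gamma \<alpha>) * ennreal (Beta \<alpha> (\<alpha> - \<beta> + 1) * T powr (2 * \<alpha> - \<beta>))"
    proof (intro add_mono mult_left_mono)
      show "ennreal (t powr \<alpha> / (\<alpha> * Gamma \<alpha>)) \<le> ennreal c1"
        unfolding c1_def using t \<alpha> Gam by (intro ennreal_leI divide_right_mono powr_mono2) auto
      show "(\<integral>\<^sup>+s. ennreal ((t - s) powr (\<alpha> - 1) * (s - 0) powr (\<alpha> - \<beta> + 1 - 1) * indicator {0..t} s) \<partial>lborel) \<le> ennreal (Beta \<alpha> (\<alpha> - \<beta> + 1) * T powr (2 * \<alpha> - \<beta>))"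
      proof (cases "t = 0")
        case True
        have "(\<lambda>s. ennreal ((t - s) powr (\<alpha> - 1) * (s - 0) powr (\<alpha> - \<beta> + 1 - 1) * indicator {0..t} s)) = (\<lambda>_. 0)"
          using True by (auto simp: indicator_def)
        then show ?thesis by simp
      next
        case False
        then have "(\<integral>\<^sup>+s. ennreal ((t - s) powr (\<alpha> - 1) * (s - 0) powr (\<alpha> - \<beta> + 1 - 1) * indicator {0..t} s) \<partial>lborel) = ennreal (Beta \<alpha> (\<alpha> - \<beta> + 1) * (t - 0) powr (\<alpha> + (\<alpha> - \<beta> + 1) - 1))"
          using t \<alpha> be by (intro nn_integral_Beta_affine) auto
        also have "\<dots> = ennreal (Beta \<alpha> (\<alpha> - \<beta> + 1) * t powr (2 * \<alpha> - \<beta>))" by (simp add: algebra_simps)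
        also have "\<dots> \<le> ennreal (Beta \<alpha> (\<alpha> - \<beta> + 1) * T powr (2 * \<alpha> - \<beta>))"
          using t be Bpos by (intro ennreal_leI mult_left_mono powr_mono2) auto
        finally show ?thesis .
      qed
    qed auto
    also have "\<dots> = ennreal (C * (c1 + c2) * k powr \<beta>)"
      using C c Bpos Gam by (simp add: ennreal_mult[symmetric] ennreal_plus[symmetric] c2_def field_simps del: ennreal_plus)
    finally show "(\<integral>\<^sup>+s. ennreal (\<bar>K t s\<bar> * (C * (k powr \<beta> + k powr \<beta> * s powr (\<alpha> - \<beta>)))) \<partial>lborel) \<le> ennreal (C * (c1 + c2) * k powr \<beta>)" .
    show "0 \<le> C * (c1 + c2) * k powr \<beta>" using C c by simp
  qed measurable
  moreover have "0 \<le> C * (c1 + c2)" using C c by simp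
  ultimately show ?thesis by blast
qed

end

lemma abs_integral_mult_le:
  fixes f g :: "real \<Rightarrow> real"
  assumes f: "integrable lborel f" "\<And>s. 0 \<le> f s" and g: "\<And>s. f s \<noteq> 0 \<Longrightarrow> \<bar>g s\<bar> \<le> c"
  shows "\<bar>\<integral>s. f s * g s \<partial>lborel\<bar> \<le> c * (\<integral>s. f s \<partial>lborel)"
proof (cases "integrable lborel (\<lambda>s. f s * g s)")
  case True
  have "\<bar>\<integral>s. f s * g s \<partial>lborel\<bar> \<le> (\<integral>s. \<bar>f s * g s\<bar> \<partial>lborel)" by (rule integral_abs_bound)
  also have "\<dots> \<le> (\<integral>s. c * f s \<partial>lborel)"
  proof (rule integral_mono)
    fix s
    show "\<bar>f s * g s\<bar> \<le> c * f s"
      using mult_left_mono[OF g f(2), of s s] f(2)[of s] by (cases "f s = 0") (auto simp: abs_mult mult.commute)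
  qed (use True f in auto)
  finally show ?thesis by simp
next
  case False
  have "0 \<le> c * (\<integral>s. f s \<partial>lborel)"
  proof (cases "\<forall>s. f s = 0")
    case False
    then have "0 \<le> c" using g by (meson abs_ge_zero order_trans)
    then show ?thesis using f(2) by (simp add: integral_nonneg)
  qed simp
  with False show ?thesis by (simp add: not_integrable_integral_eq)
qed

context rl_solution_fd
begin

text \<open>
  The equation holds for each \<open>t\<close> only almost surely, so \<open>G\<close> itself need not be jointly measurable;
  \<open>Gy\<close> is a modification that is.
\<close>

definition Gy :: "real \<Rightarrow> 'a \<Rightarrow> real^'b" where "Gy s w = y s w - x0 w - D s w"

lemma Gy_joint: "(\<lambda>p. Gy (fst p) (snd p)) \<in> borel_measurable (lborel \<Otimes>\<^sub>M P)"
  unfolding Gy_def by (intro borel_measurable_diff y_joint D_joint) measurable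

lemmas Gy_joint' = measurable_joint_compose[of Gy, OF Gy_joint]

lemma Gy_measurable [measurable]: "Gy s \<in> borel_measurable P"
  using Gy_joint'[of "\<lambda>_. s" P "\<lambda>w. w"] by simp

lemma Gy_AE: "s \<in> {0..T} \<Longrightarrow> AE w in P. Gy s w = G s w"
  by (drule y_solution, erule eventually_mono) (simp add: Gy_def)

lemma Gy_incr:
  assumes "s \<in> {0..T}" "t \<in> {0..T}"
  shows "L2_le P (\<lambda>w. Gy t w - Gy s w) (CG * \<bar>t - s\<bar> powr (1 - H))"
    and "(\<integral>w. (norm (Gy t w - Gy s w))\<^sup>2 \<partial>P) = CG\<^sup>2 * \<bar>t - s\<bar> powr \<alpha>"
proof -
  have AE: "AE w in P. Gy t w - Gy s w = G t w - G s w"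
    using Gy_AE[OF assms(1)] Gy_AE[OF assms(2)] by eventually_elim simp
  have "L2_le P (\<lambda>w. G t w - G s w) (CG * \<bar>t - s\<bar> powr (1 - H))"
    using G_incr[OF assms] fd by simp
  then show "L2_le P (\<lambda>w. Gy t w - Gy s w) (CG * \<bar>t - s\<bar> powr (1 - H))"
    by (rule L2_le_cong_AE) (use AE in auto)
  note [measurable] = G_meas[OF assms(1)] G_meas[OF assms(2)]
  have "(\<integral>w. (norm (Gy t w - Gy s w))\<^sup>2 \<partial>P) = (\<integral>w. (norm (G t w - G s w))\<^sup>2 \<partial>P)"
    by (intro integral_cong_AE) (use AE in \<open>auto elim!: eventually_mono\<close>)
  then show "(\<integral>w. (norm (Gy t w - Gy s w))\<^sup>2 \<partial>P) = CG\<^sup>2 * \<bar>t - s\<bar> powr \<alpha>"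
    using G_var[OF assms] by simp
qed

lemma Gy_cov:
  assumes "s \<in> {0..T}" "a \<in> {0..T}" "r \<in> {0..T}" "c \<in> {0..T}"
  shows "(\<integral>w. (Gy s w - Gy a w) \<bullet> (Gy r w - Gy c w) \<partial>P)
     = CG\<^sup>2 / 2 * (\<bar>s - c\<bar> powr \<alpha> + \<bar>a - r\<bar> powr \<alpha> - \<bar>s - r\<bar> powr \<alpha> - \<bar>a - c\<bar> powr \<alpha>)"
proof -
  have pol: "(Gy s w - Gy a w) \<bullet> (Gy r w - Gy c w) = (1/2) * ((norm (Gy s w - Gy c w))\<^sup>2 + (norm (Gy a w - Gy r w))\<^sup>2
      - (norm (Gy s w - Gy r w))\<^sup>2 - (norm (Gy a w - Gy c w))\<^sup>2)" for w
    unfolding power2_norm_eq_inner by (simp add: inner_diff_left inner_diff_right inner_commute algebra_simps)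
  have i: "integrable P (\<lambda>w. (norm (Gy t w - Gy u w))\<^sup>2)" if "t \<in> {0..T}" "u \<in> {0..T}" for t u
    using L2_leD(3)[OF Gy_incr(1)[OF that(2,1)]] .
  show ?thesis
    unfolding pol using i assms by (simp add: Gy_incr(2) algebra_simps)
qed

lemma Gy_corr:
  assumes k: "0 < k" and s: "s \<in> {0..T}" "s \<in> cell k i" and r: "r \<in> {0..T}" "r \<in> cell k j" and ij: "0 < i" "0 < j"
  shows "\<bar>\<integral>w. (Gy s w - Gy (grid_floor k s) w) \<bullet> (Gy r w - Gy (grid_floor k r) w) \<partial>P\<bar>
     \<le> CG\<^sup>2 * k powr \<alpha> * corr_decay \<alpha> (nat_dist i j)"
proof -
  have main: "\<bar>\<integral>w. (Gy s w - Gy (grid_floor k s) w) \<bullet> (Gy r w - Gy (grid_floor k r) w) \<partial>P\<bar>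
     \<le> CG\<^sup>2 * k powr \<alpha> * corr_decay \<alpha> (i - j)"
    if s: "s \<in> {0..T}" "s \<in> cell k i" and r: "r \<in> {0..T}" "r \<in> cell k j" and ij: "0 < j" "j \<le> i" for s r i j
  proof -
    define a where "a = grid_floor k s"
    define c where "c = grid_floor k r"
    have a: "a = real (i - 1) * k" and c: "c = real (j - 1) * k"
      using grid_floor_cell[OF k] s r ij by (auto simp: a_def c_def)
    note gs = grid_floor_bounds[OF k, of s, folded a_def] and gr = grid_floor_bounds[OF k, of r, folded c_def]
    have aT: "a \<in> {0..T}" "c \<in> {0..T}" using gs gr s r by auto
    show ?thesis
    proof (cases "i - j \<le> 1")
      case True
      have "L2_le P (\<lambda>w. Gy s w - Gy a w) (CG * k powr (1 - H))"
        by (rule L2_le_mono[OF Gy_incr(1)[OF aT(1) s(1)]]) (use CG gs H in \<open>auto intro!: mult_left_mono powr_mono2\<close>)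
      moreover have "L2_le P (\<lambda>w. Gy r w - Gy c w) (CG * k powr (1 - H))"
        by (rule L2_le_mono[OF Gy_incr(1)[OF aT(2) r(1)]]) (use CG gr H in \<open>auto intro!: mult_left_mono powr_mono2\<close>)
      ultimately have "\<bar>\<integral>w. (Gy s w - Gy a w) \<bullet> (Gy r w - Gy c w) \<partial>P\<bar> \<le> (CG * k powr (1 - H)) * (CG * k powr (1 - H))"
        by (rule L2_le_inner(2))
      also have "\<dots> = CG\<^sup>2 * (k powr (1 - H) * k powr (1 - H))" by (simp add: power2_eq_square)
      also have "k powr (1 - H) * k powr (1 - H) = k powr \<alpha>" using fd by (simp flip: powr_add)
      finally show ?thesis using True by (simp add: corr_decay_def a_def c_def)
    next
      case False
      define m where "m = i - j"
      have m: "2 \<le> m" using False by (simp add: m_def)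
      have d: "a - c = real m * k" using m ij unfolding a c m_def by (simp add: of_nat_diff algebra_simps)
      define p where "p = s - a"
      define q where "q = r - c"
      have pq: "0 \<le> p" "p \<le> k" "0 \<le> q" "q \<le> k" using gs gr by (auto simp: p_def q_def)
      define \<delta> where "\<delta> = real (m - 1) * k"
      have \<delta>: "0 < \<delta>" "\<delta> \<le> a - c - q" using m k pq d by (auto simp: \<delta>_def of_nat_diff algebra_simps)
      have "(\<integral>w. (Gy s w - Gy a w) \<bullet> (Gy r w - Gy c w) \<partial>P)
         = CG\<^sup>2 / 2 * (\<bar>s - c\<bar> powr \<alpha> + \<bar>a - r\<bar> powr \<alpha> - \<bar>s - r\<bar> powr \<alpha> - \<bar>a - c\<bar> powr \<alpha>)"
        by (rule Gy_cov[OF s(1) aT(1) r(1) aT(2)])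
      also have "\<bar>s - c\<bar> = a - c + p" using \<delta> pq by (simp add: p_def)
      also have "\<bar>a - r\<bar> = a - c - q" using \<delta> pq by (simp add: q_def)
      also have "\<bar>s - r\<bar> = a - c - q + p" using \<delta> pq by (simp add: p_def q_def)
      also have "\<bar>a - c\<bar> = a - c" using \<delta> pq by simp
      also have "(a - c + p) powr \<alpha> + (a - c - q) powr \<alpha> - (a - c - q + p) powr \<alpha> - (a - c) powr \<alpha>
        = ((a - c + p) powr \<alpha> - (a - c) powr \<alpha>) - ((a - c - q + p) powr \<alpha> - (a - c - q) powr \<alpha>)" by simp
      finally have "\<bar>\<integral>w. (Gy s w - Gy a w) \<bullet> (Gy r w - Gy c w) \<partial>P\<bar>
        = CG\<^sup>2 / 2 * \<bar>((a - c + p) powr \<alpha> - (a - c) powr \<alpha>) - ((a - c - q + p) powr \<alpha> - (a - c - q) powr \<alpha>)\<bar>"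
        by (simp only: abs_mult) simp
      also have "\<dots> \<le> CG\<^sup>2 / 2 * (k\<^sup>2 * \<delta> powr (\<alpha> - 2))"
        using \<alpha> pq \<delta> by (intro mult_left_mono powr_second_difference) auto
      also have "\<dots> \<le> CG\<^sup>2 * (k\<^sup>2 * \<delta> powr (\<alpha> - 2))" by (intro mult_right_mono) auto
      also have "k\<^sup>2 * \<delta> powr (\<alpha> - 2) = k powr \<alpha> * real (m - 1) powr (\<alpha> - 2)"
        using k by (simp add: \<delta>_def powr_mult powr_diff)
      finally show ?thesis using m by (simp add: corr_decay_def a_def c_def m_def mult.assoc)
    qed
  qed
  show ?thesis
  proof (cases "j \<le> i")
    case True
    then show ?thesis using main[OF s r ij(2)] by (auto simp: nat_dist_def)
  next
    case False
    then show ?thesis using main[OF r s ij(1)] by (simp add: nat_dist_def inner_commute)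
  qed
qed

lemma K_cell_value:
  assumes k: "0 < k" and i: "i \<in> {1..n}"
  shows "(\<integral>s. indicator (cell k i) s * K (real n * k) s \<partial>lborel) \<le> k powr \<alpha> / (\<alpha> * Gamma \<alpha>) * real (n - i + 1) powr (\<alpha> - 1)"
    and "0 \<le> (\<integral>s. indicator (cell k i) s * K (real n * k) s \<partial>lborel)"
proof -
  define t where "t = real n * k"
  have le: "real (i - 1) * k \<le> real i * k" "real i * k \<le> t" "0 \<le> real (i - 1) * k"
    using i k by (auto simp: t_def intro!: mult_right_mono)
  have "(\<integral>s. indicator (cell k i) s * K t s \<partial>lborel) = (LINT s:cell k i|lborel. (1 / Gamma \<alpha>) * (t - s) powr (\<alpha> - 1))"
    unfolding set_lebesgue_integral_def
  proof (intro Bochner_Integration.integral_cong refl)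
    fix s
    have "0 \<le> s \<and> s \<le> t" if "s \<in> cell k i" using that le unfolding cell_def by auto
    then show "indicator (cell k i) s * K t s = indicator (cell k i) s *\<^sub>R ((1 / Gamma \<alpha>) * (t - s) powr (\<alpha> - 1))"
      by (auto simp: K_def indicator_def)
  qed
  also have "\<dots> = (1 / Gamma \<alpha>) * (LINT s:{real (i - 1) * k..real i * k}|lborel. (t - s) powr (\<alpha> - 1))"
    by (subst set_integral_cell) auto
  also have "\<dots> = (1 / Gamma \<alpha>) * (((t - real (i - 1) * k) powr \<alpha> - (t - real i * k) powr \<alpha>) / \<alpha>)"
    using powr_reflect_lborel(3)[of \<alpha> "real (i - 1) * k" "real i * k" t] \<alpha> le by simp
  also have "\<dots> \<le> (1 / Gamma \<alpha>) * ((k powr 1 * (t - real (i - 1) * k) powr (\<alpha> - 1)) / \<alpha>)"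
    using k i le \<alpha> Gam by (intro mult_left_mono divide_right_mono powr_diff_le_interp) (auto simp: of_nat_diff algebra_simps)
  also have "t - real (i - 1) * k = real (n - i + 1) * k"
    using i by (simp add: t_def of_nat_diff algebra_simps)
  also have "k powr 1 * (real (n - i + 1) * k) powr (\<alpha> - 1) = k powr \<alpha> * real (n - i + 1) powr (\<alpha> - 1)"
    using k by (simp add: powr_mult powr_diff)
  finally show "(\<integral>s. indicator (cell k i) s * K (real n * k) s \<partial>lborel) \<le> k powr \<alpha> / (\<alpha> * Gamma \<alpha>) * real (n - i + 1) powr (\<alpha> - 1)"
    by (simp add: t_def mult.commute)
  show "0 \<le> (\<integral>s. indicator (cell k i) s * K (real n * k) s \<partial>lborel)"
    by (simp add: integral_nonneg)
qed

lemma Gy_path: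
  assumes "0 \<le> t" "t \<le> T" "w \<in> space P" "0 < k"
  shows "integrable lborel (\<lambda>s. K t s *\<^sub>R (Gy s w - Gy (grid_floor k s) w))"
proof -
  obtain m where m: "\<And>s. norm (y s w) \<le> m" using y_bounded[OF assms(3)] by blast
  obtain m' where m': "0 \<le> m'" "\<And>s. norm (b (y s w)) \<le> m'" using drift_bounded[OF assms(3)] by blast
  have D_bd: "norm (D s w) \<le> m' * (T powr \<alpha> / (\<alpha> * Gamma \<alpha>))" if "0 \<le> s" "s \<le> T" for s
  proof -
    have "norm (D s w) \<le> (\<integral>r. norm (K s r *\<^sub>R b (y r w)) \<partial>lborel)" unfolding D_def by (rule integral_norm_bound)
    also have "\<dots> \<le> (\<integral>r. m' * K s r \<partial>lborel)"
      using D_integrable[OF that(1) assms(3)] K_integral(1)[OF that(1)] m'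
      by (intro integral_mono integrable_norm) (auto simp: mult.commute[of m'] intro!: mult_left_mono)
    also have "\<dots> = m' * (s powr \<alpha> / (\<alpha> * Gamma \<alpha>))" using K_integral(2)[OF that(1)] by simp
    also have "\<dots> \<le> m' * (T powr \<alpha> / (\<alpha> * Gamma \<alpha>))"
      using that m' \<alpha> Gam by (intro mult_left_mono divide_right_mono powr_mono2) auto
    finally show ?thesis .
  qed
  define M where "M = m + norm (x0 w) + m' * (T powr \<alpha> / (\<alpha> * Gamma \<alpha>))"
  have G_bd: "norm (Gy s w) \<le> M" if "0 \<le> s" "s \<le> T" for s
  proof -
    have "norm (Gy s w) \<le> norm (y s w) + norm (x0 w) + norm (D s w)"
      unfolding Gy_def by (meson add_right_mono norm_triangle_ineq4 order_trans)
    then show ?thesis using m[of s] D_bd[OF that] by (simp add: M_def)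
  qed
  have M: "0 \<le> M" using G_bd[of 0] T norm_ge_zero by (meson less_imp_le order_refl order_trans)
  define f where "f = (\<lambda>s. indicator {0..T} s *\<^sub>R (Gy s w - Gy (grid_floor k s) w))"
  have "(\<lambda>s. Gy s w) \<in> borel_measurable borel" "(\<lambda>s. Gy (grid_floor k s) w) \<in> borel_measurable borel"
    using Gy_joint'[of "\<lambda>s. s" lborel "\<lambda>_. w"] Gy_joint'[of "grid_floor k" lborel "\<lambda>_. w"] assms(3) by auto
  then have fm: "f \<in> borel_measurable borel" unfolding f_def by measurable
  have "norm (f s) \<le> 2 * M" for s
  proof (cases "s \<in> {0..T}")
    case True
    note gf = grid_floor_bounds[OF assms(4), of s]
    have "norm (Gy s w - Gy (grid_floor k s) w) \<le> norm (Gy s w) + norm (Gy (grid_floor k s) w)" by (rule norm_triangle_ineq4)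
    also have "\<dots> \<le> M + M" using gf True by (intro add_mono G_bd) auto
    finally show ?thesis using True by (simp add: f_def)
  qed (use M in \<open>simp add: f_def\<close>)
  from integrable_K_bounded[OF assms(1) fm this]
  have "integrable lborel (\<lambda>s. K t s *\<^sub>R f s)" .
  moreover have "K t s *\<^sub>R f s = K t s *\<^sub>R (Gy s w - Gy (grid_floor k s) w)" for s
    using assms by (auto simp: f_def K_def indicator_def)
  ultimately show ?thesis by simp
qed

lemma noise_residual:
  "\<exists>C\<ge>0. \<forall>(N::nat) n. 0 < N \<and> n \<le> N \<longrightarrow>
     L2_le P (\<lambda>w. \<integral>s. K (real n * (T / real N)) s *\<^sub>R (Gy s w - Gy (grid_floor (T / real N) s) w) \<partial>lborel)
       (C * sqrt ((T / real N) powr (3 * \<alpha>) * (\<Sum>l\<in>{1..N}. real l powr (2 * \<alpha> - 2))))"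
proof -
  define S where "S = 2 * suminf (corr_decay \<alpha>)"
  have S: "0 \<le> S" using corr_decay_summable[OF \<alpha>(2)] by (simp add: S_def suminf_nonneg)
  define C where "C = CG * sqrt S / (\<alpha> * Gamma \<alpha>)"
  have C: "0 \<le> C" using CG S \<alpha> Gam by (simp add: C_def)
  have "L2_le P (\<lambda>w. \<integral>s. K (real n * (T / real N)) s *\<^sub>R (Gy s w - Gy (grid_floor (T / real N) s) w) \<partial>lborel)
       (C * sqrt ((T / real N) powr (3 * \<alpha>) * (\<Sum>l\<in>{1..N}. real l powr (2 * \<alpha> - 2))))" if N: "0 < N" and n: "n \<le> N" for N n :: nat
  proof -
    define k where "k = T / real N"
    have k: "0 < k" using T N by (simp add: k_def)
    define t where "t = real n * k"
    have t: "0 \<le> t" "t \<le> T" using n T N by (auto simp: t_def k_def field_simps intro!: mult_left_mono)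
    define Z where "Z = (\<lambda>s w. Gy s w - Gy (grid_floor k s) w)"
    define f where "f = (\<lambda>i s. indicator (cell k i) s * K t s)"
    define \<xi> where "\<xi> = (\<lambda>i w. \<integral>s. f i s *\<^sub>R Z s w \<partial>lborel)"
    define \<kappa> where "\<kappa> = (\<lambda>i. \<integral>s. f i s \<partial>lborel)"
    have sf: "sigma_finite_measure P" by unfold_locales
    have Zj: "(\<lambda>p. Z (fst p) (snd p)) \<in> borel_measurable (lborel \<Otimes>\<^sub>M P)"
      unfolding Z_def by (intro borel_measurable_diff Gy_joint') measurable
    have fi: "integrable lborel (f i)" "\<And>s. 0 \<le> f i s" for i
      unfolding f_def using K_cell_integrable[OF t(1)] by auto
    have [measurable]: "f i \<in> borel_measurable borel" for i using fi(1)[of i] by auto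
    have fs: "s \<in> {0..T} \<and> s \<in> cell k i" if "f i s \<noteq> 0" for i s
      using that t by (auto simp: f_def K_def indicator_def split: if_splits)
    have Z2: "L2_le P (Z s) (CG * k powr (1 - H))" if "s \<in> {0..T}" for s
    proof -
      note gf = grid_floor_bounds[OF k, of s]
      have g: "grid_floor k s \<in> {0..T}" using gf that by auto
      show ?thesis unfolding Z_def
        by (rule L2_le_mono[OF Gy_incr(1)[OF g that]]) (use CG gf H in \<open>auto intro!: mult_left_mono powr_mono2\<close>)
    qed
    have path: "integrable lborel (\<lambda>s. f i s *\<^sub>R Z s w)" if "w \<in> space P" for i w
      using integrable_mult_indicator[of "cell k i" lborel, OF _ Gy_path[OF t that k]] unfolding f_def Z_def
      by simp
    have \<kappa>0: "0 \<le> \<kappa> i" for i unfolding \<kappa>_def using fi by (simp add: integral_nonneg)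
    have \<xi>2: "L2_le P (\<xi> i) (\<kappa> i * (CG * k powr (1 - H)))" for i
      unfolding \<xi>_def
    proof (rule L2_le_integral[OF sf Zj, where \<phi>="\<lambda>_. CG * k powr (1 - H)"])
      show "L2_le P (Z s) (CG * k powr (1 - H))" if "f i s \<noteq> 0" for s using Z2 fs[OF that] by blast
      have "(\<integral>\<^sup>+s. ennreal (\<bar>f i s\<bar> * (CG * k powr (1 - H))) \<partial>lborel) = (\<integral>\<^sup>+s. ennreal (f i s) \<partial>lborel) * ennreal (CG * k powr (1 - H))"
        using CG fi by (simp add: ennreal_mult'' nn_integral_multc)
      also have "\<dots> = ennreal (\<kappa> i * (CG * k powr (1 - H)))"
        unfolding \<kappa>_def using fi CG by (simp add: nn_integral_eq_integral ennreal_mult'')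
      finally show "(\<integral>\<^sup>+s. ennreal (\<bar>f i s\<bar> * (CG * k powr (1 - H))) \<partial>lborel) \<le> ennreal (\<kappa> i * (CG * k powr (1 - H)))" by simp
      show "0 \<le> \<kappa> i * (CG * k powr (1 - H))" using \<kappa>0 CG by simp
    qed auto
    have cov: "\<bar>\<integral>w. \<xi> i w \<bullet> \<xi> j w \<partial>P\<bar> \<le> CG\<^sup>2 * k powr \<alpha> * (\<kappa> i * \<kappa> j * corr_decay \<alpha> (nat_dist i j))" if ij: "i \<in> {1..n}" "j \<in> {1..n}" for i j
    proof -
      define q where "q = CG\<^sup>2 * k powr \<alpha> * corr_decay \<alpha> (nat_dist i j)"
      have i0: "0 < i" "0 < j" using ij by auto
      have \<xi>j: "\<xi> j = (\<lambda>w. \<integral>s. f j s *\<^sub>R Z s w \<partial>lborel)" by (simp add: \<xi>_def)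
      have "(\<integral>w. \<xi> i w \<bullet> \<xi> j w \<partial>P) = (\<integral>w. \<xi> i w \<bullet> (\<integral>s. f j s *\<^sub>R Z s w \<partial>lborel) \<partial>P)"
        unfolding \<xi>j ..
      also have "\<dots> = (\<integral>s. f j s * (\<integral>w. \<xi> i w \<bullet> Z s w \<partial>P) \<partial>lborel)"
        by (rule expectation_inner_integral[OF sf \<xi>2 Zj, where C="CG * k powr (1 - H)"]) (use Z2 fs CG fi path in auto)
      also have "\<bar>\<dots>\<bar> \<le> (q * \<kappa> i) * (\<integral>s. f j s \<partial>lborel)"
      proof (rule abs_integral_mult_le[OF fi])
        fix s assume s: "f j s \<noteq> 0"
        have "(\<integral>w. \<xi> i w \<bullet> Z s w \<partial>P) = (\<integral>w. Z s w \<bullet> \<xi> i w \<partial>P)" by (simp add: inner_commute)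
        also have "\<dots> = (\<integral>r. f i r * (\<integral>w. Z s w \<bullet> Z r w \<partial>P) \<partial>lborel)"
          unfolding \<xi>_def
          by (rule expectation_inner_integral[OF sf Z2 Zj, where C="CG * k powr (1 - H)"]) (use Z2 fs[OF s] fs CG fi path in auto)
        also have "\<bar>\<dots>\<bar> \<le> q * (\<integral>r. f i r \<partial>lborel)"
        proof (rule abs_integral_mult_le[OF fi])
          fix r assume r: "f i r \<noteq> 0"
          show "\<bar>\<integral>w. Z s w \<bullet> Z r w \<partial>P\<bar> \<le> q"
            using Gy_corr[OF k, of r i s j] fs[OF s] fs[OF r] i0
            by (simp add: Z_def q_def inner_commute)
        qed
        finally show "\<bar>\<integral>w. \<xi> i w \<bullet> Z s w \<partial>P\<bar> \<le> q * \<kappa> i" by (simp add: \<kappa>_def)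
      qed
      finally show ?thesis by (simp add: q_def \<kappa>_def mult.assoc mult.left_commute mult.commute)
    qed
    define R where "R = (\<lambda>w. \<Sum>i\<in>{1..n}. \<xi> i w)"
    have Req: "(\<integral>s. K t s *\<^sub>R Z s w \<partial>lborel) = R w" if w: "w \<in> space P" for w
    proof -
      have "K t s *\<^sub>R Z s w = (\<Sum>i\<in>{1..n}. f i s *\<^sub>R Z s w)" for s
      proof -
        have "(\<Sum>i\<in>{1..n}. f i s *\<^sub>R Z s w) = ((\<Sum>i\<in>{1..n}. indicator (cell k i) s) * K t s) *\<^sub>R Z s w"
          by (simp only: f_def scaleR_sum_left sum_distrib_right)
        also have "(\<Sum>i\<in>{1..n}. indicator (cell k i) s) * K t s = K t s"
          unfolding sum_indicator_cell[OF k] by (auto simp: indicator_def K_def t_def)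
        finally show ?thesis by simp
      qed
      then show ?thesis unfolding R_def \<xi>_def using path[OF w] by (simp add: Bochner_Integration.integral_sum)
    qed
    have R2: "L2_le P R (\<Sum>i\<in>{1..n}. \<kappa> i * (CG * k powr (1 - H)))"
      unfolding R_def by (intro L2_le_sum \<xi>2) auto
    have ii: "integrable P (\<lambda>w. \<xi> i w \<bullet> \<xi> j w)" for i j by (rule L2_le_inner(1)[OF \<xi>2 \<xi>2])
    have "(\<integral>w. (norm (R w))\<^sup>2 \<partial>P) = (\<Sum>i\<in>{1..n}. \<Sum>j\<in>{1..n}. \<integral>w. \<xi> i w \<bullet> \<xi> j w \<partial>P)"
      unfolding power2_norm_eq_inner R_def inner_sum_left inner_sum_right
      using ii by (simp add: Bochner_Integration.integral_sum) (rule sum.swap)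
    also have "\<dots> \<le> (\<Sum>i\<in>{1..n}. \<Sum>j\<in>{1..n}. CG\<^sup>2 * k powr \<alpha> * (\<kappa> i * \<kappa> j * corr_decay \<alpha> (nat_dist i j)))"
      using cov by (intro sum_mono) (meson abs_le_D1)
    also have "\<dots> = CG\<^sup>2 * k powr \<alpha> * (\<Sum>i\<in>{1..n}. \<Sum>j\<in>{1..n}. \<kappa> i * \<kappa> j * corr_decay \<alpha> (nat_dist i j))"
      by (simp add: sum_distrib_left)
    also have "\<dots> \<le> CG\<^sup>2 * k powr \<alpha> * (S * (\<Sum>i\<in>{1..n}. (\<kappa> i)\<^sup>2))"
      unfolding S_def using \<alpha> by (intro mult_left_mono schur_bound corr_decay_row_sum) (auto simp: nat_dist_def)
    also have "\<dots> \<le> CG\<^sup>2 * k powr \<alpha> * (S * ((k powr \<alpha> / (\<alpha> * Gamma \<alpha>))\<^sup>2 * (\<Sum>l\<in>{1..N}. real l powr (2 * \<alpha> - 2))))"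
    proof (intro mult_left_mono S)
      have "(\<Sum>i\<in>{1..n}. (\<kappa> i)\<^sup>2) \<le> (\<Sum>i\<in>{1..n}. (k powr \<alpha> / (\<alpha> * Gamma \<alpha>))\<^sup>2 * real (n - i + 1) powr (2 * \<alpha> - 2))"
      proof (rule sum_mono)
        fix i assume i: "i \<in> {1..n}"
        have "(\<kappa> i)\<^sup>2 \<le> (k powr \<alpha> / (\<alpha> * Gamma \<alpha>) * real (n - i + 1) powr (\<alpha> - 1))\<^sup>2"
          unfolding \<kappa>_def f_def t_def using K_cell_value[OF k i] by (intro power_mono) auto
        also have "\<dots> = (k powr \<alpha> / (\<alpha> * Gamma \<alpha>))\<^sup>2 * (real (n - i + 1) powr (\<alpha> - 1))\<^sup>2"
          by (rule power_mult_distrib)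
        also have "(real (n - i + 1) powr (\<alpha> - 1))\<^sup>2 = real (n - i + 1) powr (2 * \<alpha> - 2)"
          by (simp add: power2_eq_square powr_add[symmetric])
        finally show "(\<kappa> i)\<^sup>2 \<le> (k powr \<alpha> / (\<alpha> * Gamma \<alpha>))\<^sup>2 * real (n - i + 1) powr (2 * \<alpha> - 2)" .
      qed
      also have "\<dots> = (k powr \<alpha> / (\<alpha> * Gamma \<alpha>))\<^sup>2 * (\<Sum>i\<in>{1..n}. real (n - i + 1) powr (2 * \<alpha> - 2))"
        by (simp add: sum_distrib_left)
      also have "(\<Sum>i\<in>{1..n}. real (n - i + 1) powr (2 * \<alpha> - 2)) = (\<Sum>l\<in>{1..n}. real l powr (2 * \<alpha> - 2))"
        by (rule sum.reindex_bij_witness[of _ "\<lambda>l. n - l + 1" "\<lambda>i. n - i + 1"]) auto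
      also have "(k powr \<alpha> / (\<alpha> * Gamma \<alpha>))\<^sup>2 * \<dots> \<le> (k powr \<alpha> / (\<alpha> * Gamma \<alpha>))\<^sup>2 * (\<Sum>l\<in>{1..N}. real l powr (2 * \<alpha> - 2))"
        using n by (intro mult_left_mono sum_mono2) auto
      finally show "(\<Sum>i\<in>{1..n}. (\<kappa> i)\<^sup>2) \<le> (k powr \<alpha> / (\<alpha> * Gamma \<alpha>))\<^sup>2 * (\<Sum>l\<in>{1..N}. real l powr (2 * \<alpha> - 2))" .
    qed auto
    also have "\<dots> = (C * sqrt (k powr (3 * \<alpha>) * (\<Sum>l\<in>{1..N}. real l powr (2 * \<alpha> - 2))))\<^sup>2"
    proof -
      have "k powr \<alpha> * (k powr \<alpha>)\<^sup>2 = k powr (3 * \<alpha>)" by (simp add: power2_eq_square powr_add[symmetric])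
      moreover have "(sqrt S)\<^sup>2 = S" "0 \<le> (\<Sum>l\<in>{1..N}. real l powr (2 * \<alpha> - 2))" using S by (auto simp: sum_nonneg)
      ultimately show ?thesis
        by (simp add: C_def power_mult_distrib power_divide real_sqrt_pow2 del: power_mult_distrib) (simp add: power_mult_distrib power_divide ac_simps)
    qed
    finally have "(\<integral>w. (norm (R w))\<^sup>2 \<partial>P) \<le> (C * sqrt (k powr (3 * \<alpha>) * (\<Sum>l\<in>{1..N}. real l powr (2 * \<alpha> - 2))))\<^sup>2" .
    then have "L2_le P R (C * sqrt (k powr (3 * \<alpha>) * (\<Sum>l\<in>{1..N}. real l powr (2 * \<alpha> - 2))))"
      using L2_leD(1,3)[OF R2] C by (intro L2_leI) (auto simp: sum_nonneg)
    then have "L2_le P (\<lambda>w. \<integral>s. K t s *\<^sub>R Z s w \<partial>lborel) (C * sqrt (k powr (3 * \<alpha>) * (\<Sum>l\<in>{1..N}. real l powr (2 * \<alpha> - 2))))"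
    proof (rule L2_le_cong_AE)
      show "(\<lambda>w. \<integral>s. K t s *\<^sub>R Z s w \<partial>lborel) \<in> borel_measurable P"
        using L2_leD(1)[OF R2] by (rule measurable_cong[THEN iffD1, rotated]) (use Req in auto)
      show "AE w in P. (\<integral>s. K t s *\<^sub>R Z s w \<partial>lborel) = R w" by (intro AE_I2 Req)
    qed
    then show ?thesis by (simp add: t_def k_def Z_def)
  qed
  with C show ?thesis by blast
qed

lemma b_linear: "linear b"
  unfolding lin by (rule matrix_vector_mul_linear)

lemma residual_fd:
  "\<exists>C\<ge>0. \<forall>(N::nat) n. 0 < N \<and> n \<le> N \<longrightarrow> L2_le P (residual (T / real N) n)
      (C * ((T / real N) powr \<beta> + sqrt ((T / real N) powr (3 * \<alpha>) * (\<Sum>l\<in>{1..N}. real l powr (2 * \<alpha> - 2)))))"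
proof -
  obtain C1 where C1: "0 \<le> C1" "\<And>k t. 0 < k \<and> 0 \<le> t \<and> t \<le> T \<Longrightarrow>
     L2_le P (\<lambda>w. \<integral>s. K t s *\<^sub>R (D s w - D (grid_floor k s) w) \<partial>lborel) (C1 * k powr \<beta>)"
    using drift_residual by blast
  obtain C2 where C2: "0 \<le> C2" "\<And>(N::nat) n. 0 < N \<and> n \<le> N \<Longrightarrow>
     L2_le P (\<lambda>w. \<integral>s. K (real n * (T / real N)) s *\<^sub>R (Gy s w - Gy (grid_floor (T / real N) s) w) \<partial>lborel)
       (C2 * sqrt ((T / real N) powr (3 * \<alpha>) * (\<Sum>l\<in>{1..N}. real l powr (2 * \<alpha> - 2))))"
    using noise_residual by blast
  obtain C3 where C3: "\<And>(N::nat) n. 0 < N \<Longrightarrow> n \<le> N \<Longrightarrow> L2_le P (residual (T / real N) n) (C3 * (T / real N) powr (\<alpha> + H - 1))"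
    using residual_le by blast
  have "L2_le P (residual (T / real N) n) (L * (C1 + C2) *
      ((T / real N) powr \<beta> + sqrt ((T / real N) powr (3 * \<alpha>) * (\<Sum>l\<in>{1..N}. real l powr (2 * \<alpha> - 2)))))"
    if N: "0 < N" and n: "n \<le> N" for N n :: nat
  proof -
    define k where "k = T / real N"
    define t where "t = real n * k"
    define S where "S = sqrt (k powr (3 * \<alpha>) * (\<Sum>l\<in>{1..N}. real l powr (2 * \<alpha> - 2)))"
    have S: "0 \<le> S" by (simp add: S_def sum_nonneg)
    have k: "0 < k" using T N by (simp add: k_def)
    have t: "0 \<le> t" "t \<le> T" using n T N by (auto simp: t_def k_def field_simps intro!: mult_left_mono)
    define r1 where "r1 = (\<lambda>w. \<integral>s. K t s *\<^sub>R (D s w - D (grid_floor k s) w) \<partial>lborel)"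
    define r2 where "r2 = (\<lambda>w. \<integral>s. K t s *\<^sub>R (Gy s w - Gy (grid_floor k s) w) \<partial>lborel)"
    have r: "L2_le P (\<lambda>w. r1 w + r2 w) (C1 * k powr \<beta> + C2 * S)"
      unfolding r1_def r2_def S_def using C1(2) C2(2)[of N n] k t N n
      by (intro L2_le_add) (auto simp: t_def k_def)
    have eq: "residual k n w = b (- (r1 w + r2 w))" if w: "w \<in> space P" for w
    proof -
      obtain m where m: "\<And>s. norm (y s w) \<le> m" using y_bounded[OF w] by blast
      have ym: "(\<lambda>s. y s w - y (grid_floor k s) w) \<in> borel_measurable borel"
        using w by (intro borel_measurable_diff y_path measurable_compose[OF grid_floor_measurable y_path])
      have "norm (y s w - y (grid_floor k s) w) \<le> m + m" for s
        by (rule order_trans[OF norm_triangle_ineq4 add_mono[OF m m]])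
      from integrable_K_bounded[OF t(1) ym this]
      have iy: "integrable lborel (\<lambda>s. K t s *\<^sub>R (y s w - y (grid_floor k s) w))" .
      note iG = Gy_path[OF t w k]
      have "K t s *\<^sub>R (D s w - D (grid_floor k s) w) = K t s *\<^sub>R (y s w - y (grid_floor k s) w) - K t s *\<^sub>R (Gy s w - Gy (grid_floor k s) w)" for s
        by (simp add: Gy_def algebra_simps)
      then have "r1 w + r2 w = (\<integral>s. K t s *\<^sub>R (y s w - y (grid_floor k s) w) \<partial>lborel)"
        unfolding r1_def r2_def using iy iG by simp
      moreover have "residual k n w = (\<integral>s. b (- (K t s *\<^sub>R (y s w - y (grid_floor k s) w))) \<partial>lborel)"
        unfolding residual_def t_def[symmetric]
        by (simp add: linear_neg[OF b_linear] linear_scale[OF b_linear] linear_diff[OF b_linear] scaleR_diff_right)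
      moreover have "\<dots> = b (\<integral>s. - (K t s *\<^sub>R (y s w - y (grid_floor k s) w)) \<partial>lborel)"
        by (rule integral_bounded_linear[OF linear_conv_bounded_linear[THEN iffD1, OF b_linear]]) (use iy in simp)
      ultimately show ?thesis using iy by simp
    qed
    have b0: "b 0 = 0" using b_linear by (rule linear_0)
    have "L2_le P (residual k n) (L * (C1 * k powr \<beta> + C2 * S))"
    proof (rule L2_le_norm_bound[OF r])
      show "residual k n \<in> borel_measurable P" using L2_leD(1)[OF C3[OF N n]] by (simp add: k_def)
      show "AE w in P. norm (residual k n w) \<le> L * norm (r1 w + r2 w)"
      proof (rule AE_I2)
        fix w assume w: "w \<in> space P"
        show "norm (residual k n w) \<le> L * norm (r1 w + r2 w)"
          using b_bound[of "- (r1 w + r2 w)"] unfolding eq[OF w] b0 norm_minus_cancel by simp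
      qed
    qed (use L in simp)
    then show ?thesis unfolding k_def[symmetric] S_def[symmetric]
    proof (rule L2_le_mono)
      have "C1 * k powr \<beta> + C2 * S \<le> (C1 + C2) * (k powr \<beta> + S)"
        using C1 C2 S by (simp add: algebra_simps)
      then show "L * (C1 * k powr \<beta> + C2 * S) \<le> L * (C1 + C2) * (k powr \<beta> + S)"
        using L(1) by (simp add: mult.assoc mult_left_mono)
    qed
  qed
  then show ?thesis using L C1 C2 by (intro exI[of _ "L * (C1 + C2)"]) auto
qed

end

definition fd_rate :: "real \<Rightarrow> real \<Rightarrow> real" where
  "fd_rate H k = (if 3/4 < H then k powr (3 - 3 * H)
     else if H = 3/4 then sqrt \<bar>ln k\<bar> * k powr (3/4) else k powr (3/2 - H))"

lemma fd_rate_bound: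
  fixes T \<alpha> H :: real
  assumes T: "0 < T" and H: "1/2 < H" "H < 1" and \<alpha>: "\<alpha> = 2 - 2*H"
  shows "\<exists>C\<ge>0. \<forall>N::nat. 0 < N \<and> T / real N < 1 \<longrightarrow>
    (T / real N) powr (min (3/2 - H) (3 - 3*H))
      + sqrt ((T / real N) powr (3 * \<alpha>) * (\<Sum>l\<in>{1..N}. real l powr (2 * \<alpha> - 2))) \<le> C * fd_rate H (T / real N)"
proof -
  consider "3/4 < H" | "H = 3/4" | "H < 3/4" by linarith
  then show ?thesis
  proof cases
    case 1
    have s: "summable (\<lambda>l. real l powr (2 * \<alpha> - 2))"
      using 1 \<alpha> by (subst summable_real_powr_iff) auto
    define Z where "Z = (\<Sum>l. real l powr (2 * \<alpha> - 2))"
    have Z: "0 \<le> Z" unfolding Z_def by (intro suminf_nonneg s) auto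
    have "k powr (3 * \<alpha>) * (\<Sum>l\<in>{1..N}. real l powr (2 * \<alpha> - 2)) \<le> Z * (k powr (3 - 3*H))\<^sup>2" for N :: nat and k
    proof -
      have "(\<Sum>l\<in>{1..N}. real l powr (2 * \<alpha> - 2)) \<le> Z" unfolding Z_def by (intro sum_le_suminf s) auto
      then have "k powr (3 * \<alpha>) * (\<Sum>l\<in>{1..N}. real l powr (2 * \<alpha> - 2)) \<le> k powr (3 * \<alpha>) * Z" by (intro mult_left_mono) auto
      moreover have "k powr (3 * \<alpha>) = (k powr (3 - 3*H))\<^sup>2" using \<alpha> by (simp add: power2_eq_square powr_add[symmetric])
      ultimately show ?thesis by (simp only: mult.commute[of Z])
    qed
    then have "sqrt (k powr (3 * \<alpha>) * (\<Sum>l\<in>{1..N}. real l powr (2 * \<alpha> - 2))) \<le> sqrt Z * k powr (3 - 3*H)" for N :: nat and k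
      by (metis abs_of_nonneg powr_ge_zero real_sqrt_abs real_sqrt_le_mono real_sqrt_mult)
    then show ?thesis using 1 Z
      by (intro exI[of _ "1 + sqrt Z"]) (auto simp: fd_rate_def min_def distrib_right)
  next
    case 2
    define N0 where "N0 = nat \<lfloor>T\<rfloor> + 1"
    have N0: "T < real N0" "0 < N0" using T unfolding N0_def by linarith+
    define c0 where "c0 = - ln (T / real N0)"
    have c0: "0 < c0" unfolding c0_def using T N0 by (simp add: ln_less_zero)
    define C where "C = (1 + \<bar>ln T\<bar>) / c0 + 1"
    have C: "0 \<le> C" using c0 by (simp add: C_def)
    \<comment> \<open>As \<open>N > T\<close> is an integer, \<open>k \<le> T / N0 < 1\<close>, which keeps \<open>|ln k|\<close> away from \<open>0\<close>.\<close>
    have main: "k powr (3/4) + sqrt (k powr (3/2) * (\<Sum>l\<in>{1..N}. real l powr (-1))) \<le> (1 / sqrt c0 + sqrt C) * (sqrt \<bar>ln k\<bar> * k powr (3/4))"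
      if N: "0 < N" "T / real N < 1" and k: "k = T / real N" for N :: nat and k
    proof -
      have "T < real N" using N by (simp add: field_simps)
      then have "N0 \<le> N" using T unfolding N0_def by linarith
      then have "k \<le> T / real N0" unfolding k using T N N0 by (intro divide_left_mono) auto
      moreover have k0: "0 < k" using T N by (simp add: k)
      ultimately have "ln k \<le> ln (T / real N0)" by (intro ln_mono) auto
      then have lk: "c0 \<le> \<bar>ln k\<bar>" using c0 by (simp add: c0_def)
      have "1 \<le> sqrt \<bar>ln k\<bar> / sqrt c0" using lk c0 by simp
      then have 1: "k powr (3/4) \<le> 1 / sqrt c0 * (sqrt \<bar>ln k\<bar> * k powr (3/4))"
        using mult_right_mono[of 1 "sqrt \<bar>ln k\<bar> / sqrt c0" "k powr (3/4)"] by simp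
      have "ln (real N) = ln T - ln k" using T N by (simp add: k ln_div)
      then have "1 + ln (real N) \<le> 1 + \<bar>ln T\<bar> + \<bar>ln k\<bar>" by linarith
      also have "\<dots> \<le> (1 + \<bar>ln T\<bar>) * (\<bar>ln k\<bar> / c0) + \<bar>ln k\<bar>"
        using lk c0 mult_left_mono[of 1 "\<bar>ln k\<bar> / c0" "1 + \<bar>ln T\<bar>"] by simp
      also have "\<dots> = C * \<bar>ln k\<bar>" using c0 by (simp add: C_def field_simps)
      finally have "(\<Sum>l\<in>{1..N}. real l powr (-1)) \<le> C * \<bar>ln k\<bar>" using sum_inverse_le_ln[OF N(1)] by linarith
      then have "k powr (3/2) * (\<Sum>l\<in>{1..N}. real l powr (-1)) \<le> k powr (3/2) * (C * \<bar>ln k\<bar>)" by (intro mult_left_mono) auto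
      then have "sqrt (k powr (3/2) * (\<Sum>l\<in>{1..N}. real l powr (-1))) \<le> sqrt (k powr (3/2) * (C * \<bar>ln k\<bar>))" by simp
      also have "\<dots> = sqrt (k powr (3/2)) * (sqrt C * sqrt \<bar>ln k\<bar>)" by (simp only: real_sqrt_mult)
      also have "sqrt (k powr (3/2)) = k powr (3/4)"
      proof -
        have "k powr (3/2) = (k powr (3/4))\<^sup>2" by (simp add: power2_eq_square powr_add[symmetric])
        then show ?thesis by simp
      qed
      finally have 2: "sqrt (k powr (3/2) * (\<Sum>l\<in>{1..N}. real l powr (-1))) \<le> sqrt C * (sqrt \<bar>ln k\<bar> * k powr (3/4))"
        by (simp only: ac_simps)
      show ?thesis using 1 2 by (simp add: distrib_right)
    qed
    have e: "2 * \<alpha> - 2 = -1" "3 * \<alpha> = 3/2" "min (3/2 - H) (3 - 3*H) = 3/4" using 2 \<alpha> by auto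
    have rate: "fd_rate H k = sqrt \<bar>ln k\<bar> * k powr (3/4)" for k using 2 by (simp add: fd_rate_def)
    have "0 \<le> 1 / sqrt c0 + sqrt C" using C c0 by simp
    with main show ?thesis unfolding e rate by blast
  next
    case 3
    define p where "p = 3 - 4*H"
    have p: "0 < p" "p \<le> 1" "2 * \<alpha> - 2 = p - 1" using 3 H \<alpha> by (auto simp: p_def)
    define Z where "Z = T powr p / p"
    have Z: "0 \<le> Z" using p by (simp add: Z_def)
    have "sqrt (k powr (3 * \<alpha>) * (\<Sum>l\<in>{1..N}. real l powr (2 * \<alpha> - 2))) \<le> sqrt Z * k powr (3/2 - H)"
      if N: "0 < N" and k: "k = T / real N" for N :: nat and k
    proof -
      have k0: "0 < k" using T N by (simp add: k)
      have "(\<Sum>l\<in>{1..N}. real l powr (2 * \<alpha> - 2)) \<le> real N powr p / p" unfolding p(3) by (rule sum_powr_le[OF p(1,2)])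
      also have "real N = T / k" using T N by (simp add: k)
      finally have "k powr (3 * \<alpha>) * (\<Sum>l\<in>{1..N}. real l powr (2 * \<alpha> - 2)) \<le> k powr (3 * \<alpha>) * ((T / k) powr p / p)" by (intro mult_left_mono) auto
      also have "\<dots> = Z * k powr (3 * \<alpha> - p)" using T k0 by (simp add: Z_def powr_divide powr_diff mult.commute)
      also have "k powr (3 * \<alpha> - p) = (k powr (3/2 - H))\<^sup>2" using \<alpha> by (simp add: p_def power2_eq_square powr_add[symmetric])
      finally show ?thesis
        by (metis abs_of_nonneg powr_ge_zero real_sqrt_abs real_sqrt_le_mono real_sqrt_mult)
    qed
    then show ?thesis using 3 Z
      by (intro exI[of _ "1 + sqrt Z"]) (auto simp: fd_rate_def min_def distrib_right)
  qed
qed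

lemma L2_le_sqrt_integral:
  assumes "L2_le P Z A"
  shows "sqrt (\<integral>w. (norm (Z w))\<^sup>2 \<partial>P) \<le> A"
  using real_sqrt_le_mono[OF L2_leD(4)[OF assms]] L2_leD(2)[OF assms] by simp

theorem mainTheorem9:
  fixes P :: "'w measure" and T \<alpha> H \<sigma> L :: real
    and x0 :: "'w \<Rightarrow> real^'d" and BH G x :: "real \<Rightarrow> 'w \<Rightarrow> real^'d"
    and b :: "real^'d \<Rightarrow> real^'d"
  assumes "prob_space P" and "0 < T" and "0 < \<alpha>" and "\<alpha> < 1"
    and "1/2 < H" and "H < 1" and "0 < \<sigma>"
    and "x0 \<in> borel_measurable P"
    and "is_fBm P H BH"
    and "\<forall>u v. norm (b u - b v) \<le> L * norm (u - v)"
    and "is_RL_fBm_integral P \<alpha> \<sigma> BH T G"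
    and "is_RL_solution P \<alpha> b x0 G T x"
  shows
   "(integrable P (\<lambda>w. (norm (x0 w))\<^sup>2 + (norm (b (x0 w)))\<^sup>2) \<longrightarrow>
      (\<exists>C. \<forall>(N::nat) \<epsilon> (M::nat) \<omega> s (X :: nat \<Rightarrow> 'w \<Rightarrow> real^'d).
         0 < N \<and> T / real N < 1 \<and> 0 < \<epsilon> \<and> \<epsilon> < 1 \<and>
         soe_approx \<alpha> (T / real N) T \<epsilon> M \<omega> s \<and>
         fast_scheme P \<alpha> T N M \<omega> s x0 b G X \<longrightarrow>
         (\<forall>n\<le>N. integrable P (\<lambda>w. (norm (X n w - x (real n * (T / real N)) w))\<^sup>2) \<and>
            sqrt (integral\<^sup>L P (\<lambda>w. (norm (X n w - x (real n * (T / real N)) w))\<^sup>2))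
              \<le> C * ((T / real N) powr (H + \<alpha> - 1) + \<epsilon>))))
    \<and>
    (\<forall>Bm :: real^'d^'d.
      \<alpha> = 2 - 2 * H \<and> b = (\<lambda>v. Bm *v v) \<and> integrable P (\<lambda>w. (norm (x0 w))\<^sup>2) \<longrightarrow>
      (\<exists>C. \<forall>(N::nat) (M::nat) \<omega> s (X :: nat \<Rightarrow> 'w \<Rightarrow> real^'d).
         0 < N \<and> T / real N < 1 \<and>
         soe_approx \<alpha> (T / real N) T ((T / real N) powr (min (3/2 - H) (3 - 3 * H))) M \<omega> s \<and>
         fast_scheme P \<alpha> T N M \<omega> s x0 b G X \<longrightarrow>
         (\<forall>n\<le>N. integrable P (\<lambda>w. (norm (X n w - x (real n * (T / real N)) w))\<^sup>2) \<and>
            sqrt (integral\<^sup>L P (\<lambda>w. (norm (X n w - x (real n * (T / real N)) w))\<^sup>2))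
              \<le> C * (if 3/4 < H then (T / real N) powr (3 - 3 * H)
                     else if H = 3/4 then sqrt \<bar>ln (T / real N)\<bar> * (T / real N) powr (3/4)
                     else (T / real N) powr (3/2 - H)))))"
proof -
  note incr = RL_fBm_increments[OF assms(1-7,9,11)]
  obtain CC where CC: "0 \<le> CC" "\<And>s t. s \<in> {0..T} \<Longrightarrow> t \<in> {0..T} \<Longrightarrow> integrable P (\<lambda>w. (norm (G t w - G s w))\<^sup>2) \<and>
        (\<integral>w. (norm (G t w - G s w))\<^sup>2 \<partial>P) \<le> CC * \<bar>t - s\<bar> powr (2 * (\<alpha> + H - 1)) \<and>
        (\<alpha> = 2 - 2*H \<longrightarrow> (\<integral>w. (norm (G t w - G s w))\<^sup>2 \<partial>P) = CC * \<bar>t - s\<bar> powr (2 * (\<alpha> + H - 1)))"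
    using incr(2) by blast
  have Gm: "G t \<in> borel_measurable P" if "t \<in> {0..T}" for t
    using assms(11) that by (auto simp: is_RL_fBm_integral_def)
  have loc: "rl_solution P T \<alpha> H (max 0 L) (sqrt CC) x0 G x b" if "integrable P (\<lambda>w. (norm (x0 w))\<^sup>2)"
  proof (rule rl_solution.intro)
    show "norm (b u - b v) \<le> max 0 L * norm (u - v)" for u v
    proof -
      have "norm (b u - b v) \<le> L * norm (u - v)" using assms(10) by blast
      also have "\<dots> \<le> max 0 L * norm (u - v)" by (intro mult_right_mono) auto
      finally show ?thesis .
    qed
    show "L2_le P (\<lambda>w. G t w - G s w) (sqrt CC * \<bar>t - s\<bar> powr (\<alpha> + H - 1))" if "s \<in> {0..T}" "t \<in> {0..T}" for s t
    proof (rule L2_leI)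
      have "(\<bar>t - s\<bar> powr (\<alpha> + H - 1))\<^sup>2 = \<bar>t - s\<bar> powr (2 * (\<alpha> + H - 1))"
        by (simp add: power2_eq_square powr_add[symmetric] algebra_simps)
      then show "(\<integral>w. (norm (G t w - G s w))\<^sup>2 \<partial>P) \<le> (sqrt CC * \<bar>t - s\<bar> powr (\<alpha> + H - 1))\<^sup>2"
        using CC that by (simp add: power_mult_distrib)
      show "(\<lambda>w. G t w - G s w) \<in> borel_measurable P" using Gm that by measurable
    qed (use CC that in auto)
    show "1 < \<alpha> + H" "AE w in P. G 0 w = 0" by (rule incr)+
    show "G t \<in> borel_measurable P" if "t \<in> {0..T}" for t using that by (rule Gm)
    show "0 \<le> sqrt CC" using CC(1) by simp
  qed (use assms(1-8,12) that in auto)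
  show ?thesis
  proof (intro conjI impI allI)
    assume int: "integrable P (\<lambda>w. (norm (x0 w))\<^sup>2 + (norm (b (x0 w)))\<^sup>2)"
    have "integrable P (\<lambda>w. (norm (x0 w))\<^sup>2)"
      by (rule Bochner_Integration.integrable_bound[OF int]) (use assms(8) in auto)
    then interpret rl_solution P T \<alpha> H "max 0 L" "sqrt CC" x0 G x b by (rule loc)
    obtain C0 where C0: "0 \<le> C0" "\<And>(N::nat) \<epsilon> (M::nat) \<omega> s X A.
     0 < N \<and> 0 < \<epsilon> \<and> \<epsilon> \<le> 1 \<and> soe_approx \<alpha> (T / real N) T \<epsilon> M \<omega> s \<and>
     fast_scheme P \<alpha> T N M \<omega> s x0 b G X \<and> (\<forall>n\<le>N. L2_le P (residual (T / real N) n) A) \<Longrightarrow>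
     (\<forall>n\<le>N. L2_le P (\<lambda>w. X n w - x (real n * (T / real N)) w) (C0 * (A + \<epsilon>)))"
      using scheme_error by blast
    obtain C1 where C1: "0 \<le> C1" "\<And>N::nat. 0 < N \<Longrightarrow> \<forall>n\<le>N. L2_le P (residual (T / real N) n) (C1 * (T / real N) powr (\<alpha> + H - 1))"
      using residual_le by blast
    show "\<exists>C. \<forall>(N::nat) \<epsilon> (M::nat) \<omega> s (X :: nat \<Rightarrow> 'w \<Rightarrow> real^'d).
         0 < N \<and> T / real N < 1 \<and> 0 < \<epsilon> \<and> \<epsilon> < 1 \<and>
         soe_approx \<alpha> (T / real N) T \<epsilon> M \<omega> s \<and>
         fast_scheme P \<alpha> T N M \<omega> s x0 b G X \<longrightarrow>
         (\<forall>n\<le>N. integrable P (\<lambda>w. (norm (X n w - x (real n * (T / real N)) w))\<^sup>2) \<and>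
            sqrt (integral\<^sup>L P (\<lambda>w. (norm (X n w - x (real n * (T / real N)) w))\<^sup>2))
              \<le> C * ((T / real N) powr (H + \<alpha> - 1) + \<epsilon>))"
    proof (intro exI[of _ "C0 * (C1 + 1)"] allI impI)
      fix N M n :: nat and \<epsilon> \<omega> s and X :: "nat \<Rightarrow> 'w \<Rightarrow> real^'d"
      assume h: "0 < N \<and> T / real N < 1 \<and> 0 < \<epsilon> \<and> \<epsilon> < 1 \<and>
         soe_approx \<alpha> (T / real N) T \<epsilon> M \<omega> s \<and> fast_scheme P \<alpha> T N M \<omega> s x0 b G X" and n: "n \<le> N"
      have L2: "L2_le P (\<lambda>w. X n w - x (real n * (T / real N)) w) (C0 * (C1 * (T / real N) powr (\<alpha> + H - 1) + \<epsilon>))"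
        using C0(2)[of N \<epsilon> M \<omega> s X] C1(2)[of N] h n by auto
      have "C1 * (T / real N) powr (\<alpha> + H - 1) + \<epsilon> \<le> (C1 + 1) * ((T / real N) powr (H + \<alpha> - 1) + \<epsilon>)"
        using C1(1) h by (simp add: algebra_simps)
      then have "C0 * (C1 * (T / real N) powr (\<alpha> + H - 1) + \<epsilon>) \<le> C0 * (C1 + 1) * ((T / real N) powr (H + \<alpha> - 1) + \<epsilon>)"
        using C0(1) by (simp add: mult.assoc mult_left_mono)
      then show "integrable P (\<lambda>w. (norm (X n w - x (real n * (T / real N)) w))\<^sup>2) \<and>
            sqrt (integral\<^sup>L P (\<lambda>w. (norm (X n w - x (real n * (T / real N)) w))\<^sup>2))
              \<le> C0 * (C1 + 1) * ((T / real N) powr (H + \<alpha> - 1) + \<epsilon>)"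
        using L2_leD(3)[OF L2] L2_le_sqrt_integral[OF L2] by linarith
    qed
  next
    fix Bm :: "real^'d^'d"
    assume h0: "\<alpha> = 2 - 2 * H \<and> b = (\<lambda>v. Bm *v v) \<and> integrable P (\<lambda>w. (norm (x0 w))\<^sup>2)"
    interpret rl_solution P T \<alpha> H "max 0 L" "sqrt CC" x0 G x b by (rule loc) (use h0 in blast)
    interpret rl_solution_fd P T \<alpha> H "max 0 L" "sqrt CC" x0 G x b Bm
    proof
      show "\<alpha> = 2 - 2 * H" "b = (\<lambda>v. Bm *v v)" using h0 by auto
      show "(\<integral>w. (norm (G t w - G s w))\<^sup>2 \<partial>P) = (sqrt CC)\<^sup>2 * \<bar>t - s\<bar> powr \<alpha>" if "s \<in> {0..T}" "t \<in> {0..T}" for s t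
      proof -
        have "2 * (\<alpha> + H - 1) = \<alpha>" using h0 by simp
        then show ?thesis using CC(2)[OF that] CC(1) h0 by simp
      qed
    qed
    obtain C0 where C0: "0 \<le> C0" "\<And>(N::nat) \<epsilon> (M::nat) \<omega> s X A.
     0 < N \<and> 0 < \<epsilon> \<and> \<epsilon> \<le> 1 \<and> soe_approx \<alpha> (T / real N) T \<epsilon> M \<omega> s \<and>
     fast_scheme P \<alpha> T N M \<omega> s x0 b G X \<and> (\<forall>n\<le>N. L2_le P (residual (T / real N) n) A) \<Longrightarrow>
     (\<forall>n\<le>N. L2_le P (\<lambda>w. X n w - x (real n * (T / real N)) w) (C0 * (A + \<epsilon>)))"
      using scheme_error by blast
    obtain C1 where C1: "0 \<le> C1" "\<And>(N::nat) n. 0 < N \<and> n \<le> N \<Longrightarrow> L2_le P (residual (T / real N) n)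
      (C1 * ((T / real N) powr \<beta> + sqrt ((T / real N) powr (3 * \<alpha>) * (\<Sum>l\<in>{1..N}. real l powr (2 * \<alpha> - 2)))))"
      using residual_fd by blast
    obtain C2 where C2: "0 \<le> C2" "\<And>N::nat. 0 < N \<and> T / real N < 1 \<Longrightarrow>
      (T / real N) powr \<beta> + sqrt ((T / real N) powr (3 * \<alpha>) * (\<Sum>l\<in>{1..N}. real l powr (2 * \<alpha> - 2))) \<le> C2 * fd_rate H (T / real N)"
      using fd_rate_bound[OF assms(2,5,6)] h0 unfolding \<beta>_def by blast
    show "\<exists>C. \<forall>(N::nat) (M::nat) \<omega> s (X :: nat \<Rightarrow> 'w \<Rightarrow> real^'d).
         0 < N \<and> T / real N < 1 \<and>
         soe_approx \<alpha> (T / real N) T ((T / real N) powr (min (3/2 - H) (3 - 3 * H))) M \<omega> s \<and>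
         fast_scheme P \<alpha> T N M \<omega> s x0 b G X \<longrightarrow>
         (\<forall>n\<le>N. integrable P (\<lambda>w. (norm (X n w - x (real n * (T / real N)) w))\<^sup>2) \<and>
            sqrt (integral\<^sup>L P (\<lambda>w. (norm (X n w - x (real n * (T / real N)) w))\<^sup>2))
              \<le> C * (if 3/4 < H then (T / real N) powr (3 - 3 * H)
                     else if H = 3/4 then sqrt \<bar>ln (T / real N)\<bar> * (T / real N) powr (3/4)
                     else (T / real N) powr (3/2 - H)))"
      unfolding fd_rate_def[symmetric] \<beta>_def[symmetric]
    proof (intro exI[of _ "C0 * ((C1 + 1) * C2)"] allI impI)
      fix N M n :: nat and \<omega> s and X :: "nat \<Rightarrow> 'w \<Rightarrow> real^'d"
      assume h: "0 < N \<and> T / real N < 1 \<and> soe_approx \<alpha> (T / real N) T ((T / real N) powr \<beta>) M \<omega> s \<and>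
         fast_scheme P \<alpha> T N M \<omega> s x0 b G X" and n: "n \<le> N"
      define k where "k = T / real N"
      define S where "S = sqrt (k powr (3 * \<alpha>) * (\<Sum>l\<in>{1..N}. real l powr (2 * \<alpha> - 2)))"
      have S: "0 \<le> S" by (simp add: S_def sum_nonneg)
      have k: "0 < k" "k < 1" using h assms(2) by (auto simp: k_def)
      then have "0 < k powr \<beta>" "k powr \<beta> \<le> 1" using \<beta> by (auto intro: powr_le1)
      then have L2: "L2_le P (\<lambda>w. X n w - x (real n * (T / real N)) w) (C0 * (C1 * (k powr \<beta> + S) + k powr \<beta>))"
        using C0(2)[of N "k powr \<beta>" M \<omega> s X "C1 * (k powr \<beta> + S)"] C1(2)[of N] h n
        unfolding S_def k_def by auto
      have "C1 * (k powr \<beta> + S) + k powr \<beta> \<le> (C1 + 1) * (k powr \<beta> + S)" using S by (simp add: algebra_simps)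
      also have "\<dots> \<le> (C1 + 1) * (C2 * fd_rate H k)"
        using C2(2)[of N] h C1(1) unfolding S_def k_def by (intro mult_left_mono) auto
      finally have "C0 * (C1 * (k powr \<beta> + S) + k powr \<beta>) \<le> C0 * ((C1 + 1) * C2) * fd_rate H (T / real N)"
        using C0(1) by (simp add: mult.assoc mult_left_mono k_def)
      then show "integrable P (\<lambda>w. (norm (X n w - x (real n * (T / real N)) w))\<^sup>2) \<and>
            sqrt (integral\<^sup>L P (\<lambda>w. (norm (X n w - x (real n * (T / real N)) w))\<^sup>2))
              \<le> C0 * ((C1 + 1) * C2) * fd_rate H (T / real N)"
        using L2_leD(3)[OF L2] L2_le_sqrt_integral[OF L2] by linarith
    qed
  qed
qed

end
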